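(* Let $\lambda,\mu$ be partitions with $\widetilde\lambda_1\le n$ and $\widetilde\mu_1\le n$, and let $v_\mu$ be the canonical highest weight vector of the irreducible $gl(n)$-module $Schur_{\widetilde\mu}(n)$ with highest weight $\mu$. Then: if $|\mu|<|\lambda|$, then $\mathbf S_\lambda(n)\cdot v_\mu=0$; if $|\mu|=|\lambda|$, then $\mathbf S_\lambda(n)\cdot v_\mu=\delta_{\lambda,\mu}\,H(\lambda)\,v_\lambda$.
   Context: Virtual symbols. Let $\mathcal L=\{1,\dots,n\}$, and let $\mathcal A_0=\{\alpha_1,\dots,\alpha_{m_0}\}$, $\mathcal A_1=\{\beta_1,\dots,\beta_{m_1}\}$ be finite sets of auxiliary (virtual) symbols, with $m_0,m_1$ sufficiently large. Put $|a|=0\in\mathbb Z_2$ for $a\in\mathcal A_0$ and $|a|=1\in\mathbb Z_2$ for $a\in\mathcal A_1\cup\mathcal L$. Let $gl(m_0|m_1+n)$ be the complex Lie superalgebra with basis $e_{a,b}$, $a,b\in\mathcal A_0\cup\mathcal A_1\cup\mathcal L$, $|e_{a,b}|=|a|+|b|$, and superbracket $[e_{a,b},e_{c,d}]=\delta_{bc}e_{a,d}-(-1)^{(|a|+|b|)(|c|+|d|)}\delta_{ad}e_{c,b}$. Its enveloping superalgebra $\mathbf U(gl(m_0|m_1+n))$ contains $\mathbf U(gl(n))$ as the subalgebra generated by $e_{i,j}$, $i,j\in\mathcal L$. Devirtualization. A product $e_{a_m,b_m}\cdots e_{a_1,b_1}$ is irregular if there are $i\le m$ and a virtual symbol $\gamma\in\mathcal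 A_0\cup\mathcal A_1$ with $\#\{j\le i: b_j=\gamma\}>\#\{j<i: a_j=\gamma\}$. Let $\mathbf{Irr}$ be the left ideal of $\mathbf U(gl(m_0|m_1+n))$ generated by the irregular products. The sum $Virt=\mathbf U(gl(n))+\mathbf{Irr}$ is direct and is a subalgebra, in which $\mathbf{Irr}$ is a two-sided ideal; $\mathfrak p:Virt\to\mathbf U(gl(n))$ denotes the projection with kernel $\mathbf{Irr}$ (an algebra epimorphism). Tableaux. A Young tableau of shape $\lambda$ over an alphabet is any filling of the cells of the Ferrers diagram of $\lambda$ (rows of lengths $\lambda_1\ge\lambda_2\ge\cdots$). For tableaux $S,T$ of the same shape, $e_{S,T}$ is the product of the $e_{S(c),T(c)}$ over the cells $c$, read row by row from top to bottom, left to right in each row. $D^*_\lambda$ is the tableau of shape $\lambda$ whose $r$-th row is $\beta_1\beta_2\cdots\beta_{\lambda_r}$, and $C^*_\lambda$ the tableau of shape $\lambda$ whose $r$-th row is $\alpha_r\alpha_r\cdots\alpha_r$ (the $\alpha$'s and $\beta$'s being arbitrary distinct positive, resp. negative, virtual symbols). For tableaux $S,T$ of shape $\lambda$ over $\mathcal L$, the double Young-Capelli bitableau is $[\,\boxed{S\,|\,T}\,]=\mathfrak p\big(e_{S,C^*_\lambda}e_{C^*_\lambda,D^*_\lambda}e_{D^*_\lambda,C^*_\lambda}e_{C^*_\lambda,T}\big)\in\mathbf U(gl(n))$; the argument of $\mathfrak p$ lies in $Virt$ and the result does not depend on the choice of virtual symbols. Schur elements. $\widetilde\lambda$ is the conjugate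 partition and $H(\lambda)=H(\widetilde\lambda)$ the product of the hook lengths of all boxes of the Ferrers diagram. For $\widetilde\lambda_1\le n$, $\mathbf S_\lambda(n)=\frac1{H(\widetilde\lambda)}\sum_S[\,\boxed{S\,|\,S}\,]\in\mathbf U(gl(n))$, the sum over all tableaux $S$ of shape $\widetilde\lambda$ on $\mathcal L$ with strictly increasing rows (no condition on columns); $\mathbf S_\emptyset(n)=\mathbf 1$. Schur modules. Let $\mathbb C[M_{n,d}]$ be the polynomial algebra in commuting variables $(i|j)$, $1\le i\le n$, $1\le j\le d$, with $gl(n)$ acting by derivations, $e_{i,j}\cdot(k|t)=\delta_{jk}(i|t)$, and $d$ sufficiently large. For a partition $\nu$ with $\nu_1\le n$, $Schur_\nu(n)\subset\mathbb C[M_{n,d}]$ is the span of all products $\prod_r\det[(X_{r,s}|t)]_{s,t=1,\dots,\nu_r}$, $X=(X_{r,s})$ any tableau of shape $\nu$ over $\mathcal L$; it is an irreducible $gl(n)$-module with highest weight $\widetilde\nu$. Its canonical highest weight vector $v_{\widetilde\nu}$ is, up to a fixed sign, $\prod_r\det[(s|t)]_{s,t=1,\dots,\nu_r}$. *)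

theory Defs
  imports
    "HOL-Library.Poly_Mapping"
    "HOL-Library.Cardinality"
    "Jordan_Normal_Form.Determinant"
begin

section \<open>Free associative algebras\<close>

datatype 'a word = Word (letters: "'a list")

instantiation word :: (type) monoid_add
begin

definition zero_word :: "'a word" where "0 = Word []"

definition plus_word :: "'a word \<Rightarrow> 'a word \<Rightarrow> 'a word"
  where "u + v = Word (letters u @ letters v)"

instance
  by standard (auto simp: zero_word_def plus_word_def)

end

type_synonym 'a free_algebra = "'a word \<Rightarrow>\<^sub>0 complex"

definition free_gen :: "'a \<Rightarrow> 'a free_algebra"
  where "free_gen x = Poly_Mapping.single (Word [x]) 1"

lemma poly_mapping_sum_single:
  fixes x :: "'a \<Rightarrow>\<^sub>0 'b::comm_monoid_add"
  shows "x = (\<Sum>w\<in>Poly_Mapping.keys x. Poly_Mapping.single w (Poly_Mapping.lookup x w))"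
proof (rule poly_mapping_eqI)
  fix k
  have "Poly_Mapping.lookup (\<Sum>w\<in>Poly_Mapping.keys x. Poly_Mapping.single w (Poly_Mapping.lookup x w)) k
      = (\<Sum>w\<in>Poly_Mapping.keys x. if w = k then Poly_Mapping.lookup x w else 0)"
    by (simp add: lookup_sum lookup_single when_def)
  also have "\<dots> = Poly_Mapping.lookup x k"
    by (simp add: in_keys_iff)
  finally show "Poly_Mapping.lookup x k
      = Poly_Mapping.lookup (\<Sum>w\<in>Poly_Mapping.keys x. Poly_Mapping.single w (Poly_Mapping.lookup x w)) k"
    by simp
qed

lemma poly_mapping_add_induct [case_names single add]:
  fixes x :: "'a \<Rightarrow>\<^sub>0 'b::comm_monoid_add"
  assumes single: "\<And>k c. P (Poly_Mapping.single k c)"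
    and add: "\<And>x y. P x \<Longrightarrow> P y \<Longrightarrow> P (x + y)"
  shows "P x"
proof -
  have "P (\<Sum>w\<in>A. Poly_Mapping.single w (f w))" if "finite A" for A and f :: "'a \<Rightarrow> 'b"
    using that
  proof (induction A)
    case empty
    show ?case using single[of undefined 0] by simp
  next
    case (insert a A)
    then show ?case by (simp add: single add)
  qed
  then show ?thesis by (subst poly_mapping_sum_single) simp
qed

section \<open>The enveloping superalgebra of a general linear Lie superalgebra\<close>

text \<open>The parity of a symbol is an element of \<open>\<int>\<^sub>2\<close>, represented by 0 or 1;
  it is only ever used in exponents of -1.\<close>

class graded_symbol =
  fixes parity :: "'a \<Rightarrow> nat"
  assumes parity_le_1: "parity a \<le> 1"

definition super_sign :: "'s::graded_symbol \<times> 's \<Rightarrow> 's \<times> 's \<Rightarrow> 'r::ring_1"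
  where "super_sign x y =
    (- 1) ^ ((parity (fst x) + parity (snd x)) * (parity (fst y) + parity (snd y)))"

definition super_bracket :: "'s::graded_symbol \<times> 's \<Rightarrow> 's \<times> 's \<Rightarrow> ('s \<times> 's) free_algebra"
  where "super_bracket x y = (case (x, y) of ((a, b), (c, d)) \<Rightarrow>
    of_bool (b = c) * free_gen (a, d) - super_sign x y * of_bool (a = d) * free_gen (c, b))"

definition gl_relation :: "'s::graded_symbol \<times> 's \<Rightarrow> 's \<times> 's \<Rightarrow> ('s \<times> 's) free_algebra"
  where "gl_relation x y =
    free_gen x * free_gen y - super_sign x y * (free_gen y * free_gen x) - super_bracket x y"

inductive_set gl_ideal :: "('s::graded_symbol \<times> 's) free_algebra set" where
  zero: "0 \<in> gl_ideal"
| gen: "u * gl_relation x y * v \<in> gl_ideal"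
| add: "p \<in> gl_ideal \<Longrightarrow> q \<in> gl_ideal \<Longrightarrow> p + q \<in> gl_ideal"

lemma gl_ideal_mult_left: "p \<in> gl_ideal \<Longrightarrow> w * p \<in> gl_ideal"
proof (induction rule: gl_ideal.induct)
  case (gen u x y v)
  have "w * (u * gl_relation x y * v) = (w * u) * gl_relation x y * v"
    by (simp add: mult.assoc)
  then show ?case using gl_ideal.gen by metis
qed (auto simp: distrib_left intro: gl_ideal.intros)

lemma gl_ideal_mult_right: "p \<in> gl_ideal \<Longrightarrow> p * w \<in> gl_ideal"
proof (induction rule: gl_ideal.induct)
  case (gen u x y v)
  have "(u * gl_relation x y * v) * w = u * gl_relation x y * (v * w)"
    by (simp add: mult.assoc)
  then show ?case using gl_ideal.gen by metis
qed (auto simp: distrib_right intro: gl_ideal.intros)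

lemma gl_ideal_uminus: "p \<in> gl_ideal \<Longrightarrow> - p \<in> gl_ideal"
  using gl_ideal_mult_left[of p "- 1"] by simp

lemma gl_ideal_diff: "p \<in> gl_ideal \<Longrightarrow> q \<in> gl_ideal \<Longrightarrow> p - q \<in> gl_ideal"
  using gl_ideal.add[of p "- q"] gl_ideal_uminus[of q] by simp

text \<open>The enveloping superalgebra of the general linear Lie superalgebra with basis
  \<open>e\<^bsub>a,b\<^esub>\<close>, where \<open>a\<close> and \<open>b\<close> range over all elements of the type of symbols.\<close>

quotient_type (overloaded) 's env = "('s::graded_symbol \<times> 's) free_algebra"
  / "\<lambda>p q. p - q \<in> gl_ideal"
proof (rule equivpI)
  show "reflp (\<lambda>p q :: ('s \<times> 's) free_algebra. p - q \<in> gl_ideal)"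
    by (auto intro!: reflpI gl_ideal.zero)
  show "symp (\<lambda>p q :: ('s \<times> 's) free_algebra. p - q \<in> gl_ideal)"
    by (rule sympI) (metis gl_ideal_uminus minus_diff_eq)
  show "transp (\<lambda>p q :: ('s \<times> 's) free_algebra. p - q \<in> gl_ideal)"
  proof (rule transpI)
    fix p q r :: "('s \<times> 's) free_algebra"
    assume "p - q \<in> gl_ideal" "q - r \<in> gl_ideal"
    then show "p - r \<in> gl_ideal"
      using gl_ideal.add[of "p - q" "q - r"] by simp
  qed
qed

lemma lookup_zero_word_mult:
  "Poly_Mapping.lookup (p * q :: 'a free_algebra) 0 =
    Poly_Mapping.lookup p 0 * Poly_Mapping.lookup q 0"
proof (induction p rule: poly_mapping_add_induct)
  case (single k c)
  show ?case
  proof (induction q rule: poly_mapping_add_induct)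
    case (single l d)
    show ?case
      by (cases k; cases l) (auto simp: mult_single lookup_single when_def zero_word_def plus_word_def)
  qed (simp add: distrib_left lookup_add)
qed (simp add: distrib_right lookup_add)

lemma lookup_zero_word_free_gen: "Poly_Mapping.lookup (free_gen x) 0 = 0"
  by (simp add: free_gen_def lookup_single zero_word_def)

lemma gl_ideal_lookup_zero_word: "p \<in> gl_ideal \<Longrightarrow> Poly_Mapping.lookup p 0 = 0"
  by (induction rule: gl_ideal.induct)
    (auto simp: lookup_zero_word_mult lookup_add gl_relation_def super_bracket_def lookup_minus
       lookup_zero_word_free_gen split: prod.splits)

instantiation env :: (graded_symbol) ring_1
begin

lift_definition zero_env :: "'a env" is 0 .

lift_definition one_env :: "'a env" is 1 .

lift_definition plus_env :: "'a env \<Rightarrow> 'a env \<Rightarrow> 'a env" is "(+)"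
  by (metis add_diff_add gl_ideal.add)

lift_definition minus_env :: "'a env \<Rightarrow> 'a env \<Rightarrow> 'a env" is "(-)"
proof -
  fix p p' q q' :: "('a \<times> 'a) free_algebra"
  assume "p - p' \<in> gl_ideal" "q - q' \<in> gl_ideal"
  then have "(p - p') - (q - q') \<in> gl_ideal" by (rule gl_ideal_diff)
  then show "p - q - (p' - q') \<in> gl_ideal" by (simp add: algebra_simps)
qed

lift_definition uminus_env :: "'a env \<Rightarrow> 'a env" is uminus
  by (metis gl_ideal_uminus minus_diff_minus)

lift_definition times_env :: "'a env \<Rightarrow> 'a env \<Rightarrow> 'a env" is "(*)"
proof -
  fix p p' q q' :: "('a \<times> 'a) free_algebra"
  assume "p - p' \<in> gl_ideal" "q - q' \<in> gl_ideal"
  then have "(p - p') * q + p' * (q - q') \<in> gl_ideal"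
    by (intro gl_ideal.add gl_ideal_mult_left gl_ideal_mult_right)
  then show "p * q - p' * q' \<in> gl_ideal" by (simp add: algebra_simps)
qed

instance
proof
  show "(0 :: 'a env) \<noteq> 1"
    by transfer (use gl_ideal_lookup_zero_word in fastforce)
qed (transfer, simp add: algebra_simps gl_ideal.zero)+

end

lift_definition gl_e :: "'s::graded_symbol \<Rightarrow> 's \<Rightarrow> 's env"
  is "\<lambda>a b. free_gen (a, b)" .

lift_definition scale_env :: "complex \<Rightarrow> 's::graded_symbol env \<Rightarrow> 's env"
  is "\<lambda>c p. Poly_Mapping.single 0 c * p"
  by (metis gl_ideal_mult_left right_diff_distrib)

section \<open>Proper and virtual symbols\<close>

text \<open>The proper symbols \<open>\<L> = {1, \<dots>, n}\<close> are the elements of a finite linearly ordered type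
  \<open>'l\<close>, so \<open>n = CARD('l)\<close>; the positive and the negative virtual symbols are the elements of
  \<open>'p\<close> and \<open>'q\<close>, so \<open>m\<^sub>0 = CARD('p)\<close> and \<open>m\<^sub>1 = CARD('q)\<close>. The constructor
  \<open>Letter\<close> only serves to attach a parity to the elements of an arbitrary type \<open>'l\<close>.\<close>

datatype 'l letter = Letter (the_letter: 'l)

instantiation letter :: (type) graded_symbol
begin
definition parity_letter :: "'a letter \<Rightarrow> nat" where "parity_letter a = 1"
instance by standard (simp add: parity_letter_def)
end

datatype ('p, 'q, 'l) symbol = Pos 'p | Neg 'q | Proper "'l letter"

instantiation symbol :: (type, type, type) graded_symbol
begin
definition parity_symbol :: "('a, 'b, 'c) symbol \<Rightarrow> nat"
  where "parity_symbol a = (case a of Pos _ \<Rightarrow> 0 | Neg _ \<Rightarrow> 1 | Proper x \<Rightarrow> parity x)"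
instance by standard (simp add: parity_symbol_def parity_letter_def split: symbol.split)
end

definition virtual :: "('p, 'q, 'l) symbol \<Rightarrow> bool"
  where "virtual a \<longleftrightarrow> (case a of Proper _ \<Rightarrow> False | _ \<Rightarrow> True)"

text \<open>Hence \<open>'l letter env\<close> is \<open>U(gl(n))\<close> (all signs in its relations are +1), and
  \<open>('p, 'q, 'l) symbol env\<close> is \<open>U(gl(m\<^sub>0|m\<^sub>1+n))\<close>. The inclusion of the former into the
  latter is induced by \<open>e\<^bsub>i,j\<^esub> \<mapsto> e\<^bsub>i,j\<^esub>\<close>; it is injective by the
  Poincare-Birkhoff-Witt theorem, which is not needed for the definitions.\<close>

definition map_free :: "('a \<Rightarrow> 'b) \<Rightarrow> 'a free_algebra \<Rightarrow> 'b free_algebra"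
  where "map_free f p =
    (\<Sum>w\<in>Poly_Mapping.keys p. Poly_Mapping.single (map_word f w) (Poly_Mapping.lookup p w))"

lemma map_free_add: "map_free f (p + q) = map_free f p + map_free f q"
  unfolding map_free_def by (rule setsum_keys_plus_distrib) (simp_all add: single_add)

lemma map_free_0 [simp]: "map_free f 0 = 0"
  by (simp add: map_free_def)

lemma map_free_single:
  "map_free f (Poly_Mapping.single w c) = Poly_Mapping.single (map_word f w) c"
  by (simp add: map_free_def)

lemma map_free_mult: "map_free f (p * q) = map_free f p * map_free f q"
proof (induction p rule: poly_mapping_add_induct)
  case (single k c)
  show ?case
  proof (induction q rule: poly_mapping_add_induct)
    case (single l d)
    show ?case
      by (cases k; cases l) (simp add: mult_single map_free_single plus_word_def)
  qed (simp add: distrib_left map_free_add)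
qed (simp add: distrib_right map_free_add)

lemma map_free_1 [simp]: "map_free f 1 = 1"
  by (metis list.simps(8) map_free_single single_one word.map zero_word_def)

lemma map_free_uminus: "map_free f (- p) = - map_free f p"
  using map_free_add[of f p "- p"] by (simp add: add_eq_0_iff)

lemma map_free_diff: "map_free f (p - q) = map_free f p - map_free f q"
  using map_free_add[of f p "- q"] by (simp add: map_free_uminus)

lemma map_free_gen: "map_free f (free_gen x) = free_gen (f x)"
  by (simp add: free_gen_def map_free_single)

lemma map_free_power: "map_free f (p ^ k) = map_free f p ^ k"
  by (induction k) (simp_all add: map_free_mult)

lemma map_free_gl_relation:
  "map_free (map_prod Proper Proper) (gl_relation x y) =
    gl_relation (map_prod Proper Proper x) (map_prod Proper Proper y)"
  by (cases x; cases y)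
    (simp add: gl_relation_def super_bracket_def super_sign_def map_free_diff map_free_mult
      map_free_gen map_free_power map_free_uminus of_bool_def parity_symbol_def)

lemma map_free_gl_ideal: "p \<in> gl_ideal \<Longrightarrow> map_free (map_prod Proper Proper) p \<in> gl_ideal"
  by (induction rule: gl_ideal.induct)
    (auto simp: map_free_add map_free_mult map_free_gl_relation intro: gl_ideal.intros)

lift_definition incl :: "'l letter env \<Rightarrow> ('p, 'q, 'l) symbol env"
  is "map_free (map_prod Proper Proper)"
  by (metis map_free_diff map_free_gl_ideal)

section \<open>Devirtualization\<close>

definition e_word :: "('s::graded_symbol \<times> 's) list \<Rightarrow> 's env"
  where "e_word w = prod_list (map (\<lambda>(a, b). gl_e a b) w)"

text \<open>The list \<open>w\<close> stands for \<open>e\<^bsub>a\<^sub>m,b\<^sub>m\<^esub> \<cdots> e\<^bsub>a\<^sub>1,b\<^sub>1\<^esub>\<close> as written, so the pair with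
  index \<open>j\<close> in the usual numbering from the right is \<open>rev w ! (j - 1)\<close>.\<close>

definition irregular :: "(('p, 'q, 'l) symbol \<times> ('p, 'q, 'l) symbol) list \<Rightarrow> bool"
  where "irregular w \<longleftrightarrow> (\<exists>i<length w. \<exists>\<gamma>. virtual \<gamma> \<and>
    card {j. j \<le> i \<and> snd (rev w ! j) = \<gamma>} > card {j. j < i \<and> fst (rev w ! j) = \<gamma>})"

inductive_set Irr :: "('p, 'q, 'l) symbol env set" where
  zero: "0 \<in> Irr"
| gen: "irregular w \<Longrightarrow> x * e_word w \<in> Irr"
| add: "x \<in> Irr \<Longrightarrow> y \<in> Irr \<Longrightarrow> x + y \<in> Irr"

text \<open>The \<open>U(gl(n))\<close>-component of an element of \<open>Virt = U(gl(n)) + Irr\<close>;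
  it is unique as this sum is direct.\<close>

definition devirt :: "('p, 'q, 'l) symbol env \<Rightarrow> 'l letter env"
  where "devirt x = (SOME u. x - incl u \<in> Irr)"

section \<open>Partitions and tableaux\<close>

definition is_partition :: "nat list \<Rightarrow> bool"
  where "is_partition lam \<longleftrightarrow> sorted_wrt (\<ge>) lam \<and> 0 \<notin> set lam"

definition row_length :: "nat list \<Rightarrow> nat \<Rightarrow> nat"
  where "row_length lam i = (if i < length lam then lam ! i else 0)"

definition conjugate_partition :: "nat list \<Rightarrow> nat list"
  where "conjugate_partition lam = map (\<lambda>j. card {i. i < length lam \<and> j < lam ! i}) [0..<row_length lam 0]"

text \<open>Arm length plus leg length plus one, for each box; rows and columns are numbered from 0.\<close>

definition hook_product :: "nat list \<Rightarrow> nat"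
  where "hook_product lam = (\<Prod>i<length lam. \<Prod>j<lam ! i.
    (lam ! i - j - 1) + (conjugate_partition lam ! j - i - 1) + 1)"

text \<open>A tableau is the list of its rows.\<close>

definition tableaux :: "nat list \<Rightarrow> 'a list list set"
  where "tableaux nu = {S. map length S = nu}"

definition row_strict_tableaux :: "nat list \<Rightarrow> 'a::linorder list list set"
  where "row_strict_tableaux nu = {S \<in> tableaux nu. \<forall>r\<in>set S. sorted_wrt (<) r}"

lemma finite_tableaux: "finite (tableaux nu :: 'a::finite list list set)"
proof (induction nu)
  case Nil
  show ?case by (simp add: tableaux_def)
next
  case (Cons k nu)
  have "tableaux (k # nu) \<subseteq>
      (\<lambda>(r, S). r # S) ` ({r :: 'a list. set r \<subseteq> UNIV \<and> length r = k} \<times> tableaux nu)"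
    by (auto simp: tableaux_def Cons_eq_map_conv map_eq_Cons_conv image_iff)
  moreover have "finite {r :: 'a list. set r \<subseteq> UNIV \<and> length r = k}"
    by (rule finite_lists_length_eq) simp
  ultimately show ?case
    using Cons.IH by (meson finite_SigmaI finite_imageI finite_subset)
qed

lemma finite_row_strict_tableaux:
  "finite (row_strict_tableaux nu :: 'a::{finite, linorder} list list set)"
  by (simp add: row_strict_tableaux_def finite_tableaux)

definition e_tableau :: "'s::graded_symbol list list \<Rightarrow> 's list list \<Rightarrow> 's env"
  where "e_tableau S T = e_word (zip (concat S) (concat T))"

text \<open>Virtual symbols are numbered from 0 here; \<open>\<alpha>\<close> and \<open>\<beta>\<close> are arbitrary
  choices, which have to be injective on the indices that occur.\<close>

definition D_star :: "(nat \<Rightarrow> 'q) \<Rightarrow> nat list \<Rightarrow> ('p, 'q, 'l) symbol list list"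
  where "D_star \<beta> nu = map (\<lambda>k. map (\<lambda>j. Neg (\<beta> j)) [0..<k]) nu"

definition C_star :: "(nat \<Rightarrow> 'p) \<Rightarrow> nat list \<Rightarrow> ('p, 'q, 'l) symbol list list"
  where "C_star \<alpha> nu = map (\<lambda>r. replicate (nu ! r) (Pos (\<alpha> r))) [0..<length nu]"

definition proper_tableau :: "'l list list \<Rightarrow> ('p, 'q, 'l) symbol list list"
  where "proper_tableau S = map (map (\<lambda>i. Proper (Letter i))) S"

definition double_young_capelli ::
    "(nat \<Rightarrow> 'p) \<Rightarrow> (nat \<Rightarrow> 'q) \<Rightarrow> nat list \<Rightarrow> 'l list list \<Rightarrow> 'l list list \<Rightarrow> 'l letter env"
  where "double_young_capelli \<alpha> \<beta> nu S T = devirt (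
    e_tableau (proper_tableau S) (C_star \<alpha> nu) * e_tableau (C_star \<alpha> nu) (D_star \<beta> nu) *
    e_tableau (D_star \<beta> nu) (C_star \<alpha> nu) * e_tableau (C_star \<alpha> nu) (proper_tableau T)
    :: ('p, 'q, 'l) symbol env)"

definition schur_element ::
    "(nat \<Rightarrow> 'p) \<Rightarrow> (nat \<Rightarrow> 'q) \<Rightarrow> nat list \<Rightarrow> 'l::{finite, linorder} letter env"
  where "schur_element \<alpha> \<beta> lam = (if lam = [] then 1 else
    scale_env (1 / of_nat (hook_product (conjugate_partition lam)))
      (\<Sum>S\<in>row_strict_tableaux (conjugate_partition lam).
        double_young_capelli \<alpha> \<beta> (conjugate_partition lam) S S))"

section \<open>The action on polynomials\<close>

text \<open>Polynomials in the variables \<open>(i|t)\<close>, with \<open>i\<close> in \<open>'l\<close> and \<open>t\<close> in a finite linearly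
  ordered type \<open>'d\<close> of columns, so \<open>d = CARD('d)\<close>.\<close>

type_synonym ('l, 'd) polys = "(('l \<times> 'd) \<Rightarrow>\<^sub>0 nat) \<Rightarrow>\<^sub>0 complex"

definition poly_const :: "complex \<Rightarrow> ('l, 'd) polys"
  where "poly_const c = Poly_Mapping.single 0 c"

definition poly_var :: "'l \<Rightarrow> 'd \<Rightarrow> ('l, 'd) polys"
  where "poly_var i t = Poly_Mapping.single (Poly_Mapping.single (i, t) 1) 1"

definition pdiff :: "'l \<Rightarrow> 'd \<Rightarrow> ('l, 'd) polys \<Rightarrow> ('l, 'd) polys"
  where "pdiff i t f = (\<Sum>m\<in>Poly_Mapping.keys f.
    Poly_Mapping.single (m - Poly_Mapping.single (i, t) 1)
      (of_nat (Poly_Mapping.lookup m (i, t)) * Poly_Mapping.lookup f m))"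

text \<open>The derivation with \<open>(k|t) \<mapsto> \<delta>\<^bsub>jk\<^esub> (i|t)\<close>.\<close>

definition polarization :: "'l \<Rightarrow> 'l \<Rightarrow> ('l, 'd::finite) polys \<Rightarrow> ('l, 'd) polys"
  where "polarization i j f = (\<Sum>t\<in>UNIV. poly_var i t * pdiff j t f)"

lemma pdiff_add: "pdiff i t (f + g) = pdiff i t f + pdiff i t g"
  unfolding pdiff_def
  by (rule setsum_keys_plus_distrib) (simp_all add: single_add[symmetric] distrib_left)

lemma pdiff_0 [simp]: "pdiff i t 0 = 0"
  by (simp add: pdiff_def)

lemma pdiff_single:
  "pdiff i t (Poly_Mapping.single m c) = Poly_Mapping.single (m - Poly_Mapping.single (i, t) 1)
    (of_nat (Poly_Mapping.lookup m (i, t)) * c)"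
  by (simp add: pdiff_def)

lemma exponent_minus_add:
  fixes m m' :: "'a \<Rightarrow>\<^sub>0 nat"
  assumes "Poly_Mapping.lookup m v \<noteq> 0"
  shows "m + m' - Poly_Mapping.single v 1 = (m - Poly_Mapping.single v 1) + m'"
  using assms
  by (intro poly_mapping_eqI) (auto simp: lookup_add lookup_minus lookup_single when_def)

lemma pdiff_mult: "pdiff i t (f * g) = pdiff i t f * g + f * pdiff i t g"
proof (induction f rule: poly_mapping_add_induct)
  case (single m c)
  show ?case
  proof (induction g rule: poly_mapping_add_induct)
    case (single m' c')
    let ?u = "Poly_Mapping.single (i, t) (1::nat)"
    have 1: "Poly_Mapping.single (m - ?u) (of_nat (Poly_Mapping.lookup m (i, t)) * c) *
        Poly_Mapping.single m' c' =
      Poly_Mapping.single (m + m' - ?u) (of_nat (Poly_Mapping.lookup m (i, t)) * c * c')"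
      by (cases "Poly_Mapping.lookup m (i, t) = 0") (simp_all add: mult_single exponent_minus_add[symmetric] del: One_nat_def)
    have 2: "Poly_Mapping.single m c *
        Poly_Mapping.single (m' - ?u) (of_nat (Poly_Mapping.lookup m' (i, t)) * c') =
      Poly_Mapping.single (m + m' - ?u) (c * (of_nat (Poly_Mapping.lookup m' (i, t)) * c'))"
      using exponent_minus_add[of m' "(i, t)" m]
      by (cases "Poly_Mapping.lookup m' (i, t) = 0") (simp_all add: mult_single add.commute del: One_nat_def)
    show ?case
      by (simp only: pdiff_single 1 2 single_add[symmetric] mult_single[of m c m' c'])
        (simp add: lookup_add algebra_simps)
  qed (simp add: distrib_left pdiff_add)
qed (simp add: distrib_right pdiff_add)

lemma pdiff_var: "pdiff i t (poly_var k s) = of_bool (i = k \<and> t = s)"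
  by (auto simp: poly_var_def pdiff_single lookup_single when_def)

lemma pdiff_const [simp]: "pdiff i t (poly_const c) = 0"
  by (simp add: poly_const_def pdiff_single)

lemma pdiff_commute: "pdiff i t (pdiff j s f) = pdiff j s (pdiff i t f)"
proof (induction f rule: poly_mapping_add_induct)
  case (single m c)
  have "m - Poly_Mapping.single (j, s) 1 - Poly_Mapping.single (i, t) 1 =
      m - Poly_Mapping.single (i, t) 1 - Poly_Mapping.single (j, s) 1"
    by (intro poly_mapping_eqI) (simp add: lookup_minus)
  then show ?case
    by (cases "(i, t) = (j, s)")
      (auto simp: pdiff_single lookup_minus lookup_single when_def mult.left_commute)
qed (simp add: pdiff_add)

lemma polarization_add: "polarization i j (f + g) = polarization i j f + polarization i j g"
  by (simp add: polarization_def pdiff_add distrib_left sum.distrib)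

lemma polarization_0 [simp]: "polarization i j 0 = 0"
  by (simp add: polarization_def)

lemma polarization_mult:
  "polarization i j (f * g) = polarization i j f * g + f * polarization i j g"
  by (simp add: polarization_def pdiff_mult distrib_left sum.distrib sum_distrib_left
      sum_distrib_right mult_ac)

lemma polarization_var: "polarization i j (poly_var k t) = of_bool (j = k) * poly_var i t"
proof -
  have "polarization i j (poly_var k t) = (\<Sum>s\<in>UNIV. if s = t then of_bool (j = k) * poly_var i t else 0)"
    unfolding polarization_def by (rule sum.cong) (auto simp: pdiff_var)
  then show ?thesis by simp
qed

lemma polarization_const [simp]: "polarization i j (poly_const c) = 0"
  by (simp add: polarization_def)

lemma polarization_const_mult: "polarization i j (poly_const c * f) = poly_const c * polarization i j f"
  by (simp add: polarization_mult)

lemma pdiff_sum: "pdiff i t (sum f A) = (\<Sum>a\<in>A. pdiff i t (f a))"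
  by (induction A rule: infinite_finite_induct) (simp_all add: pdiff_add)

lemma polarization_polarization:
  "polarization i j (polarization k l f) = of_bool (j = k) * polarization i l f +
    (\<Sum>t\<in>UNIV. \<Sum>s\<in>UNIV. poly_var i t * poly_var k s * pdiff j t (pdiff l s f))"
proof -
  have "polarization i j (polarization k l f) =
      (\<Sum>t\<in>UNIV. \<Sum>s\<in>UNIV. (if t = s then of_bool (j = k) * (poly_var i t * pdiff l s f) else 0) +
        poly_var i t * poly_var k s * pdiff j t (pdiff l s f))"
    unfolding polarization_def pdiff_sum sum_distrib_left
    by (intro sum.cong refl) (auto simp: pdiff_mult pdiff_var algebra_simps)
  also have "\<dots> = of_bool (j = k) * polarization i l f +
      (\<Sum>t\<in>UNIV. \<Sum>s\<in>UNIV. poly_var i t * poly_var k s * pdiff j t (pdiff l s f))"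
    by (simp add: sum.distrib polarization_def sum_distrib_left)
  finally show ?thesis .
qed

lemma polarization_commutator:
  "polarization i j (polarization k l f) - polarization k l (polarization i j f) =
    of_bool (j = k) * polarization i l f - of_bool (i = l) * polarization k j f"
proof -
  have "(\<Sum>t\<in>UNIV. \<Sum>s\<in>UNIV. poly_var i t * poly_var k s * pdiff j t (pdiff l s f)) =
      (\<Sum>t\<in>UNIV. \<Sum>s\<in>UNIV. poly_var k t * poly_var i s * pdiff l t (pdiff j s f))"
    by (subst sum.swap) (simp add: mult.commute pdiff_commute)
  then show ?thesis
    by (auto simp: polarization_polarization)
qed

definition polarize_word ::
    "('l letter \<times> 'l letter) list \<Rightarrow> ('l, 'd::finite) polys \<Rightarrow> ('l, 'd) polys"
  where "polarize_word w f = foldr (\<lambda>(a, b). polarization (the_letter a) (the_letter b)) w f"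

definition free_act ::
    "('l letter \<times> 'l letter) free_algebra \<Rightarrow> ('l, 'd::finite) polys \<Rightarrow> ('l, 'd) polys"
  where "free_act p f = (\<Sum>w\<in>Poly_Mapping.keys p.
    poly_const (Poly_Mapping.lookup p w) * polarize_word (letters w) f)"

lemma poly_const_add: "poly_const (a + b) = poly_const a + poly_const b"
  by (simp add: poly_const_def single_add)

lemma poly_const_mult: "poly_const (a * b) = poly_const a * poly_const b"
  by (simp add: poly_const_def mult_single)

lemma poly_const_0 [simp]: "poly_const 0 = 0"
  by (simp add: poly_const_def)

lemma poly_const_1 [simp]: "poly_const 1 = 1"
  by (simp add: poly_const_def)

lemma free_act_add: "free_act (p + q) f = free_act p f + free_act q f"
  unfolding free_act_def
  by (rule setsum_keys_plus_distrib) (simp_all add: poly_const_add distrib_right)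

lemma free_act_single:
  "free_act (Poly_Mapping.single w c) f = poly_const c * polarize_word (letters w) f"
  by (simp add: free_act_def)

lemma polarize_word_add: "polarize_word w (f + g) = polarize_word w f + polarize_word w g"
  by (induction w arbitrary: f g)
    (auto simp: polarize_word_def polarization_add split: prod.splits)

lemma polarize_word_const_mult: "polarize_word w (poly_const c * f) = poly_const c * polarize_word w f"
  by (induction w)
    (auto simp: polarize_word_def polarization_const_mult split: prod.splits)

lemma polarize_word_append: "polarize_word (u @ w) f = polarize_word u (polarize_word w f)"
  by (simp add: polarize_word_def)

lemma free_act_add_right: "free_act p (f + g) = free_act p f + free_act p g"
  by (simp add: free_act_def polarize_word_add distrib_left sum.distrib)

lemma free_act_0 [simp]: "free_act 0 f = 0"
  by (simp add: free_act_def)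

lemma free_act_0_right [simp]: "free_act p 0 = 0"
  using free_act_add_right[of p 0 0] by simp

lemma free_act_uminus: "free_act (- p) f = - free_act p f"
  using free_act_add[of p "- p" f] by (simp add: add_eq_0_iff)

lemma free_act_diff: "free_act (p - q) f = free_act p f - free_act q f"
  using free_act_add[of p "- q" f] by (simp add: free_act_uminus)

lemma free_act_mult: "free_act (p * q) f = free_act p (free_act q f)"
proof (induction p rule: poly_mapping_add_induct)
  case (single k c)
  show ?case
  proof (induction q rule: poly_mapping_add_induct)
    case (single l d)
    show ?case
      by (cases k; cases l)
        (simp add: mult_single free_act_single plus_word_def poly_const_mult polarize_word_const_mult
          polarize_word_append mult.assoc)
  qed (simp add: distrib_left free_act_add free_act_add_right)
qed (simp add: distrib_right free_act_add)

lemma free_act_1 [simp]: "free_act 1 f = f"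
proof -
  have "free_act (Poly_Mapping.single 0 1) f = f"
    unfolding free_act_single by (simp add: zero_word_def polarize_word_def)
  then show ?thesis by simp
qed

lemma free_act_gen: "free_act (free_gen (Letter i, Letter j)) f = polarization i j f"
  by (simp add: free_gen_def free_act_single polarize_word_def)

lemma free_act_gl_relation: "free_act (gl_relation x y) f = 0"
proof -
  obtain i j k l where xy: "x = (Letter i, Letter j)" "y = (Letter k, Letter l)"
    by (metis letter.exhaust surj_pair)
  have "super_sign x y = (1 :: ('a letter \<times> 'a letter) free_algebra)"
    by (simp add: super_sign_def xy parity_letter_def)
  then show ?thesis
    using polarization_commutator[of i j k l f]
    by (auto simp: gl_relation_def super_bracket_def xy free_act_diff free_act_mult free_act_gen
        of_bool_def split: if_splits)
qed

lemma free_act_gl_ideal: "p \<in> gl_ideal \<Longrightarrow> free_act p f = 0"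
  by (induction arbitrary: f rule: gl_ideal.induct)
    (auto simp: free_act_add free_act_mult free_act_gl_relation)

lift_definition act :: "'l letter env \<Rightarrow> ('l, 'd::finite) polys \<Rightarrow> ('l, 'd) polys"
  is free_act
  by (metis eq_iff_diff_eq_0 ext free_act_diff free_act_gl_ideal)

lemma act_gl_e: "act (gl_e (Letter i) (Letter j)) f = polarization i j f"
  by transfer (rule free_act_gen)

lemma act_mult: "act (u * v) f = act u (act v f)"
  by transfer (rule free_act_mult)

lemma act_1: "act 1 f = f"
  by transfer (rule free_act_1)

lemma act_add: "act (u + v) f = act u f + act v f"
  by transfer (rule free_act_add)

lemma act_scale: "act (scale_env c u) f = poly_const c * act u f"
  by transfer (simp add: free_act_mult free_act_single zero_word_def polarize_word_def)

section \<open>Schur modules\<close>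

text \<open>The \<open>s\<close>-th smallest element, counted from 0.\<close>

definition nth_element :: "nat \<Rightarrow> 'a::{finite, linorder}"
  where "nth_element s = sorted_list_of_set UNIV ! s"

definition bideterminant :: "'l list \<Rightarrow> ('l, 'd::{finite, linorder}) polys"
  where "bideterminant r =
    det (mat (length r) (length r) (\<lambda>(s, t). poly_var (r ! s) (nth_element t)))"

definition tableau_product :: "'l list list \<Rightarrow> ('l, 'd::{finite, linorder}) polys"
  where "tableau_product X = prod_list (map bideterminant X)"

definition schur_module :: "nat list \<Rightarrow> ('l::finite, 'd::{finite, linorder}) polys set"
  where "schur_module nu = {\<Sum>X\<in>tableaux nu. poly_const (c X) * tableau_product X | c. True}"

text \<open>The canonical highest weight vector of weight \<open>mu\<close> in the Schur module of shape
  \<open>conjugate_partition mu\<close>. Its sign is a convention, which is left open as the function \<open>\<epsilon>\<close>.\<close>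

definition hw_vector ::
    "(nat list \<Rightarrow> complex) \<Rightarrow> nat list \<Rightarrow> ('l::{finite, linorder}, 'd::{finite, linorder}) polys"
  where "hw_vector \<epsilon> mu = poly_const (\<epsilon> mu) *
    tableau_product (map (\<lambda>k. map nth_element [0..<k]) (conjugate_partition mu))"

lemma hw_vector_in_schur_module: "hw_vector \<epsilon> mu \<in> schur_module (conjugate_partition mu)"
proof -
  let ?X = "map (\<lambda>k. map nth_element [0..<k]) (conjugate_partition mu) :: 'a list list"
  have "?X \<in> tableaux (conjugate_partition mu)"
    by (simp add: tableaux_def comp_def)
  then have "hw_vector \<epsilon> mu = (\<Sum>X\<in>tableaux (conjugate_partition mu).
      poly_const ((\<lambda>X. if X = ?X then \<epsilon> mu else 0) X) * (tableau_product X :: ('a, 'b) polys))"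
    by (simp add: hw_vector_def finite_tableaux if_distrib[of poly_const] if_distrib[of "\<lambda>x. x * _"]
        cong: if_cong)
  then show ?thesis unfolding schur_module_def mem_Collect_eq by (intro exI conjI TrueI)
qed

end

theory Submission
  imports
    Defs
    "HOL-Library.Function_Algebras"
    "HOL-Library.Countable"
    "HOL-Library.Product_Lexorder"
begin

text \<open>The superalgebra \<open>gl(m\<^sub>0|m\<^sub>1+n)\<close> acts by superpolarizations on the supersymmetric algebra in the
  variables \<open>(a|t)\<close>, and irregular products annihilate the polynomials in proper letters. A double
  Young-Capelli bitableau therefore acts on these polynomials as its virtual presentation does,
  without appeal to the Poincare-Birkhoff-Witt theorem.

  Let \<open>\<nu>\<close> be conjugate to \<open>\<lambda>\<close>. The half \<open>e\<^bsub>D,C\<^esub> e\<^bsub>C,S\<^esub>\<close> sends \<open>v\<^sub>\<mu>\<close> to a combination of bitableaux whose shape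
  is conjugate to \<open>\<mu>\<close>. Comparing contents and using that rows must have distinct entries, it vanishes
  unless \<open>\<lambda> = \<mu>\<close> and every row of \<open>S\<close> is \<open>1, 2, 3, \<dots>\<close>. In this remaining case the rows of \<open>\<nu>\<close> are
  processed one by one, the longest first: each turns one minor in the letters \<open>1, \<dots>, k\<close> into the same
  minor in the letters \<open>\<beta>\<^sub>1, \<dots>, \<beta>\<^sub>k\<close> and contributes the Capelli eigenvalue \<open>\<Prod>\<^sub>i (\<lambda>\<^sub>i + k - i)\<close> of the
  partition not yet processed, which is the product of the hook lengths in its first column. So each
  half acts by \<open>\<plusminus>H(\<lambda>)\<close>, with the same sign, and the factor \<open>1/H\<close> leaves \<open>H(\<lambda>)\<close>.\<close>

section \<open>Grassmann variables\<close>

text \<open>The variable (a|t) has the parity opposite to that of a. Proper letters, odd in the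
  superalgebra, thus become the commuting variables of the given action, while an even symbol
  \<alpha> becomes Grassmann: the variables (\<alpha>|t) store a row, and emptying them into k
  letters can only produce a minor.

  Evaluated directly on a product of minors, a bitableau would spread over all ways of distributing
  its letters among the factors. Two facts prevent this when a longest row, of length k, is taken
  first. The product then involves k columns only, so k Grassmann variables leave no freedom, and
  the effect is one minor times a factor independent of the target letters. And this minor is in
  letters that the remaining words do not differentiate, so it passes through them as a scalar and
  the shorter rows meet a polynomial of the same kind.

  The Capelli computation does not distinguish proper letters from negative symbols. Hence the two
  halves of the bitableau are one statement with the two alphabets exchanged, and their common sign
  squares to one.\<close>

text \<open>A set \<open>A\<close> of odd variables stands for their product in increasing order of \<open>to_nat\<close>, which fixes
  the signs of multiplication (\<open>fcre\<close>) and differentiation (\<open>fann\<close>).\<close>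

definition fsign :: "'x::countable \<Rightarrow> 'x set \<Rightarrow> 'r::comm_ring_1"
  where "fsign x A = (- 1) ^ card {y \<in> A. to_nat y < to_nat x}"

definition fcre :: "'x::finite \<Rightarrow> ('x set \<Rightarrow> 'r::comm_ring_1) \<Rightarrow> 'x set \<Rightarrow> 'r"
  where "fcre x F A = (if x \<in> A then fsign x A * F (A - {x}) else 0)"

definition fann :: "'x::finite \<Rightarrow> ('x set \<Rightarrow> 'r::comm_ring_1) \<Rightarrow> 'x set \<Rightarrow> 'r"
  where "fann x F A = (if x \<in> A then 0 else fsign x A * F (insert x A))"

lemma fsign_self [simp]: "fsign x (insert x A) = fsign x A" "fsign x (A - {x}) = fsign x A"
proof -
  have "{y \<in> insert x A. to_nat y < to_nat x} = {y \<in> A. to_nat y < to_nat x}"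
    "{y \<in> A - {x}. to_nat y < to_nat x} = {y \<in> A. to_nat y < to_nat x}"
    by auto
  then show "fsign x (insert x A) = fsign x A" "fsign x (A - {x}) = fsign x A"
    by (simp_all add: fsign_def)
qed

lemma fsign_square [simp]: "fsign x A * fsign x A = (1 :: 'r::comm_ring_1)"
  by (simp add: fsign_def power_mult_distrib[symmetric])

lemma fsign_square_left [simp]: "fsign x A * (fsign x A * r) = (r :: 'r::comm_ring_1)"
  by (simp add: mult.assoc[symmetric])

lemma fsign_insert:
  fixes x y :: "'x::finite"
  assumes "y \<notin> A"
  shows "fsign x (insert y A) = (if to_nat y < to_nat x then - fsign x A else (fsign x A :: 'r::comm_ring_1))"
proof -
  have "{z \<in> insert y A. to_nat z < to_nat x} =
      (if to_nat y < to_nat x then insert y {z \<in> A. to_nat z < to_nat x} else {z \<in> A. to_nat z < to_nat x})"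
    by auto
  then show ?thesis using assms by (simp add: fsign_def)
qed

lemma fsign_remove:
  fixes x y :: "'x::finite"
  assumes "y \<in> A"
  shows "fsign x (A - {y}) = (if to_nat y < to_nat x then - fsign x A else (fsign x A :: 'r::comm_ring_1))"
  using fsign_insert[of y "A - {y}" x, where 'r='r] assms by (auto simp: insert_absorb)

text \<open>Of the two sign factors only that of the larger variable depends on whether the other
  one is present, so the two orders differ by exactly one sign. The same count gives
  \<open>fann_fann\<close> and the canonical anticommutation relation
  \<open>fann_fcre\<close>.\<close>

lemma fcre_fcre: "fcre x (fcre y F) = - fcre y (fcre x F)"
proof
  fix A
  have *: "A - {x} - {y} = A - {y} - {x}" by auto
  show "fcre x (fcre y F) A = (- fcre y (fcre x F)) A"
  proof (cases "x = y")
    case True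
    then show ?thesis by (auto simp: fcre_def)
  next
    case False
    then have "to_nat x < to_nat y \<or> to_nat y < to_nat x"
      by (metis linorder_neqE_nat to_nat_split)
    then show ?thesis using False
      by (auto simp: fcre_def fsign_remove * algebra_simps)
  qed
qed

lemma fann_fann: "fann x (fann y F) = - fann y (fann x F)"
proof
  fix A
  have *: "insert x (insert y A) = insert y (insert x A)" by auto
  show "fann x (fann y F) A = (- fann y (fann x F)) A"
  proof (cases "x = y")
    case True
    then show ?thesis by (auto simp: fann_def)
  next
    case False
    then have "to_nat x < to_nat y \<or> to_nat y < to_nat x"
      by (metis linorder_neqE_nat to_nat_split)
    then show ?thesis using False
      by (auto simp: fann_def fsign_insert * algebra_simps)
  qed
qed

lemma fann_fcre: "fann x (fcre y F) = (if x = y then F else 0) - fcre y (fann x F)"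
proof
  fix A
  have *: "insert x A - {y} = insert x (A - {y})" if "x \<noteq> y" using that by auto
  show "fann x (fcre y F) A = ((if x = y then F else 0) - fcre y (fann x F)) A"
  proof (cases "x = y")
    case True
    then show ?thesis by (auto simp: fann_def fcre_def insert_absorb)
  next
    case False
    then have "to_nat x < to_nat y \<or> to_nat y < to_nat x"
      by (metis linorder_neqE_nat to_nat_split)
    then show ?thesis using False
      by (auto simp: fann_def fcre_def fsign_insert fsign_remove * algebra_simps)
  qed
qed

section \<open>The supersymmetric algebra as a module\<close>

text \<open>The variables \<open>(a|t)\<close> with \<open>a\<close> positive virtual are odd, all others are even. The even letters
  are replaced by natural numbers (\<open>code\<close>; its value on positive symbols is junk), so that
  the monomials are linearly ordered and the polynomial ring is known to be an integral domain.\<close>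

type_synonym ('p, 'd) smod = "('p \<times> 'd) set \<Rightarrow> (nat, 'd) polys"

definition code :: "('p::finite, 'q::finite, 'l::finite) symbol \<Rightarrow> nat"
  where "code a = (case a of Pos _ \<Rightarrow> 0 | Neg q \<Rightarrow> 2 * to_nat q + 1 | Proper x \<Rightarrow> 2 * to_nat (the_letter x))"

definition is_pos :: "('p, 'q, 'l) symbol \<Rightarrow> bool"
  where "is_pos a \<longleftrightarrow> (\<exists>p. a = Pos p)"

lemma is_pos_simps [simp]: "is_pos (Pos p)" "\<not> is_pos (Neg q)" "\<not> is_pos (Proper x)"
  by (auto simp: is_pos_def)

lemma code_eq_iff: "\<not> is_pos a \<Longrightarrow> \<not> is_pos b \<Longrightarrow> code a = code b \<longleftrightarrow> a = b"
  by (cases a; cases b) (auto simp: code_def letter.expand, presburger+)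

lemma parity_is_pos: "parity (a :: ('p, 'q, 'l) symbol) = of_bool (\<not> is_pos a)"
  by (cases a) (auto simp: parity_symbol_def parity_letter_def)

definition smul :: "'r::comm_ring_1 \<Rightarrow> ('x \<Rightarrow> 'r) \<Rightarrow> 'x \<Rightarrow> 'r"
  where "smul p F = (\<lambda>A. p * F A)"

lemma smul_simps [simp]: "smul 0 F = 0" "smul 1 F = F" "smul p 0 = 0" "smul p (smul q F) = smul (p * q) F"
  by (auto simp: smul_def fun_eq_iff mult.assoc)

lemma smul_add: "smul p (F + G) = smul p F + smul p G" "smul (p + q) F = smul p F + smul q F"
  by (auto simp: smul_def fun_eq_iff algebra_simps)

lemma smul_minus: "smul p (- F) = - smul p F" "smul (- p) F = - smul p F"
  by (auto simp: smul_def fun_eq_iff algebra_simps)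

lemma smul_diff: "smul p (F - G) = smul p F - smul p G"
  by (auto simp: smul_def fun_eq_iff algebra_simps)

lemma sum_fun_apply: "(\<Sum>i\<in>I. f i) A = (\<Sum>i\<in>I. f i A)"
  by (induction I rule: infinite_finite_induct) auto

lemma smul_sum: "smul p (\<Sum>i\<in>I. f i) = (\<Sum>i\<in>I. smul p (f i))"
  by (induction I rule: infinite_finite_induct) (simp_all only: sum.infinite sum.empty sum.insert smul_simps smul_add not_False_eq_True)

definition cre :: "('p::finite, 'q::finite, 'l::finite) symbol \<Rightarrow> 'd::finite \<Rightarrow> ('p, 'd) smod \<Rightarrow> ('p, 'd) smod"
  where "cre a t F = (case a of Pos p \<Rightarrow> fcre (p, t) F | _ \<Rightarrow> smul (poly_var (code a) t) F)"

definition ann :: "('p::finite, 'q::finite, 'l::finite) symbol \<Rightarrow> 'd::finite \<Rightarrow> ('p, 'd) smod \<Rightarrow> ('p, 'd) smod"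
  where "ann a t F = (case a of Pos p \<Rightarrow> fann (p, t) F | _ \<Rightarrow> (\<lambda>A. pdiff (code a) t (F A)))"

text \<open>Only positive symbols give odd variables, so this is the Koszul sign of the parities |a|
  + 1 and |b| + 1.\<close>

definition swap_sign :: "('p, 'q, 'l) symbol \<Rightarrow> ('p, 'q, 'l) symbol \<Rightarrow> 'r::ring_1"
  where "swap_sign a b = (if is_pos a \<and> is_pos b then - 1 else 1)"

lemma cre_nonpos: "\<not> is_pos a \<Longrightarrow> cre a t F = smul (poly_var (code a) t) F"
  by (cases a) (auto simp: cre_def)

lemma ann_nonpos: "\<not> is_pos a \<Longrightarrow> ann a t F = (\<lambda>A. pdiff (code a) t (F A))"
  by (cases a) (auto simp: ann_def)

lemma pdiff_uminus: "pdiff i t (- f) = - pdiff i t f"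
  using pdiff_add[of i t f "- f"] by (simp add: add_eq_0_iff)

lemma fsign_commute_pdiff: "pdiff i t (fsign x A * f) = fsign x A * pdiff i t f"
proof -
  have "fsign x A = (1 :: ('a, 'b) polys) \<or> fsign x A = (-1 :: ('a, 'b) polys)"
    unfolding fsign_def using neg_one_even_power neg_one_odd_power by blast
  then show ?thesis by (auto simp: pdiff_uminus)
qed

lemma cre_add: "cre a t (F + G) = cre a t F + cre a t G"
  by (cases a) (auto simp: cre_def smul_add fcre_def fun_eq_iff algebra_simps)

lemma ann_add: "ann a t (F + G) = ann a t F + ann a t G"
  by (cases a) (auto simp: ann_def pdiff_add fann_def fun_eq_iff algebra_simps)

lemma cre_0 [simp]: "cre a t 0 = 0"
  using cre_add[of a t 0 0] by simp

lemma ann_0 [simp]: "ann a t 0 = 0"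
  using ann_add[of a t 0 0] by simp

lemma cre_sum: "cre a t (\<Sum>i\<in>I. f i) = (\<Sum>i\<in>I. cre a t (f i))"
  by (induction I rule: infinite_finite_induct) (simp_all only: sum.infinite sum.empty sum.insert cre_0 cre_add not_False_eq_True)

lemma ann_sum: "ann a t (\<Sum>i\<in>I. f i) = (\<Sum>i\<in>I. ann a t (f i))"
  by (induction I rule: infinite_finite_induct) (simp_all only: sum.infinite sum.empty sum.insert ann_0 ann_add not_False_eq_True)

lemma cre_smul: "cre a t (smul p F) = smul p (cre a t F)"
  by (cases a) (auto simp: cre_def smul_def fcre_def fun_eq_iff algebra_simps)

text \<open>An operator \<open>ann b t\<close> is linear over the polynomials on which it vanishes as a derivation.\<close>

definition inert :: "('p::finite, 'q::finite, 'l::finite) symbol \<Rightarrow> (nat, 'd::finite) polys \<Rightarrow> bool"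
  where "inert b p \<longleftrightarrow> is_pos b \<or> (\<forall>t. pdiff (code b) t p = 0)"

lemma ann_smul: "inert b p \<Longrightarrow> ann b t (smul p F) = smul p (ann b t F)"
  by (cases b) (auto simp: inert_def ann_def smul_def fann_def fun_eq_iff pdiff_mult algebra_simps)

lemma inert_const [simp]: "inert b (poly_const c)"
  by (simp add: inert_def)

lemma cre_cre: "cre a t (cre b s F) = smul (swap_sign a b) (cre b s (cre a t F))"
proof (cases "is_pos a \<and> is_pos b")
  case True
  then obtain p q where "a = Pos p" "b = Pos q" by (auto simp: is_pos_def)
  then show ?thesis
    using fcre_fcre[of "(p, t)" "(q, s)" F] by (simp add: cre_def swap_sign_def smul_minus)
next
  case False
  then show ?thesis
    by (cases "is_pos a") (auto simp: cre_nonpos cre_smul swap_sign_def mult.commute)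
qed

lemma ann_ann: "ann a t (ann b s F) = smul (swap_sign a b) (ann b s (ann a t F))"
proof (cases "is_pos a \<and> is_pos b")
  case True
  then obtain p q where "a = Pos p" "b = Pos q" by (auto simp: is_pos_def)
  then show ?thesis
    using fann_fann[of "(p, t)" "(q, s)" F] by (simp add: ann_def swap_sign_def smul_minus)
next
  case False
  then consider "\<not> is_pos a" "\<not> is_pos b" | p where "a = Pos p" "\<not> is_pos b" | q where "\<not> is_pos a" "b = Pos q"
    by (auto simp: is_pos_def)
  then show ?thesis
  proof cases
    case 1
    then show ?thesis by (simp add: ann_nonpos swap_sign_def pdiff_commute)
  next
    case 2
    then show ?thesis
      by (auto simp: ann_nonpos swap_sign_def ann_def[of "Pos p"] fann_def fun_eq_iff fsign_commute_pdiff)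
  next
    case 3
    then show ?thesis
      by (auto simp: ann_nonpos swap_sign_def ann_def[of "Pos q"] fann_def fun_eq_iff fsign_commute_pdiff)
  qed
qed

lemma ann_cre:
  "ann a t (cre b s F) = smul (of_bool (a = b \<and> t = s)) F + smul (swap_sign a b) (cre b s (ann a t F))"
proof (cases "is_pos a \<and> is_pos b")
  case True
  then obtain p q where "a = Pos p" "b = Pos q" by (auto simp: is_pos_def)
  then show ?thesis
    using fann_fcre[of "(p, t)" "(q, s)" F] by (simp add: ann_def cre_def swap_sign_def smul_minus)
next
  case False
  then consider "\<not> is_pos a" "\<not> is_pos b" | p where "a = Pos p" "\<not> is_pos b" | q where "\<not> is_pos a" "b = Pos q"
    by (auto simp: is_pos_def)
  then show ?thesis
  proof cases
    case 1
    then show ?thesis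
      by (auto simp: ann_nonpos cre_nonpos swap_sign_def pdiff_mult pdiff_var smul_def fun_eq_iff code_eq_iff)
  next
    case 2
    then show ?thesis
      by (auto simp: cre_nonpos swap_sign_def ann_smul inert_def)
  next
    case 3
    then show ?thesis
      by (auto simp: ann_nonpos swap_sign_def cre_def fcre_def fun_eq_iff fsign_commute_pdiff)
  qed
qed

text \<open>Superpolarization: the superderivation with (b|t) \<mapsto> (a|t).\<close>

definition eop :: "('p::finite, 'q::finite, 'l::finite) symbol \<Rightarrow> ('p, 'q, 'l) symbol \<Rightarrow> ('p, 'd::finite) smod \<Rightarrow> ('p, 'd) smod"
  where "eop a b F = (\<Sum>t\<in>UNIV. cre a t (ann b t F))"

lemma eop_add: "eop a b (F + G) = eop a b F + eop a b G"
  by (simp add: eop_def ann_add cre_add sum.distrib)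

lemma eop_0 [simp]: "eop a b 0 = 0"
  by (simp add: eop_def)

lemma eop_smul: "inert b p \<Longrightarrow> eop a b (smul p F) = smul p (eop a b F)"
  by (simp add: eop_def ann_smul cre_smul smul_sum)

lemma swap_sign_inert [simp]: "inert c (swap_sign a b)"
  using inert_const[of c "- 1"] inert_const[of c 1]
  by (simp add: swap_sign_def inert_def pdiff_uminus flip: poly_const_1)

text \<open>Normal ordering: moving \<open>ann b\<close> past \<open>cre c\<close> yields one
  contraction. In the remainder both creations precede both annihilations, so it is symmetric in the
  two operators up to sign.\<close>

lemma eop_eop_aux:
  "eop a b (eop c d F) = smul (of_bool (b = c)) (eop a d F) +
    smul (swap_sign b c) (\<Sum>t\<in>UNIV. \<Sum>s\<in>UNIV. cre a t (cre c s (ann b t (ann d s F))))"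
proof -
  have "eop a b (eop c d F) = (\<Sum>t\<in>UNIV. \<Sum>s\<in>UNIV. (if t = s then smul (of_bool (b = c)) (cre a t (ann d s F)) else 0) +
      smul (swap_sign b c) (cre a t (cre c s (ann b t (ann d s F)))))"
    unfolding eop_def ann_sum cre_sum
    by (intro sum.cong refl) (auto simp: ann_cre cre_add cre_smul)
  also have "\<dots> = smul (of_bool (b = c)) (eop a d F) +
    smul (swap_sign b c) (\<Sum>t\<in>UNIV. \<Sum>s\<in>UNIV. cre a t (cre c s (ann b t (ann d s F))))"
    by (simp add: sum.distrib eop_def smul_sum)
  finally show ?thesis .
qed

text \<open>Exchanging the two operators costs the four swap signs of a, b against c, d. Their
  product is the sign of (|a| + |b|)(|c| + |d|), because shifting every parity by one leaves both
  sums unchanged modulo 2.\<close>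

lemma eop_supercommute:
  "eop a b (eop c d F) = smul (super_sign (a, b) (c, d)) (eop c d (eop a b F)) + smul (of_bool (b = c)) (eop a d F)
    - smul (super_sign (a, b) (c, d) * of_bool (a = d)) (eop c b F)"
proof -
  have "(\<Sum>t\<in>UNIV. \<Sum>s\<in>UNIV. cre a t (cre c s (ann b t (ann d s F)))) =
      (\<Sum>t\<in>UNIV. \<Sum>s\<in>UNIV. smul (swap_sign a c * swap_sign b d) (cre c t (cre a s (ann d t (ann b s F)))))"
  proof (subst sum.swap, intro sum.cong refl)
    fix s t
    have "cre a t (cre c s (ann b t (ann d s F))) = smul (swap_sign a c) (cre c s (cre a t (smul (swap_sign b d) (ann d s (ann b t F)))))"
      by (subst cre_cre, subst ann_ann) simp
    then show "cre a t (cre c s (ann b t (ann d s F))) = smul (swap_sign a c * swap_sign b d) (cre c s (cre a t (ann d s (ann b t F))))"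
      by (simp add: cre_smul)
  qed
  then have *: "(\<Sum>t\<in>UNIV. \<Sum>s\<in>UNIV. cre a t (cre c s (ann b t (ann d s F)))) =
      smul (swap_sign a c * swap_sign b d) (\<Sum>t\<in>UNIV. \<Sum>s\<in>UNIV. (cre c t (cre a s (ann d t (ann b s F)))))"
    by (simp add: smul_sum)
  show ?thesis
    unfolding eop_eop_aux[of a b c d] eop_eop_aux[of c d a b] *
    by (auto simp: super_sign_def parity_is_pos swap_sign_def smul_minus smul_add)
qed

text \<open>The method \<open>induction\<close> eta-expands functions, whereupon these rules would push equations
  between elements of the module down to their values.\<close>

declare plus_fun_apply [simp del] zero_fun_apply [simp del]

lemmas fun_pointwise = fun_eq_iff plus_fun_apply zero_fun_apply

section \<open>Words and the enveloping superalgebra as operators\<close>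

definition wact :: "(('p::finite, 'q::finite, 'l::finite) symbol \<times> ('p, 'q, 'l) symbol) list \<Rightarrow> ('p, 'd::finite) smod \<Rightarrow> ('p, 'd) smod"
  where "wact w F = foldr (\<lambda>(a, b). eop a b) w F"

lemma wact_simps [simp]: "wact [] F = F" "wact ((a, b) # w) F = eop a b (wact w F)"
  by (simp_all add: wact_def)

lemma wact_append: "wact (u @ w) F = wact u (wact w F)"
  by (simp add: wact_def)

lemma wact_add: "wact w (F + G) = wact w F + wact w G"
  by (induction w) (auto simp only: wact_simps eop_add split_paired_all)

lemma wact_0 [simp]: "wact w 0 = 0"
  by (induction w) (auto simp only: wact_simps eop_0 split_paired_all)

lemma wact_smul: "(\<And>a b. (a, b) \<in> set w \<Longrightarrow> inert b p) \<Longrightarrow> wact w (smul p F) = smul p (wact w F)"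
proof (induction w)
  case (Cons x w)
  obtain a b where x: "x = (a, b)" by fastforce
  have "wact w (smul p F) = smul p (wact w F)" using Cons.IH Cons.prems by (meson list.set_intros(2))
  moreover have "inert b p" using Cons.prems[of a b] by (simp add: x)
  ultimately show ?case by (simp add: x eop_smul)
qed simp

definition free_sact ::
    "(('p::finite, 'q::finite, 'l::finite) symbol \<times> ('p, 'q, 'l) symbol) free_algebra \<Rightarrow> ('p, 'd::finite) smod \<Rightarrow> ('p, 'd) smod"
  where "free_sact p F = (\<Sum>w\<in>Poly_Mapping.keys p. smul (poly_const (Poly_Mapping.lookup p w)) (wact (letters w) F))"

lemma free_sact_add: "free_sact (p + q) F = free_sact p F + free_sact q F"
  unfolding free_sact_def
  by (rule setsum_keys_plus_distrib) (simp_all add: poly_const_add smul_add)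

lemma free_sact_single: "free_sact (Poly_Mapping.single w c) F = smul (poly_const c) (wact (letters w) F)"
  by (cases "c = 0") (simp_all add: free_sact_def)

lemma free_sact_add_right: "free_sact p (F + G) = free_sact p F + free_sact p G"
  by (simp add: free_sact_def wact_add smul_add sum.distrib)

lemma free_sact_0 [simp]: "free_sact 0 F = 0"
  by (simp add: free_sact_def)

lemma free_sact_uminus: "free_sact (- p) F = - free_sact p F"
  using free_sact_add[of p "- p" F] by (simp add: add_eq_0_iff)

lemma free_sact_diff: "free_sact (p - q) F = free_sact p F - free_sact q F"
  using free_sact_add[of p "- q" F] by (simp add: free_sact_uminus)

lemma free_sact_mult: "free_sact (p * q) F = free_sact p (free_sact q F)"
proof (induction p rule: poly_mapping_add_induct)
  case (single k c)
  show ?case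
  proof (induction q rule: poly_mapping_add_induct)
    case (single l d)
    show ?case
      by (cases k; cases l)
        (simp add: mult_single free_sact_single plus_word_def poly_const_mult wact_smul wact_append)
  qed (simp add: distrib_left free_sact_add free_sact_add_right)
qed (simp add: distrib_right free_sact_add)

lemma free_sact_1 [simp]: "free_sact 1 F = F"
proof -
  have "free_sact (Poly_Mapping.single 0 1) F = F"
    unfolding free_sact_single by (simp add: zero_word_def)
  then show ?thesis by simp
qed

lemma free_sact_gen: "free_sact (free_gen (a, b)) F = eop a b F"
  by (simp add: free_gen_def free_sact_single)

lemma super_sign_eq:
  "super_sign x y = (if even ((parity (fst x) + parity (snd x)) * (parity (fst y) + parity (snd y))) then 1 else - 1)"
  by (simp add: super_sign_def)

lemma free_sact_super_sign: "free_sact (super_sign x y * p) F = smul (super_sign x y) (free_sact p F)"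
  by (simp add: super_sign_eq free_sact_uminus smul_minus)

lemma free_sact_gl_relation: "free_sact (gl_relation x y) F = 0"
proof -
  obtain a b c d where xy: "x = (a, b)" "y = (c, d)" by (metis surj_pair)
  have *: "free_sact (of_bool P * p) F = smul (of_bool P) (free_sact p F)" for P p
    by (cases P) simp_all
  show ?thesis
    using eop_supercommute[of a b c d F]
    by (simp add: gl_relation_def super_bracket_def xy free_sact_diff free_sact_mult[of "free_gen _"] free_sact_gen
        mult.assoc free_sact_super_sign *)
qed

lemma free_sact_gl_ideal: "p \<in> gl_ideal \<Longrightarrow> free_sact p F = 0"
proof (induction arbitrary: F rule: gl_ideal.induct)
  case (gen u x y v)
  have "free_sact u 0 = 0"
    using free_sact_add_right[of u 0 0] by simp
  then show ?case by (simp add: free_sact_mult free_sact_gl_relation)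
qed (simp_all add: free_sact_add)

lift_definition sact :: "('p::finite, 'q::finite, 'l::finite) symbol env \<Rightarrow> ('p, 'd::finite) smod \<Rightarrow> ('p, 'd) smod"
  is free_sact
  by (metis eq_iff_diff_eq_0 ext free_sact_diff free_sact_gl_ideal)

lemma sact_gl_e: "sact (gl_e a b) F = eop a b F"
  by transfer (rule free_sact_gen)

lemma sact_mult: "sact (u * v) F = sact u (sact v F)"
  by transfer (rule free_sact_mult)

lemma sact_1 [simp]: "sact 1 F = F"
  by transfer (rule free_sact_1)

lemma sact_0 [simp]: "sact 0 F = 0"
  by transfer (rule free_sact_0)

lemma sact_add: "sact (u + v) F = sact u F + sact v F"
  by transfer (rule free_sact_add)

lemma sact_diff: "sact (u - v) F = sact u F - sact v F"
  by transfer (rule free_sact_diff)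

lemma sact_add_right: "sact u (F + G) = sact u F + sact u G"
  by transfer (rule free_sact_add_right)

lemma sact_0_right [simp]: "sact u 0 = 0"
  using sact_add_right[of u 0 0] by simp

lemma e_word_simps [simp]: "e_word [] = 1" "e_word ((a, b) # w) = gl_e a b * e_word w"
  by (simp_all add: e_word_def)

lemma e_word_append: "e_word (u @ w) = e_word u * e_word w"
  by (simp add: e_word_def)

lemma sact_e_word: "sact (e_word w) F = wact w F"
  by (induction w) (auto simp add: sact_mult sact_gl_e)

section \<open>Elements without odd variables\<close>

definition vac :: "'r::zero \<Rightarrow> 'x set \<Rightarrow> 'r"
  where "vac p A = (if A = {} then p else 0)"

lemma vac_0 [simp]: "vac 0 = 0"
  by (simp add: vac_def fun_pointwise)

lemma vac_add: "vac (p + q) = vac p + (vac q :: _ \<Rightarrow> 'r::comm_ring_1)"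
  by (simp add: vac_def fun_pointwise)

lemma vac_smul: "smul p (vac q) = vac (p * q)"
  by (simp add: vac_def smul_def fun_pointwise)

lemma vac_inject: "vac p = vac q \<longleftrightarrow> p = q"
  by (metis vac_def)

lemma vac_sum: "vac (\<Sum>i\<in>I. f i) = (\<Sum>i\<in>I. vac (f i) :: _ \<Rightarrow> 'r::comm_ring_1)"
  by (induction I rule: infinite_finite_induct) (simp_all only: sum.infinite sum.empty sum.insert vac_0 vac_add not_False_eq_True)

lemma ann_vac_pos: "ann (Pos p) t (vac f) = 0"
  by (auto simp: ann_def fann_def vac_def fun_pointwise)

lemma eop_vac_pos [simp]: "eop a (Pos p) (vac f) = 0"
  by (simp add: eop_def ann_vac_pos)

lemma eop_vac:
  assumes "\<not> is_pos a" "\<not> is_pos b"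
  shows "eop a b (vac f) = vac (polarization (code a) (code b) f)"
proof -
  have "(\<lambda>A. pdiff (code b) t (vac f A)) = vac (pdiff (code b) t f)" for t
    by (simp add: vac_def fun_pointwise)
  note this [simp]
  show ?thesis using assms
    by (simp add: eop_def cre_nonpos ann_nonpos polarization_def vac_smul vac_sum)
qed

section \<open>Renaming of variables and the embedded polynomials\<close>

definition push :: "('a \<Rightarrow> 'b) \<Rightarrow> ('a \<Rightarrow>\<^sub>0 nat) \<Rightarrow> ('b \<Rightarrow>\<^sub>0 nat)"
  where "push \<rho> m = (\<Sum>x\<in>Poly_Mapping.keys m. Poly_Mapping.single (\<rho> x) (Poly_Mapping.lookup m x))"

lemma push_add: "push \<rho> (m + n) = push \<rho> m + push \<rho> n"
  unfolding push_def by (rule setsum_keys_plus_distrib) (simp_all add: single_add)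

lemma push_single: "push \<rho> (Poly_Mapping.single x k) = Poly_Mapping.single (\<rho> x) k"
  by (cases "k = 0") (simp_all add: push_def)

lemma push_0 [simp]: "push \<rho> 0 = 0"
  by (simp add: push_def)

lemma lookup_push:
  assumes "inj \<rho>"
  shows "Poly_Mapping.lookup (push \<rho> m) (\<rho> x) = Poly_Mapping.lookup m x"
proof -
  have "Poly_Mapping.lookup (push \<rho> m) (\<rho> x) =
      (\<Sum>y\<in>Poly_Mapping.keys m. if y = x then Poly_Mapping.lookup m y else 0)"
    unfolding push_def lookup_sum
    by (intro sum.cong refl) (use assms in \<open>auto simp: lookup_single when_def inj_eq\<close>)
  also have "\<dots> = Poly_Mapping.lookup m x"
    by (simp add: in_keys_iff)
  finally show ?thesis .
qed

lemma inj_push: "inj \<rho> \<Longrightarrow> inj (push \<rho>)"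
  by (rule injI, rule poly_mapping_eqI) (metis lookup_push)

definition rename :: "('a \<Rightarrow> 'b) \<Rightarrow> (('a \<Rightarrow>\<^sub>0 nat) \<Rightarrow>\<^sub>0 complex) \<Rightarrow> (('b \<Rightarrow>\<^sub>0 nat) \<Rightarrow>\<^sub>0 complex)"
  where "rename \<rho> f = (\<Sum>m\<in>Poly_Mapping.keys f. Poly_Mapping.single (push \<rho> m) (Poly_Mapping.lookup f m))"

lemma rename_add: "rename \<rho> (f + g) = rename \<rho> f + rename \<rho> g"
  unfolding rename_def by (rule setsum_keys_plus_distrib) (simp_all add: single_add)

lemma rename_single: "rename \<rho> (Poly_Mapping.single m c) = Poly_Mapping.single (push \<rho> m) c"
  by (cases "c = 0") (simp_all add: rename_def)

lemma rename_0 [simp]: "rename \<rho> 0 = 0"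
  by (simp add: rename_def)

lemma rename_1 [simp]: "rename \<rho> 1 = 1"
  using rename_single[of \<rho> 0 1] by simp

lemma rename_mult: "rename \<rho> (f * g) = rename \<rho> f * rename \<rho> g"
proof (induction f rule: poly_mapping_add_induct)
  case (single k c)
  show ?case
  proof (induction g rule: poly_mapping_add_induct)
    case (single l d)
    show ?case by (simp add: mult_single rename_single push_add)
  qed (simp add: distrib_left rename_add)
qed (simp add: distrib_right rename_add)

lemma rename_sum: "rename \<rho> (\<Sum>i\<in>I. f i) = (\<Sum>i\<in>I. rename \<rho> (f i))"
  by (induction I rule: infinite_finite_induct) (simp_all add: rename_add)

lemma rename_hom: "comm_ring_hom (rename \<rho>)"
  by standard (simp_all add: rename_add rename_mult)

lemma inj_rename:
  assumes "inj \<rho>"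
  shows "inj (rename \<rho>)"
proof (rule injI, rule poly_mapping_eqI)
  have *: "Poly_Mapping.lookup (rename \<rho> f) (push \<rho> m) = Poly_Mapping.lookup f m" for f m
  proof -
    have "Poly_Mapping.lookup (rename \<rho> f) (push \<rho> m) =
        (\<Sum>n\<in>Poly_Mapping.keys f. if n = m then Poly_Mapping.lookup f n else 0)"
      unfolding rename_def lookup_sum
      by (intro sum.cong refl) (use inj_push[OF assms] in \<open>auto simp: lookup_single when_def inj_eq\<close>)
    also have "\<dots> = Poly_Mapping.lookup f m"
      by (simp add: in_keys_iff)
    finally show ?thesis .
  qed
  fix f g m
  assume "rename \<rho> f = rename \<rho> g"
  then show "Poly_Mapping.lookup f m = Poly_Mapping.lookup g m" by (metis *)
qed

lemma rename_const: "rename \<rho> (poly_const c) = poly_const c"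
  by (simp add: poly_const_def rename_single)

lemma rename_var: "rename (map_prod \<rho> id) (poly_var i t) = poly_var (\<rho> i) t"
  by (simp add: poly_var_def rename_single push_single)

lemma pdiff_rename:
  assumes "inj \<rho>"
  shows "pdiff (\<rho> i) t (rename (map_prod \<rho> id) f) = rename (map_prod \<rho> id) (pdiff i t f)"
proof (induction f rule: poly_mapping_add_induct)
  case (single m c)
  have inj: "inj (map_prod \<rho> (id :: 'c \<Rightarrow> 'c))"
    using assms by (auto simp: inj_def)
  have l: "Poly_Mapping.lookup (push (map_prod \<rho> id) m) (\<rho> i, t) = Poly_Mapping.lookup m (i, t)"
    using lookup_push[OF inj, of m "(i, t)"] by simp
  show ?case
  proof (cases "Poly_Mapping.lookup m (i, t) = 0")
    case True
    then show ?thesis by (simp only: rename_single pdiff_single l, (simp)?)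
  next
    case False
    have "m = (m - Poly_Mapping.single (i, t) 1) + Poly_Mapping.single (i, t) 1"
      using False by (intro poly_mapping_eqI) (auto simp: lookup_add lookup_minus lookup_single when_def)
    then have "push (map_prod \<rho> id) m = push (map_prod \<rho> id) (m - Poly_Mapping.single (i, t) 1) + Poly_Mapping.single (\<rho> i, t) 1"
      by (metis push_add push_single map_prod_simp id_apply)
    then have "push (map_prod \<rho> id) m - Poly_Mapping.single (\<rho> i, t) 1 = push (map_prod \<rho> id) (m - Poly_Mapping.single (i, t) 1)"
      by simp
    then show ?thesis by (simp only: rename_single pdiff_single l, (simp)?)
  qed
qed (simp add: pdiff_add rename_add)

lemma polarization_rename:
  assumes "inj \<rho>"
  shows "polarization (\<rho> i) (\<rho> j) (rename (map_prod \<rho> id) f) = rename (map_prod \<rho> id) (polarization i j f)"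
  by (simp add: polarization_def pdiff_rename[OF assms] rename_sum rename_mult rename_var)

text \<open>Even numbers code proper letters and odd ones negative symbols; the parity of a code
  later separates the two kinds of content.\<close>

definition proper_code :: "'l::finite \<Rightarrow> nat"
  where "proper_code i = 2 * to_nat i"

lemma inj_proper_code: "inj proper_code"
  by (auto simp: inj_def proper_code_def)

lemma code_Proper: "code (Proper (Letter i)) = proper_code i"
  by (simp add: code_def proper_code_def)

definition emb :: "('l::finite, 'd::finite) polys \<Rightarrow> ('p::finite, 'd) smod"
  where "emb f = vac (rename (map_prod proper_code id) f)"

lemma emb_inject:
  fixes f g :: "('l::finite, 'd::finite) polys"
  shows "emb f = emb g \<longleftrightarrow> f = g"
proof -
  have "inj (map_prod proper_code id :: 'l \<times> 'd \<Rightarrow> _)"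
    using inj_proper_code by (auto simp: inj_def)
  from inj_rename[OF this] show ?thesis by (simp only: emb_def vac_inject inj_eq)
qed

lemma emb_simps: "emb 0 = 0" "emb (f + g) = emb f + emb g" "emb (poly_const c * f) = smul (poly_const c) (emb f)"
  by (simp_all add: emb_def rename_add vac_add rename_mult rename_const vac_smul)

lemma eop_emb: "eop (Proper (Letter i)) (Proper (Letter j)) (emb f) = emb (polarization i j f)"
  by (simp add: emb_def eop_vac code_Proper polarization_rename[OF inj_proper_code])

lemma wact_emb: "wact (map (map_prod Proper Proper) w) (emb f) = emb (polarize_word w f)"
proof (induction w)
  case (Cons x w)
  obtain i j where "x = (Letter i, Letter j)" by (metis letter.exhaust surj_pair)
  then show ?case using Cons eop_emb by (simp add: polarize_word_def)
qed (simp add: polarize_word_def)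

lemma free_sact_emb: "free_sact (map_free (map_prod Proper Proper) u) (emb f) = emb (free_act u f)"
proof (induction u rule: poly_mapping_add_induct)
  case (single w c)
  then show ?case
    by (cases w) (simp add: map_free_single free_sact_single wact_emb free_act_single emb_simps)
qed (simp add: map_free_add free_sact_add free_act_add emb_simps)

text \<open>The link between the action in the theorem and the virtual one. Since \<open>emb\<close>
  is injective, identities of polynomials may be checked on the virtual side.\<close>

lemma sact_incl: "sact (incl u) (emb f) = emb (act u f)"
  by transfer (rule free_sact_emb)

section \<open>Devirtualization through the action\<close>

lemma abs_env_hom:
  "abs_env (p + q) = abs_env p + abs_env q" "abs_env (p - q) = abs_env p - abs_env q"
  "abs_env (p * q) = abs_env p * abs_env q" "abs_env 1 = 1" "abs_env 0 = 0" "abs_env (- p) = - abs_env p"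
  "abs_env (free_gen (a, b)) = gl_e a b"
  by (simp_all add: plus_env.abs_eq minus_env.abs_eq times_env.abs_eq one_env.abs_eq zero_env.abs_eq
      uminus_env.abs_eq gl_e.abs_eq)

lemma abs_env_gl_relation: "abs_env (gl_relation x y) = 0"
proof -
  have "gl_relation x y \<in> gl_ideal" using gl_ideal.gen[of 1 x y 1] by simp
  then have "abs_env (gl_relation x y) = abs_env 0" by (subst env.abs_eq_iff) simp
  then show ?thesis by (simp add: abs_env_hom)
qed

lemma gl_e_supercommute:
  "gl_e a b * gl_e c d = super_sign (a, b) (c, d) * (gl_e c d * gl_e a b) + of_bool (b = c) * gl_e a d
    - super_sign (a, b) (c, d) * of_bool (a = d) * gl_e c b"
proof -
  have 1: "abs_env (of_bool P) = of_bool P" for P by (cases P) (simp_all add: abs_env_hom)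
  have 2: "abs_env (super_sign x y) = super_sign x y" for x y :: "'a \<times> 'a"
    by (simp add: super_sign_eq abs_env_hom)
  show ?thesis
    using abs_env_gl_relation[of "(a, b)" "(c, d)"]
    by (simp add: gl_relation_def super_bracket_def abs_env_hom 1 2 algebra_simps)
qed

lemma incl_simps:
  "incl 0 = 0" "incl 1 = 1" "incl (u + v) = incl u + incl v" "incl (u * v) = incl u * incl v" "incl (- u) = - incl u"
  by (transfer, simp add: map_free_add map_free_mult map_free_uminus gl_ideal.zero)+

lemma incl_gl_e: "incl (gl_e a b) = gl_e (Proper a) (Proper b)"
  by transfer (simp add: map_free_gen gl_ideal.zero)

lemma incl_e_word: "incl (e_word w) = e_word (map (map_prod Proper Proper) w)"
  by (induction w) (auto simp: incl_simps incl_gl_e)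

lemma Irr_mult_left: "x \<in> Irr \<Longrightarrow> y * x \<in> Irr"
proof (induction rule: Irr.induct)
  case (gen w x)
  then show ?case using Irr.gen[of w "y * x"] by (simp add: mult.assoc)
qed (auto simp: distrib_left intro: Irr.intros)

lemma Irr_uminus: "x \<in> Irr \<Longrightarrow> - x \<in> Irr"
  using Irr_mult_left[of x "- 1"] by simp

definition virt_alg :: "('p, 'q, 'l) symbol env set"
  where "virt_alg = {x. \<exists>u. x - incl u \<in> Irr}"

lemma virt_alg_add: "x \<in> virt_alg \<Longrightarrow> y \<in> virt_alg \<Longrightarrow> x + y \<in> virt_alg"
  unfolding virt_alg_def mem_Collect_eq
proof (elim exE)
  fix u v assume "x - incl u \<in> Irr" "y - incl v \<in> Irr"
  then have "x + y - incl (u + v) \<in> Irr"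
    using Irr.add[of "x - incl u" "y - incl v"] by (simp add: incl_simps algebra_simps)
  then show "\<exists>w. x + y - incl w \<in> Irr" by blast
qed

lemma virt_alg_uminus: "x \<in> virt_alg \<Longrightarrow> - x \<in> virt_alg"
  unfolding virt_alg_def mem_Collect_eq
proof (elim exE)
  fix u assume "x - incl u \<in> Irr"
  then have "- x - incl (- u) \<in> Irr"
    using Irr_uminus[of "x - incl u"] by (simp add: incl_simps)
  then show "\<exists>w. - x - incl w \<in> Irr" by blast
qed

lemma Irr_in_virt_alg: "x \<in> Irr \<Longrightarrow> x \<in> virt_alg"
  unfolding virt_alg_def mem_Collect_eq by (rule exI[of _ 0]) (simp add: incl_simps)

lemma incl_in_virt_alg: "incl u \<in> virt_alg"
  unfolding virt_alg_def mem_Collect_eq by (rule exI[of _ u]) (simp add: Irr.zero)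

text \<open>Weight zero for every virtual symbol. Supercommutators preserve this condition, which
  lets the induction below recurse on them.\<close>

definition balanced :: "(('p, 'q, 'l) symbol \<times> ('p, 'q, 'l) symbol) list \<Rightarrow> bool"
  where "balanced w \<longleftrightarrow> (\<forall>\<gamma>. virtual \<gamma> \<longrightarrow> count_list (map fst w) \<gamma> = count_list (map snd w) \<gamma>)"

lemma not_virtual_iff: "\<not> virtual a \<longleftrightarrow> (\<exists>i. a = Proper i)"
  by (auto simp: virtual_def split: symbol.split)

lemma irregular_single: "virtual \<gamma> \<Longrightarrow> irregular [(a, \<gamma>)]"
proof -
  assume "virtual \<gamma>"
  moreover have "{j. j \<le> (0::nat) \<and> snd (rev [(a, \<gamma>)] ! j) = \<gamma>} = {0}" by auto
  ultimately show ?thesis unfolding irregular_def by (intro exI[of _ 0] conjI exI[of _ \<gamma>]) auto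
qed

lemma zero_in_virt_alg: "0 \<in> virt_alg"
  using Irr_in_virt_alg Irr.zero by blast

text \<open>Moving a factor \<open>e\<^bsub>a,\<gamma>\<^esub>\<close> with \<open>\<gamma>\<close> virtual to the right end makes a balanced word
  irregular; the commutators met on the way are shorter balanced words.\<close>

lemma balanced_virt_alg: "balanced w \<Longrightarrow> e_word w \<in> virt_alg"
proof (induction "length w" arbitrary: w rule: less_induct)
  case less
  show ?case
  proof (cases "\<exists>x\<in>set w. virtual (snd x)")
    case False
    \<comment> \<open>No virtual symbol is in second place, so balance excludes them from first
      place too and the word lies in the image of \<open>incl\<close>.\<close>
    have "\<not> virtual (fst x)" if "x \<in> set w" for x
    proof
      assume "virtual (fst x)"
      then have "count_list (map fst w) (fst x) = count_list (map snd w) (fst x)"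
        using less.prems by (simp add: balanced_def)
      moreover have "count_list (map fst w) (fst x) \<noteq> 0"
        using that by (simp add: count_list_0_iff)
      ultimately have "count_list (map snd w) (fst x) \<noteq> 0"
        by simp
      then show False using False \<open>virtual (fst x)\<close> by (auto simp: count_list_0_iff)
    qed
    then have "\<exists>y. x = map_prod Proper Proper y" if "x \<in> set w" for x
      using False that by (cases x) (metis fst_conv snd_conv map_prod_simp not_virtual_iff)
    then obtain v where "w = map (map_prod Proper Proper) v"
      by (metis ex_map_conv)
    then show ?thesis by (metis incl_e_word incl_in_virt_alg)
  next
    case True
    then obtain u a \<gamma> v where w: "w = u @ (a, \<gamma>) # v" and \<gamma>: "virtual \<gamma>"
      by (metis split_list prod.collapse)
    have "e_word (u @ (a, \<gamma>) # v) \<in> virt_alg"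
      if "length (u @ (a, \<gamma>) # v) = length w" "balanced (u @ (a, \<gamma>) # v)" for u v
      using that
    proof (induction v arbitrary: u)
      case Nil
      then show ?case
        using Irr.gen[OF irregular_single[OF \<gamma>], of "e_word u" a] by (simp add: e_word_append Irr_in_virt_alg)
    next
      case (Cons x v)
      obtain c d where x: "x = (c, d)" by fastforce
      have bal: "count_list (map fst u) \<delta> + of_bool (a = \<delta>) + of_bool (c = \<delta>) + count_list (map fst v) \<delta> =
          count_list (map snd u) \<delta> + of_bool (\<gamma> = \<delta>) + of_bool (d = \<delta>) + count_list (map snd v) \<delta>"
        if "virtual \<delta>" for \<delta>
        using Cons.prems(2) that unfolding balanced_def x by (auto dest!: spec[of _ \<delta>] simp: of_bool_def)
      have 1: "e_word ((u @ [(c, d)]) @ (a, \<gamma>) # v) \<in> virt_alg"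
      proof (rule Cons.IH)
        show "balanced ((u @ [(c, d)]) @ (a, \<gamma>) # v)"
          unfolding balanced_def
        proof (intro allI impI)
          fix \<delta> :: "('a, 'b, 'c) symbol" assume "virtual \<delta>"
          from bal[OF this] show "count_list (map fst ((u @ [(c, d)]) @ (a, \<gamma>) # v)) \<delta> =
              count_list (map snd ((u @ [(c, d)]) @ (a, \<gamma>) # v)) \<delta>"
            by (simp add: of_bool_def split: if_splits)
        qed
      qed (use Cons.prems(1) in \<open>simp add: x\<close>)
      have 2: "of_bool (\<gamma> = c) * e_word (u @ (a, d) # v) \<in> virt_alg"
      proof (cases "\<gamma> = c")
        case True
        have "balanced (u @ (a, d) # v)"
          unfolding balanced_def
        proof (intro allI impI)
          fix \<delta> :: "('a, 'b, 'c) symbol" assume "virtual \<delta>"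
          from bal[OF this] show "count_list (map fst (u @ (a, d) # v)) \<delta> = count_list (map snd (u @ (a, d) # v)) \<delta>"
            by (simp add: True of_bool_def split: if_splits)
        qed
        then have "e_word (u @ (a, d) # v) \<in> virt_alg"
          using Cons.prems(1) by (intro less.hyps) (simp_all add: x)
        then show ?thesis using True by simp
      qed (simp add: zero_in_virt_alg)
      have 3: "of_bool (a = d) * e_word (u @ (c, \<gamma>) # v) \<in> virt_alg"
      proof (cases "a = d")
        case True
        have "balanced (u @ (c, \<gamma>) # v)"
          unfolding balanced_def
        proof (intro allI impI)
          fix \<delta> :: "('a, 'b, 'c) symbol" assume "virtual \<delta>"
          from bal[OF this] show "count_list (map fst (u @ (c, \<gamma>) # v)) \<delta> = count_list (map snd (u @ (c, \<gamma>) # v)) \<delta>"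
            by (simp add: True of_bool_def split: if_splits)
        qed
        then have "e_word (u @ (c, \<gamma>) # v) \<in> virt_alg"
          using Cons.prems(1) by (intro less.hyps) (simp_all add: x)
        then show ?thesis using True by simp
      qed (simp add: zero_in_virt_alg)
      define \<epsilon> :: "('a, 'b, 'c) symbol env" where "\<epsilon> = super_sign (a, \<gamma>) (c, d)"
      \<comment> \<open>The sign is an element of a noncommutative ring; being 1 or -1 it is central
        and can be moved to the front.\<close>
      have \<epsilon>: "\<epsilon> = 1 \<or> \<epsilon> = - 1" by (simp add: \<epsilon>_def super_sign_eq)
      have expand: "p * (\<epsilon> * q + r - \<epsilon> * s) * t = \<epsilon> * (p * q * t) + p * r * t - \<epsilon> * (p * s * t)" for p q r s t
        using \<epsilon> by (elim disjE) (simp_all only: distrib_left distrib_right left_diff_distrib right_diff_distrib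
            mult_1 mult_minus_left mult_minus_right mult_1_left)
      have "e_word (u @ (a, \<gamma>) # x # v) = e_word u * (gl_e a \<gamma> * gl_e c d) * e_word v"
        by (simp add: e_word_append x mult.assoc)
      also have "gl_e a \<gamma> * gl_e c d =
          \<epsilon> * (gl_e c d * gl_e a \<gamma>) + of_bool (\<gamma> = c) * gl_e a d - \<epsilon> * (of_bool (a = d) * gl_e c \<gamma>)"
        unfolding \<epsilon>_def by (subst gl_e_supercommute) (simp only: mult.assoc)
      also have "e_word u * \<dots> * e_word v = \<epsilon> * e_word ((u @ [(c, d)]) @ (a, \<gamma>) # v) +
          of_bool (\<gamma> = c) * e_word (u @ (a, d) # v) - \<epsilon> * (of_bool (a = d) * e_word (u @ (c, \<gamma>) # v))"
        unfolding expand
        by (cases "\<gamma> = c"; cases "a = d"; simp add: e_word_append mult.assoc)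
      also have "\<dots> \<in> virt_alg"
      proof -
        have "\<epsilon> * y \<in> virt_alg" if "y \<in> virt_alg" for y
          using \<epsilon> that virt_alg_uminus by auto
        then show ?thesis
          unfolding diff_conv_add_uminus using 1 2 3 by (intro virt_alg_add virt_alg_uminus)
      qed
      finally show ?case .
    qed
    from this[of u v] show ?thesis using w less.prems by simp
  qed
qed

section \<open>Weights of virtual symbols and the vanishing of irregular words\<close>

lemma poly_const_mult_lookup: "Poly_Mapping.lookup (poly_const c * f) m = c * Poly_Mapping.lookup f m"
  by (induction f rule: poly_mapping_add_induct)
    (simp_all add: poly_const_def mult_single lookup_single when_def distrib_left lookup_add)

lemma lookup_var_pdiff:
  "Poly_Mapping.lookup (poly_var i t * pdiff i t f) m = of_nat (Poly_Mapping.lookup m (i, t)) * Poly_Mapping.lookup f m"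
proof (induction f rule: poly_mapping_add_induct)
  case (single n c)
  show ?case
  proof (cases "Poly_Mapping.lookup n (i, t) = 0")
    case True
    then show ?thesis by (auto simp: pdiff_single lookup_single when_def)
  next
    case False
    then have "Poly_Mapping.single (i, t) 1 + (n - Poly_Mapping.single (i, t) 1) = n"
      by (intro poly_mapping_eqI) (auto simp: lookup_add lookup_minus lookup_single when_def)
    then show ?thesis by (simp add: pdiff_single poly_var_def mult_single lookup_single when_def)
  qed
qed (simp add: pdiff_add distrib_left lookup_add)

text \<open>The operator is diagonal on monomials. N is the number of columns t with (p|t) in A for
  a positive symbol p, and the total exponent of \<gamma> in m otherwise.\<close>

lemma eop_diagonal:
  "\<exists>N. Poly_Mapping.lookup (eop \<gamma> \<gamma> F A) m = of_nat N * Poly_Mapping.lookup (F A) m"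
proof (cases "is_pos \<gamma>")
  case True
  then obtain p where p: "\<gamma> = Pos p" by (auto simp: is_pos_def)
  have "Poly_Mapping.lookup (eop \<gamma> \<gamma> F A) m = (\<Sum>t\<in>UNIV. of_bool ((p, t) \<in> A) * Poly_Mapping.lookup (F A) m)"
    unfolding eop_def sum_fun_apply lookup_sum
    by (intro sum.cong refl) (auto simp: p cre_def ann_def fcre_def fann_def insert_absorb)
  then show ?thesis
    by (intro exI[of _ "\<Sum>t\<in>UNIV. of_bool ((p, t) \<in> A)"]) (simp only: of_nat_sum of_nat_of_bool sum_distrib_right)
next
  case False
  have "Poly_Mapping.lookup (eop \<gamma> \<gamma> F A) m =
      (\<Sum>t\<in>UNIV. of_nat (Poly_Mapping.lookup m (code \<gamma>, t)) * Poly_Mapping.lookup (F A) m)"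
    unfolding eop_def sum_fun_apply lookup_sum
    by (intro sum.cong refl) (simp add: False cre_nonpos ann_nonpos smul_def lookup_var_pdiff)
  then show ?thesis
    by (intro exI[of _ "\<Sum>t\<in>UNIV. Poly_Mapping.lookup m (code \<gamma>, t)"]) (simp only: of_nat_sum of_nat_of_bool sum_distrib_right)
qed

text \<open>\<open>e\<^bsub>\<gamma>,\<gamma>\<^esub>\<close> counts the occurrences of \<open>\<gamma>\<close>, so negative weights do not occur. An irregular word
  would reach one.\<close>

definition has_weight :: "('p::finite, 'q::finite, 'l::finite) symbol \<Rightarrow> int \<Rightarrow> ('p, 'd::finite) smod \<Rightarrow> bool"
  where "has_weight \<gamma> c F \<longleftrightarrow> eop \<gamma> \<gamma> F = smul (poly_const (of_int c)) F"

lemma has_weight_negative: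
  assumes "has_weight \<gamma> c F" "c < 0"
  shows "F = 0"
proof (rule ext, rule poly_mapping_eqI)
  fix A m
  obtain N :: nat where "Poly_Mapping.lookup (eop \<gamma> \<gamma> F A) m = of_nat N * Poly_Mapping.lookup (F A) m"
    using eop_diagonal by blast
  then have "of_nat N * Poly_Mapping.lookup (F A) m = of_int c * Poly_Mapping.lookup (F A) m"
    using assms(1) by (simp only: has_weight_def smul_def poly_const_mult_lookup)
  moreover have "(of_nat N :: complex) \<noteq> of_int c"
    using assms(2) by (metis of_int_eq_iff of_int_of_nat_eq of_nat_0_le_iff not_le)
  ultimately show "Poly_Mapping.lookup (F A) m = Poly_Mapping.lookup (0 A) m"
    by (simp add: zero_fun_apply)
qed

lemma poly_const_diff: "poly_const (a - b) = poly_const a - poly_const b"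
  by (simp add: poly_const_def single_diff)

lemma poly_const_of_bool: "poly_const (of_bool P) = of_bool P"
  by (cases P) simp_all

lemma has_weight_eop:
  assumes "has_weight \<gamma> c F"
  shows "has_weight \<gamma> (c + of_bool (a = \<gamma>) - of_bool (b = \<gamma>)) (eop a b F)"
proof -
  have s: "super_sign (\<gamma>, \<gamma>) (a, b) = 1"
    by (simp add: super_sign_eq)
  have 1: "smul (of_bool (\<gamma> = a)) (eop \<gamma> b F) = smul (of_bool (a = \<gamma>)) (eop a b F)"
    "smul (of_bool (\<gamma> = b)) (eop a \<gamma> F) = smul (of_bool (b = \<gamma>)) (eop a b F)"
    by (cases "a = \<gamma>"; simp) (cases "b = \<gamma>"; simp)
  have "eop \<gamma> \<gamma> (eop a b F) = smul (poly_const (of_int c)) (eop a b F) + smul (of_bool (a = \<gamma>)) (eop a b F)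
      - smul (of_bool (b = \<gamma>)) (eop a b F)"
    using eop_supercommute[of \<gamma> \<gamma> a b F] assms
    by (simp only: s has_weight_def smul_simps mult_1 eop_smul[OF inert_const] 1)
  also have "\<dots> = smul (poly_const (of_int c) + of_bool (a = \<gamma>) - of_bool (b = \<gamma>)) (eop a b F)"
    by (simp only: diff_conv_add_uminus smul_add smul_minus)
  also have "poly_const (of_int c) + of_bool (a = \<gamma>) - of_bool (b = \<gamma>) =
      poly_const (of_int (c + of_bool (a = \<gamma>) - of_bool (b = \<gamma>)))"
    by (simp add: poly_const_add poly_const_diff poly_const_of_bool)
  finally show ?thesis unfolding has_weight_def .
qed

lemma has_weight_wact:
  assumes "has_weight \<gamma> c F"
  shows "has_weight \<gamma> (c + int (count_list (map fst w) \<gamma>) - int (count_list (map snd w) \<gamma>)) (wact w F)"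
proof (induction w)
  case (Cons x w)
  obtain a b where x: "x = (a, b)" by fastforce
  have "c + int (count_list (map fst w) \<gamma>) - int (count_list (map snd w) \<gamma>) + of_bool (a = \<gamma>) - of_bool (b = \<gamma>) =
      c + int (count_list (map fst (x # w)) \<gamma>) - int (count_list (map snd (x # w)) \<gamma>)"
    by (auto simp: x)
  then show ?case using has_weight_eop[OF Cons, of a b] by (simp only: x wact_simps)
qed (simp add: assms)

lemma pdiff_rename_notin:
  assumes "n \<notin> range \<rho>"
  shows "pdiff n t (rename (map_prod \<rho> id) f) = 0"
proof (induction f rule: poly_mapping_add_induct)
  case (single m c)
  have "Poly_Mapping.lookup (push (map_prod \<rho> id) m) (n, t) = 0"
    unfolding push_def lookup_sum
    by (intro sum.neutral ballI) (use assms in \<open>auto simp: lookup_single when_def\<close>)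
  then show ?case by (simp only: rename_single pdiff_single) simp
qed (simp add: pdiff_add rename_add)

lemma has_weight_emb:
  fixes f :: "('l::finite, 'd::finite) polys" and \<gamma> :: "('p::finite, 'q::finite, 'l) symbol"
  assumes "virtual \<gamma>"
  shows "has_weight \<gamma> 0 (emb f)"
proof -
  consider p where "\<gamma> = Pos p" | q where "\<gamma> = Neg q"
    using assms by (auto simp: virtual_def split: symbol.splits)
  then have "eop \<gamma> \<gamma> (emb f) = 0"
  proof cases
    case 1
    then show ?thesis by (simp add: emb_def)
  next
    case 2
    have "code \<gamma> \<notin> range (proper_code :: 'l \<Rightarrow> nat)"
      by (auto simp: 2 code_def proper_code_def) presburger
    then have "polarization (code \<gamma>) (code \<gamma>) (rename (map_prod proper_code id) f) = 0"
      by (simp add: polarization_def pdiff_rename_notin)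
    moreover have "\<not> is_pos \<gamma>" by (simp add: 2)
    ultimately show ?thesis by (simp add: emb_def eop_vac)
  qed
  then show ?thesis by (simp add: has_weight_def)
qed

lemma card_nth_eq_count_list:
  "i \<le> length v \<Longrightarrow> card {j. j < i \<and> f (v ! j) = \<gamma>} = count_list (map f (take i v)) \<gamma>"
proof (induction i)
  case (Suc i)
  have "{j. j < Suc i \<and> f (v ! j) = \<gamma>} =
      (if f (v ! i) = \<gamma> then insert i {j. j < i \<and> f (v ! j) = \<gamma>} else {j. j < i \<and> f (v ! j) = \<gamma>})"
    by (auto simp: less_Suc_eq)
  then show ?case using Suc by (simp add: take_Suc_conv_app_nth)
qed simp

text \<open>To the right of the offending factor \<open>eop a b\<close>, the word v has brought the
  weight c of \<gamma> below zero, or to zero with b = \<gamma>. In the latter case the factor leads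
  to weight -1, unless a = \<gamma>, when it multiplies by the weight zero.\<close>

lemma irregular_wact_emb:
  fixes f :: "('l::finite, 'd::finite) polys" and w :: "(('p::finite, 'q::finite, 'l) symbol \<times> ('p, 'q, 'l) symbol) list"
  assumes "irregular w"
  shows "wact w (emb f) = 0"
proof -
  obtain i \<gamma> where i: "i < length w" and \<gamma>: "virtual \<gamma>"
    and gt: "card {j. j \<le> i \<and> snd (rev w ! j) = \<gamma>} > card {j. j < i \<and> fst (rev w ! j) = \<gamma>}"
    using assms unfolding irregular_def by blast
  define v where "v = rev (take i (rev w))"
  obtain a b where ab: "rev w ! i = (a, b)" by fastforce
  have w: "w = rev (drop (Suc i) (rev w)) @ (a, b) # v"
  proof -
    have "rev w = take i (rev w) @ (a, b) # drop (Suc i) (rev w)"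
      using i ab by (metis id_take_nth_drop length_rev)
    then have "rev (rev w) = rev (take i (rev w) @ (a, b) # drop (Suc i) (rev w))" by (rule arg_cong)
    then show ?thesis by (simp add: v_def)
  qed
  have take: "take (Suc i) (rev w) = take i (rev w) @ [(a, b)]"
    using i ab by (simp add: take_Suc_conv_app_nth)
  have "{j. j \<le> i \<and> snd (rev w ! j) = \<gamma>} = {j. j < Suc i \<and> snd (rev w ! j) = \<gamma>}"
    by auto
  then have *: "of_bool (b = \<gamma>) + count_list (map snd v) \<gamma> > count_list (map fst v) \<gamma>"
    using gt i by (simp add: card_nth_eq_count_list take v_def rev_map[symmetric] count_list_rev split: if_splits)
  define c where "c = int (count_list (map fst v) \<gamma>) - int (count_list (map snd v) \<gamma>)"
  have hw: "has_weight \<gamma> c (wact v (emb f))"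
    using has_weight_wact[OF has_weight_emb[OF \<gamma>], of v f] by (simp add: c_def)
  have "eop a b (wact v (emb f)) = 0"
  proof (cases "c < 0")
    case True
    then show ?thesis using has_weight_negative[OF hw] by simp
  next
    case False
    then have b: "b = \<gamma>" "c = 0" using * by (cases "b = \<gamma>"; simp add: c_def)+
    show ?thesis
    proof (cases "a = \<gamma>")
      case True
      then show ?thesis using hw b by (simp add: has_weight_def)
    next
      case False
      then have "has_weight \<gamma> (- 1) (eop a b (wact v (emb f)))"
        using has_weight_eop[OF hw, of a b] b by simp
      then show ?thesis using has_weight_negative by fastforce
    qed
  qed
  then show ?thesis by (subst w) (simp add: wact_append)
qed

lemma Irr_sact_emb:
  fixes f :: "('l::finite, 'd::finite) polys" and x :: "('p::finite, 'q::finite, 'l) symbol env"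
  shows "x \<in> Irr \<Longrightarrow> sact x (emb f) = 0"
proof (induction rule: Irr.induct)
  case (gen w x)
  then show ?case by (simp add: sact_mult sact_e_word irregular_wact_emb)
qed (simp_all add: sact_add)

text \<open>\<open>devirt\<close> is a choice, but whichever representative it picks differs from x
  by an element of \<open>Irr\<close>, which vanishes on embedded polynomials. Only the existence of
  a representative enters, not its uniqueness.\<close>

lemma emb_act_devirt:
  assumes "x \<in> virt_alg"
  shows "emb (act (devirt x) f) = sact x (emb f)"
proof -
  have "x - incl (devirt x) \<in> Irr"
    using assms unfolding devirt_def virt_alg_def mem_Collect_eq by (rule someI_ex)
  then have "sact (x - incl (devirt x)) (emb f) = 0"
    by (rule Irr_sact_emb)
  then show ?thesis by (simp add: sact_diff sact_incl)
qed

section \<open>Spans of bitableaux\<close>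

lemma polarization_uminus: "polarization i j (- f) = - polarization i j f"
  using polarization_add[of i j f "- f"] by (simp add: add_eq_0_iff)

lemma polarization_sum: "polarization i j (\<Sum>k\<in>I. f k) = (\<Sum>k\<in>I. polarization i j (f k))"
  by (induction I rule: infinite_finite_induct) (simp_all add: polarization_add)

lemma polarization_1 [simp]: "polarization i j 1 = 0"
  using polarization_const[of i j 1] by simp

lemma polarization_prod:
  "finite I \<Longrightarrow> polarization i j (\<Prod>k\<in>I. f k) = (\<Sum>k\<in>I. polarization i j (f k) * (\<Prod>l\<in>I - {k}. f l))"
proof (induction I rule: finite_induct)
  case (insert x I)
  have "(\<Prod>l\<in>insert x I - {k}. f l) = f x * (\<Prod>l\<in>I - {k}. f l)" if "k \<in> I" for k
  proof -
    have "insert x I - {k} = insert x (I - {k})" "x \<notin> I - {k}" using insert that by auto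
    then show ?thesis using insert by simp
  qed
  then have "(\<Sum>k\<in>I. polarization i j (f k) * (\<Prod>l\<in>insert x I - {k}. f l)) =
      f x * (\<Sum>k\<in>I. polarization i j (f k) * (\<Prod>l\<in>I - {k}. f l))"
    by (simp add: sum_distrib_left mult.left_commute)
  then show ?case using insert by (simp add: polarization_mult)
qed simp

lemma polarization_sign: "polarization i j (signof p * f) = signof p * polarization i j f"
  by (simp add: sign_def polarization_uminus)

lemma pdiff_sign: "pdiff i j (signof p * f) = signof p * pdiff i j f"
  by (simp add: sign_def pdiff_uminus)

lemma bideterminant_eq:
  "bideterminant r = (\<Sum>p | p permutes {0..<length r}.
    signof p * (\<Prod>i = 0..<length r. poly_var (r ! i) (nth_element (p i))))"
proof -
  have "(\<Prod>i = 0..<length r. mat (length r) (length r) (\<lambda>(s, t). poly_var (r ! s) (nth_element t)) $$ (i, p i)) =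
      (\<Prod>i = 0..<length r. poly_var (r ! i) (nth_element (p i)))" if "p permutes {0..<length r}" for p
  proof (intro prod.cong refl)
    fix i assume "i \<in> {0..<length r}"
    moreover then have "p i \<in> {0..<length r}" using that by (simp add: permutes_in_image)
    ultimately show "mat (length r) (length r) (\<lambda>(s, t). poly_var (r ! s) (nth_element t)) $$ (i, p i) =
      poly_var (r ! i) (nth_element (p i))" by simp
  qed
  then show ?thesis
    unfolding bideterminant_def by (subst det_def'[of _ "length r"]) auto
qed

lemma polarization_bideterminant:
  "polarization a b (bideterminant r) = (\<Sum>s<length r. of_bool (r ! s = b) * bideterminant (r[s := a]))"
proof -
  let ?n = "length r" and ?P = "{p. p permutes {0..<length r}}"
  have upd: "(\<Prod>i = 0..<?n. poly_var (r[s := a] ! i) (nth_element (p i))) =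
      poly_var a (nth_element (p s)) * (\<Prod>i\<in>{0..<?n} - {s}. poly_var (r ! i) (nth_element (p i)))"
    if "s < ?n" for s p
    using that by (subst prod.remove[of _ s]) (auto intro!: prod.cong)
  have "polarization a b (bideterminant r) = (\<Sum>p\<in>?P. \<Sum>s = 0..<?n. of_bool (r ! s = b) *
      (signof p * (\<Prod>i = 0..<?n. poly_var (r[s := a] ! i) (nth_element (p i)))))"
    unfolding bideterminant_eq polarization_sum polarization_sign polarization_prod[OF finite_atLeastLessThan] sum_distrib_left
  proof (intro sum.cong refl)
    fix p s assume "s \<in> {0..<?n}"
    then have "s < ?n" by simp
    then show "signof p * (polarization a b (poly_var (r ! s) (nth_element (p s))) *
        (\<Prod>l\<in>{0..<?n} - {s}. poly_var (r ! l) (nth_element (p l)))) =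
      of_bool (r ! s = b) * (signof p * (\<Prod>i = 0..<?n. poly_var (r[s := a] ! i) (nth_element (p i))))"
      by (cases "r ! s = b") (simp_all add: polarization_var upd)
  qed
  also have "\<dots> = (\<Sum>s = 0..<?n. of_bool (r ! s = b) * bideterminant (r[s := a]))"
    unfolding bideterminant_eq by (subst sum.swap) (simp add: sum_distrib_left)
  finally show ?thesis by (simp add: atLeast0LessThan)
qed

lemma bideterminant_not_distinct:
  assumes "\<not> distinct r"
  shows "bideterminant r = 0"
proof -
  obtain i j where ij: "i < length r" "j < length r" "i \<noteq> j" "r ! i = r ! j"
    using assms by (auto simp: distinct_conv_nth)
  show ?thesis
    unfolding bideterminant_def
    by (rule det_identical_rows[of _ "length r" i j]) (use ij in \<open>auto simp: row_def\<close>)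
qed

lemma pdiff_prod_0: "(\<And>k. k \<in> I \<Longrightarrow> pdiff i t (f k) = 0) \<Longrightarrow> pdiff i t (\<Prod>k\<in>I. f k) = 0"
proof (induction I rule: infinite_finite_induct)
  case (insert x I)
  then show ?case by (simp add: pdiff_mult)
qed (use pdiff_const[of i t 1] in simp_all)

lemma pdiff_bideterminant_0:
  assumes "a \<notin> set r \<or> t \<notin> nth_element ` {..<length r}"
  shows "pdiff a t (bideterminant r) = 0"
proof -
  have "pdiff a t (\<Prod>i = 0..<length r. poly_var (r ! i) (nth_element (p i))) = 0"
    if "p permutes {0..<length r}" for p
  proof (rule pdiff_prod_0)
    fix i assume i: "i \<in> {0..<length r}"
    then have "p i < length r" using that by (metis atLeastLessThan_iff permutes_in_image)
    then show "pdiff a t (poly_var (r ! i) (nth_element (p i))) = 0"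
      using assms i by (auto simp: pdiff_var)
  qed
  then show ?thesis
    by (simp add: bideterminant_eq pdiff_sum pdiff_sign)
qed

text \<open>Contents are integer-valued so that replacing one letter b by a is always \<kappa> plus
  one unit minus another. If this makes a value negative, no generator exists and the span is
  zero.\<close>

inductive_set bispan :: "nat list \<Rightarrow> (nat \<Rightarrow> int) \<Rightarrow> (nat, 'd::{finite, linorder}) polys set"
  for sh \<kappa> where
  zero: "0 \<in> bispan sh \<kappa>"
| gen: "map length X = sh \<Longrightarrow> (\<And>n. int (count_list (concat X) n) = \<kappa> n) \<Longrightarrow> poly_const c * tableau_product X \<in> bispan sh \<kappa>"
| add: "p \<in> bispan sh \<kappa> \<Longrightarrow> q \<in> bispan sh \<kappa> \<Longrightarrow> p + q \<in> bispan sh \<kappa>"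

lemma bispan_const: "p \<in> bispan sh \<kappa> \<Longrightarrow> poly_const c * p \<in> bispan sh \<kappa>"
proof (induction rule: bispan.induct)
  case (gen X c')
  then show ?case using bispan.gen[OF gen, of "c * c'"] by (simp add: poly_const_mult mult.assoc)
qed (auto simp: distrib_left intro: bispan.intros)

lemma bispan_uminus: "p \<in> bispan sh \<kappa> \<Longrightarrow> - p \<in> bispan sh \<kappa>"
proof -
  have "poly_const (- 1) * p = - p"
    by (simp add: poly_const_def single_uminus)
  then show "p \<in> bispan sh \<kappa> \<Longrightarrow> - p \<in> bispan sh \<kappa>" by (metis bispan_const)
qed

lemma bispan_sum: "(\<And>i. i \<in> I \<Longrightarrow> f i \<in> bispan sh \<kappa>) \<Longrightarrow> (\<Sum>i\<in>I. f i) \<in> bispan sh \<kappa>"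
  by (induction I rule: infinite_finite_induct) (auto intro: bispan.intros)

lemma tableau_product_simps [simp]:
  "tableau_product [] = 1" "tableau_product (r # X) = bideterminant r * tableau_product X"
  by (simp_all add: tableau_product_def)

lemma tableau_product_bispan:
  "tableau_product X \<in> bispan (map length X) (\<lambda>n. int (count_list (concat X) n))"
  using bispan.gen[of X "map length X" "\<lambda>n. int (count_list (concat X) n)" 1] by simp

lemma bispan_Cons:
  "q \<in> bispan sh \<kappa> \<Longrightarrow> bideterminant r * q \<in> bispan (length r # sh) (\<lambda>n. int (count_list r n) + \<kappa> n)"
proof (induction rule: bispan.induct)
  case (gen X c)
  have "poly_const c * tableau_product (r # X) \<in> bispan (length r # sh) (\<lambda>n. int (count_list r n) + \<kappa> n)"
    by (rule bispan.gen) (use gen in auto)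
  then show ?case by (simp add: mult_ac)
qed (auto simp: distrib_left intro: bispan.intros)

lemma count_list_update:
  "s < length r \<Longrightarrow> int (count_list (r[s := a]) n) = int (count_list r n) + of_bool (a = n) - of_bool (r ! s = n)"
proof (induction r arbitrary: s)
  case (Cons x r)
  then show ?case by (cases s) auto
qed simp

lemma polarization_tableau_product:
  "polarization a b (tableau_product X :: (nat, 'd::{finite, linorder}) polys) \<in>
    bispan (map length X) (\<lambda>n. int (count_list (concat X) n) + of_bool (a = n) - of_bool (b = n))"
proof (induction X)
  case Nil
  then show ?case by (simp add: bispan.zero)
next
  case (Cons r X)
  let ?K = "bispan (map length (r # X)) (\<lambda>n. int (count_list (concat (r # X)) n) + of_bool (a = n) - of_bool (b = n)) :: (nat, 'd) polys set"
  have "of_bool (r ! s = b) * (bideterminant (r[s := a]) * tableau_product X) \<in> ?K" if "s < length r" for s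
  proof (cases "r ! s = b")
    case True
    have "poly_const 1 * tableau_product (r[s := a] # X) \<in> ?K"
      by (rule bispan.gen) (use that True in \<open>auto simp: count_list_update\<close>)
    then show ?thesis using True by simp
  qed (simp add: bispan.zero)
  then have "polarization a b (bideterminant r) * tableau_product X \<in> ?K"
    unfolding polarization_bideterminant sum_distrib_right
    by (intro bispan_sum) (simp only: mult.assoc lessThan_iff)
  moreover have "bideterminant r * polarization a b (tableau_product X) \<in> ?K"
    using bispan_Cons[OF Cons.IH, of r] by (simp add: add.assoc add_diff_eq)
  ultimately show ?case unfolding tableau_product_simps polarization_mult by (rule bispan.add)
qed

lemma polarization_bispan:
  fixes q :: "(nat, 'd::{finite, linorder}) polys"
  shows "q \<in> bispan sh \<kappa> \<Longrightarrow> polarization a b q \<in> bispan sh (\<lambda>n. \<kappa> n + of_bool (a = n) - of_bool (b = n))"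
proof (induction rule: bispan.induct)
  case (gen X c)
  have "\<kappa> = (\<lambda>n. int (count_list (concat X) n))" "sh = map length X" using gen by auto
  then show ?case unfolding polarization_const_mult
    using bispan_const[OF polarization_tableau_product[of a b X], of c] by simp
qed (auto simp: polarization_add intro: bispan.intros)

text \<open>A repeated letter in a row of X is a repeated row of a determinant, so under the second
  assumption every generator vanishes.\<close>

lemma bispan_trivial:
  fixes q :: "(nat, 'd::{finite, linorder}) polys"
  assumes "q \<in> bispan sh \<kappa>"
    and "\<And>X. map length X = sh \<Longrightarrow> (\<And>n. int (count_list (concat X) n) = \<kappa> n) \<Longrightarrow> \<exists>r\<in>set X. \<not> distinct r"
  shows "q = 0"
  using assms(1)
proof (induction rule: bispan.induct)
  case (gen X c)
  then obtain r where "r \<in> set X" "\<not> distinct r" using assms(2) by blast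
  then have "(tableau_product X :: (nat, 'd) polys) = 0"
    by (induction X) (auto simp: bideterminant_not_distinct)
  then show ?case by simp
qed auto

section \<open>Contracting a pair of odd words into ordinary polarizations\<close>

lemma vac_uminus: "- vac p = (vac (- p) :: _ \<Rightarrow> 'r::comm_ring_1)"
  by (simp add: vac_def fun_eq_iff)

definition vac_bispan :: "nat list \<Rightarrow> (nat \<Rightarrow> int) \<Rightarrow> ('p, 'd::{finite, linorder}) smod set"
  where "vac_bispan sh \<kappa> = vac ` bispan sh \<kappa>"

lemma vac_bispan_0: "0 \<in> vac_bispan sh \<kappa>"
  unfolding vac_bispan_def by (rule image_eqI[of _ _ 0]) (simp_all add: bispan.zero)

lemma vac_bispan_uminus: "F \<in> vac_bispan sh \<kappa> \<Longrightarrow> - F \<in> vac_bispan sh \<kappa>"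
  unfolding vac_bispan_def by (auto simp: vac_uminus bispan_uminus)

lemma vac_bispan_add: "F \<in> vac_bispan sh \<kappa> \<Longrightarrow> G \<in> vac_bispan sh \<kappa> \<Longrightarrow> F + G \<in> vac_bispan sh \<kappa>"
  unfolding vac_bispan_def by (auto simp: bispan.add simp flip: vac_add)

definition letter_count :: "('p::finite, 'q::finite, 'l::finite) symbol list \<Rightarrow> nat \<Rightarrow> int"
  where "letter_count w n = int (count_list (map code w) n)"

lemma letter_count_simps:
  "letter_count [] n = 0" "letter_count (a # w) n = of_bool (code a = n) + letter_count w n"
  "letter_count (u @ w) n = letter_count u n + letter_count w n"
  by (auto simp: letter_count_def)

lemma wact_uminus: "wact w (- F) = - wact w F"
  using wact_add[of w F "- F"] by (simp add: add_eq_0_iff)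

lemma eop_commute:
  assumes "b \<noteq> c" "a \<noteq> d" "parity a = parity b \<or> parity c = parity d"
  shows "eop a b (eop c d F) = eop c d (eop a b F)"
proof -
  have "even ((parity a + parity b) * (parity c + parity d))"
    using assms(3) by auto
  then have "super_sign (a, b) (c, d) = (1 :: (nat, 'd) polys)" by (simp add: super_sign_eq)
  then show ?thesis using assms by (simp add: eop_supercommute[of a b c d])
qed

lemma wact_commute:
  assumes "\<And>c d. (c, d) \<in> set w \<Longrightarrow> b \<noteq> c \<and> a \<noteq> d" "parity a = parity b"
  shows "eop a b (wact w F) = wact w (eop a b F)"
  using assms(1)
proof (induction w)
  case (Cons x w)
  obtain c d where x: "x = (c, d)" by fastforce
  have "eop a b (wact w F) = wact w (eop a b F)"
  proof (rule Cons.IH)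
    show "b \<noteq> c \<and> a \<noteq> d" if "(c, d) \<in> set w" for c d
      by (rule Cons.prems) (simp add: that)
  qed
  moreover have "b \<noteq> c" "a \<noteq> d" using Cons.prems[of c d] by (simp_all add: x)
  ultimately show ?case by (simp add: x eop_commute[of b c a d] assms(2))
qed simp

text \<open>The odd factor \<open>eop a b\<close> has passed B1 and now passes
  \<open>(c, d)\<close>, which is odd too; hence the minus sign. The only possible contraction is
  through b = c. It gives the even operator \<open>eop a d\<close>, which commutes with the rest B2
  and so reaches the polynomial.\<close>

lemma contract_step:
  fixes a b c d :: "('p::finite, 'q::finite, 'l::finite) symbol" and p :: "(nat, 'd::finite) polys"
  assumes "\<And>x. x \<in> set B2 \<Longrightarrow> \<exists>\<alpha> i. x = (Pos \<alpha>, Proper i)"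
    and "a = Neg q" "b = Pos \<alpha>" "c = Pos \<alpha>'" "d = Proper i"
  shows "wact As (wact B1 (eop a b (wact ((c, d) # B2) (vac p)))) =
      smul (of_bool (b = c)) (wact As (wact (B1 @ B2) (eop a d (vac p)))) +
      - wact As (wact (B1 @ [(c, d)]) (eop a b (wact B2 (vac p))))"
proof -
  have s: "super_sign (a, b) (c, d) = (- 1 :: (nat, 'd) polys)"
    by (simp add: assms super_sign_eq parity_is_pos)
  have "eop a d (wact B2 (vac p)) = wact B2 (eop a d (vac p))"
  proof (rule wact_commute)
    show "d \<noteq> c' \<and> a \<noteq> d'" if "(c', d') \<in> set B2" for c' d'
      using assms(1)[OF that] assms(2-5) by auto
  qed (simp add: parity_is_pos assms)
  moreover have "eop a b (eop c d (wact B2 (vac p))) =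
      smul (of_bool (b = c)) (eop a d (wact B2 (vac p))) + - eop c d (eop a b (wact B2 (vac p)))"
  proof -
    have "a \<noteq> d" by (simp add: assms)
    then show ?thesis
      unfolding eop_supercommute[of a b c d] s by (simp add: smul_minus)
  qed
  ultimately have "eop a b (eop c d (wact B2 (vac p))) =
      smul (of_bool (b = c)) (wact B2 (eop a d (vac p))) + - eop c d (eop a b (wact B2 (vac p)))" by (simp only:)
  then show ?thesis
    by (cases "b = c") (simp_all only: wact_simps wact_add wact_uminus wact_append of_bool_eq smul_simps add_0 simp_thms wact_0)
qed

text \<open>Each factor \<open>e\<^bsub>\<beta>,\<alpha>\<^esub>\<close> on the left is contracted with a factor \<open>e\<^bsub>\<alpha>,i\<^esub>\<close> on its right into
  the ordinary polarization \<open>e\<^bsub>\<beta>,i\<^esub>\<close>, which preserves the span of the bitableaux of a given shape.\<close>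

lemma wact_contract_bispan:
  fixes As Bs :: "(('p::finite, 'q::finite, 'l::finite) symbol \<times> ('p, 'q, 'l) symbol) list"
    and p :: "(nat, 'd::{finite, linorder}) polys"
  assumes "length As = length Bs"
    and "\<And>x. x \<in> set As \<Longrightarrow> \<exists>q \<alpha>. x = (Neg q, Pos \<alpha>)" and "\<And>x. x \<in> set Bs \<Longrightarrow> \<exists>\<alpha> i. x = (Pos \<alpha>, Proper i)"
    and "p \<in> bispan sh \<kappa>"
  shows "wact As (wact Bs (vac p)) \<in> vac_bispan sh (\<lambda>n. \<kappa> n + letter_count (map fst As) n - letter_count (map snd Bs) n)"
  using assms
proof (induction As arbitrary: Bs p \<kappa> rule: rev_induct)
  case Nil
  then show ?case by (simp add: letter_count_simps vac_bispan_def)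
next
  case (snoc x As)
  obtain q \<alpha> a b where x: "x = (a, b)" and ab: "a = Neg q" "b = Pos \<alpha>" using snoc.prems(2)[of x] by auto
  have "wact As (wact B1 (eop a b (wact B2 (vac p)))) \<in>
      vac_bispan sh (\<lambda>n. \<kappa> n + letter_count (map fst (As @ [x])) n - letter_count (map snd (B1 @ B2)) n)"
    if "length (As @ [x]) = length (B1 @ B2)" "\<And>x. x \<in> set (B1 @ B2) \<Longrightarrow> \<exists>\<alpha> i. x = (Pos \<alpha>, Proper i)"
    for B1 B2 :: "(('p, 'q, 'l) symbol \<times> ('p, 'q, 'l) symbol) list"
    using that
  proof (induction B2 arbitrary: B1)
    case Nil
    \<comment> \<open>With nothing left to contract, \<open>eop a b\<close> meets a polynomial
      without odd variables.\<close>
    show ?case by (simp only: wact_simps ab eop_vac_pos wact_0 vac_bispan_0)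
  next
    case (Cons y B2)
    obtain \<alpha>' i c d where y: "y = (c, d)" and cd: "c = Pos \<alpha>'" "d = Proper i" using Cons.prems(2)[of y] by auto
    define K where "K = (\<lambda>n. \<kappa> n + letter_count (map fst (As @ [x])) n - letter_count (map snd (B1 @ y # B2)) n)"
    \<comment> \<open>The contracted term: both words are one factor shorter and the polynomial is
      polarized, so the outer induction hypothesis applies with the content shifted
      accordingly.\<close>
    have "wact As (wact (B1 @ B2) (vac (polarization (code a) (code d) p))) \<in>
        vac_bispan sh (\<lambda>n. (\<kappa> n + of_bool (code a = n) - of_bool (code d = n)) +
         letter_count (map fst As) n - letter_count (map snd (B1 @ B2)) n)"
    proof (rule snoc.IH)
      show "length As = length (B1 @ B2)" using Cons.prems(1) by simp
      show "\<exists>q \<alpha>. z = (Neg q, Pos \<alpha>)" if "z \<in> set As" for z using snoc.prems(2)[of z] that by simp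
      show "\<exists>\<alpha> i. z = (Pos \<alpha>, Proper i)" if "z \<in> set (B1 @ B2)" for z using Cons.prems(2)[of z] that by auto
    qed (rule polarization_bispan[OF snoc.prems(4)])
    also have "(\<lambda>n. (\<kappa> n + of_bool (code a = n) - of_bool (code d = n)) +
         letter_count (map fst As) n - letter_count (map snd (B1 @ B2)) n) = K"
      by (simp add: K_def x y letter_count_simps fun_eq_iff)
    finally have 1: "wact As (wact (B1 @ B2) (eop a d (vac p))) \<in> vac_bispan sh K"
      by (simp add: eop_vac ab cd)
    have "wact As (wact (B1 @ [y]) (eop a b (wact B2 (vac p)))) \<in>
       vac_bispan sh (\<lambda>n. \<kappa> n + letter_count (map fst (As @ [x])) n - letter_count (map snd ((B1 @ [y]) @ B2)) n)"
    proof (rule Cons.IH)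
      show "length (As @ [x]) = length ((B1 @ [y]) @ B2)" using Cons.prems(1) by simp
      show "\<exists>\<alpha> i. z = (Pos \<alpha>, Proper i)" if "z \<in> set ((B1 @ [y]) @ B2)" for z using Cons.prems(2)[of z] that by auto
    qed
    also have "(\<lambda>n. \<kappa> n + letter_count (map fst (As @ [x])) n - letter_count (map snd ((B1 @ [y]) @ B2)) n) = K"
      by (simp add: K_def)
    finally have 2: "wact As (wact (B1 @ [y]) (eop a b (wact B2 (vac p)))) \<in> vac_bispan sh K" .
    have 3: "smul (of_bool (b = c)) F \<in> vac_bispan sh K" if "F \<in> vac_bispan sh K" for F :: "('p, 'd) smod"
      using that by (cases "b = c") (simp_all add: vac_bispan_0)
    have "\<exists>\<alpha> i. z = (Pos \<alpha>, Proper i)" if "z \<in> set B2" for z using Cons.prems(2)[of z] that by auto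
    then have step: "wact As (wact B1 (eop a b (wact ((c, d) # B2) (vac p)))) =
        smul (of_bool (b = c)) (wact As (wact (B1 @ B2) (eop a d (vac p)))) +
        - wact As (wact (B1 @ [(c, d)]) (eop a b (wact B2 (vac p))))"
      by (rule contract_step[OF _ ab cd])
    show ?case
      unfolding K_def[symmetric] unfolding y step
      by (intro vac_bispan_add vac_bispan_uminus 3 1 2[unfolded y])
  qed
  from this[of "[]" Bs] show ?case using snoc.prems(1,3) by (simp only: x wact_append wact_simps append_Nil)
qed

section \<open>Capelli eigenvalues\<close>

lemma inj_on_nth_element: "inj_on (nth_element :: nat \<Rightarrow> 'a::{finite, linorder}) {..<CARD('a)}"
  unfolding nth_element_def
  by (rule inj_on_nth) simp_all

lemma poly_const_of_nat: "poly_const (of_nat n) = of_nat n"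
  by (induction n) (simp_all add: poly_const_add)

lemma inert_of_nat [simp]: "inert b (of_nat n)"
  using inert_const[of b "of_nat n"] by (simp only: poly_const_of_nat)

lemma inert_sign [simp]: "inert b ((- 1) ^ n :: (nat, 'd::finite) polys)"
proof -
  have "inert b (poly_const 1 :: (nat, 'd) polys)" "inert b (poly_const (- 1) :: (nat, 'd) polys)"
    by (rule inert_const)+
  moreover have "poly_const (- 1) = (- 1 :: (nat, 'd) polys)" by (simp add: poly_const_def single_uminus)
  ultimately show ?thesis by (cases "even n") simp_all
qed

section \<open>Signs from reordering words of odd factors\<close>

definition anticommuting ::
    "(('p, 'q, 'l) symbol \<times> ('p, 'q, 'l) symbol) list \<Rightarrow> (('p, 'q, 'l) symbol \<times> ('p, 'q, 'l) symbol) list \<Rightarrow> bool"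
  where "anticommuting u w \<longleftrightarrow> (\<forall>(a, b)\<in>set u. \<forall>(c, d)\<in>set w.
    is_pos a \<noteq> is_pos b \<and> is_pos c \<noteq> is_pos d \<and> b \<noteq> c \<and> a \<noteq> d)"

lemma anticommutingI:
  assumes "\<And>a b c d. (a, b) \<in> set u \<Longrightarrow> (c, d) \<in> set w \<Longrightarrow>
    is_pos a \<noteq> is_pos b \<and> is_pos c \<noteq> is_pos d \<and> b \<noteq> c \<and> a \<noteq> d"
  shows "anticommuting u w"
  using assms by (auto simp: anticommuting_def)

lemma eop_anticommute:
  assumes "is_pos a \<noteq> is_pos b" "is_pos c \<noteq> is_pos d" "b \<noteq> c" "a \<noteq> d"
  shows "eop a b (eop c d F) = smul (- 1) (eop c d (eop a b F))"
proof -
  have "super_sign (a, b) (c, d) = (- 1 :: (nat, 'd) polys)"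
    using assms(1,2) by (auto simp: super_sign_eq parity_is_pos)
  then show ?thesis using assms(3,4) by (simp add: eop_supercommute[of a b c d])
qed

lemma wact_smul_sign [simp]: "wact w (smul ((- 1) ^ n) F) = smul ((- 1) ^ n) (wact w F)"
  by (rule wact_smul) simp

lemma eop_smul_sign [simp]: "eop a b (smul ((- 1) ^ n) F) = smul ((- 1) ^ n) (eop a b F)"
  by (rule eop_smul) simp

lemma eop_wact_anticommute:
  assumes "anticommuting [(a, b)] w"
  shows "eop a b (wact w F) = smul ((- 1) ^ length w) (wact w (eop a b F))"
  using assms
proof (induction w)
  case (Cons x w)
  obtain c d where x: "x = (c, d)" by fastforce
  have "anticommuting [(a, b)] w" "is_pos a \<noteq> is_pos b" "is_pos c \<noteq> is_pos d" "b \<noteq> c" "a \<noteq> d"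
    using Cons.prems by (auto simp: anticommuting_def x)
  with Cons.IH eop_anticommute[of a b c d "wact w F"] show ?case
    by (simp add: x mult.commute)
qed simp

lemma wact_swap:
  assumes "anticommuting u w"
  shows "wact u (wact w F) = smul ((- 1) ^ (length u * length w)) (wact w (wact u F))"
  using assms
proof (induction u)
  case (Cons x u)
  obtain a b where x: "x = (a, b)" by fastforce
  have "anticommuting u w" "anticommuting [(a, b)] w"
    using Cons.prems by (auto simp: anticommuting_def x)
  with Cons.IH eop_wact_anticommute[of a b w "wact u F"] show ?case
    by (simp add: x power_add mult.commute)
qed simp

text \<open>This is n(n-1)/2, the number of transpositions of neighbours that reverse a word of
  length n.\<close>

primrec triangle :: "nat \<Rightarrow> nat" where
  "triangle 0 = 0"
| "triangle (Suc n) = triangle n + n"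

lemma wact_rev:
  assumes "anticommuting w w"
  shows "wact (rev w) F = smul ((- 1) ^ triangle (length w)) (wact w F)"
  using assms
proof (induction w arbitrary: F)
  case (Cons x w)
  obtain a b where x: "x = (a, b)" by fastforce
  have 1: "anticommuting w w" and 2: "anticommuting [(a, b)] w"
    using Cons.prems by (auto simp: anticommuting_def x)
  have "wact w (eop a b F) = smul ((- 1) ^ length w) (eop a b (wact w F))"
    by (simp add: eop_wact_anticommute[OF 2] power_add[symmetric])
  then show ?case
    by (simp add: x wact_append Cons.IH[OF 1] power_add)
qed simp

text \<open>Here v is a singular vector of weight l for the letters x 0, ..., x (k-1), and it
  contains no symbol \<alpha>. The letters may be proper or negative, which serves both halves of a
  bitableau.\<close>

locale capelli_row =
  fixes x :: "nat \<Rightarrow> ('p::finite, 'q::finite, 'l::finite) symbol" and \<alpha> :: 'p and k :: nat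
    and l :: "nat \<Rightarrow> nat" and v :: "('p, 'd::finite) smod"
  assumes nonpos: "\<And>i. \<not> is_pos (x i)"
    and inj: "inj_on x {..<k}"
    and raising: "\<And>i j. i < j \<Longrightarrow> j < k \<Longrightarrow> eop (x i) (x j) v = 0"
    and weight: "\<And>i. i < k \<Longrightarrow> eop (x i) (x i) v = smul (of_nat (l i)) v"
    and free: "\<And>a :: ('p, 'q, 'l) symbol. eop a (Pos \<alpha>) v = 0"
begin

definition lowered :: "nat \<Rightarrow> ('p, 'd) smod"
  where "lowered m = wact (map (\<lambda>j. (Pos \<alpha>, x j)) [m..<k]) v"

lemma lowered_k: "lowered k = v"
  by (simp add: lowered_def)

lemma lowered_step: "m < k \<Longrightarrow> lowered m = eop (Pos \<alpha>) (x m) (lowered (Suc m))"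
  by (simp add: lowered_def upt_conv_Cons)

lemma x_neq [simp]: "x i \<noteq> Pos \<alpha>" "Pos \<alpha> \<noteq> x i"
  using nonpos[of i] by (metis is_pos_simps(1))+

lemma x_eq: "i < k \<Longrightarrow> j < k \<Longrightarrow> x i = x j \<longleftrightarrow> i = j"
  using inj by (auto simp: inj_on_def)

lemma super_sign_x:
  "super_sign (x i, x j) (c, d) = 1" "super_sign (Pos \<alpha> :: ('p, 'q, 'l) symbol, Pos \<alpha>) (c, d) = 1"
  "super_sign (x i, Pos \<alpha>) (Pos \<alpha>, x j) = - 1"
  using nonpos by (auto simp: super_sign_eq parity_is_pos)

text \<open>Invariants for lowering one more letter x m. The number of \<alpha> grows by one;
  raisings and weights at x i with i < m persist because x i differs from x m. For
  \<open>eop (x i) (Pos \<alpha>)\<close>, passing the new factor leaves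
  \<open>eop (x i) (x m)\<close>, a raising operator, which vanishes.\<close>

lemma lowered_props:
  assumes "m \<le> k"
  shows "eop (Pos \<alpha> :: ('p, 'q, 'l) symbol) (Pos \<alpha>) (lowered m) = smul (of_nat (k - m)) (lowered m) \<and>
    (\<forall>i j. i < j \<and> j < k \<and> i < m \<longrightarrow> eop (x i) (x j) (lowered m) = 0) \<and>
    (\<forall>i. i < m \<longrightarrow> eop (x i) (x i) (lowered m) = smul (of_nat (l i)) (lowered m)) \<and>
    (\<forall>i. i < m \<longrightarrow> eop (x i) (Pos \<alpha>) (lowered m) = 0)"
  using assms
proof (induction rule: inc_induct)
  case base
  then show ?case by (simp add: lowered_k free raising weight)
next
  case (step m)
  let ?G = "lowered (Suc m)"
  have Fm: "lowered m = eop (Pos \<alpha>) (x m) ?G" using step.hyps by (simp add: lowered_step)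
  have 1: "eop (Pos \<alpha> :: ('p, 'q, 'l) symbol) (Pos \<alpha>) (lowered m) = smul (of_nat (k - m)) (lowered m)"
  proof -
    have "eop (Pos \<alpha> :: ('p, 'q, 'l) symbol) (Pos \<alpha>) (lowered m) = smul (of_nat (k - Suc m)) (lowered m) + lowered m"
      unfolding Fm using step.IH
      by (subst eop_supercommute) (simp add: super_sign_x eop_smul)
    also have "\<dots> = smul (of_nat (k - Suc m) + 1) (lowered m)" by (simp add: smul_add)
    also have "of_nat (k - Suc m) + 1 = (of_nat (k - m) :: (nat, 'd) polys)"
      using step.hyps by (metis Suc_diff_Suc of_nat_Suc add.commute)
    finally show ?thesis .
  qed
  have 2: "eop (x i) (x j) (lowered m) = 0" if "i < j" "j < k" "i < m" for i j
    unfolding Fm eop_supercommute[of "x i" "x j" "Pos \<alpha>"] using step that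
    by (simp add: super_sign_x x_eq)
  have 3: "eop (x i) (x i) (lowered m) = smul (of_nat (l i)) (lowered m)" if "i < m" for i
    unfolding Fm eop_supercommute[of "x i" "x i" "Pos \<alpha>"] using step that
    by (simp add: super_sign_x x_eq eop_smul)
  have 4: "eop (x i) (Pos \<alpha>) (lowered m) = 0" if "i < m" for i
    unfolding Fm eop_supercommute[of "x i" "Pos \<alpha>" "Pos \<alpha>"] using step that
    by (simp add: super_sign_x x_eq)
  show ?case using 1 2 3 4 by blast
qed

text \<open>The shift \<open>k - 1 - m\<close> is the number of symbols \<open>\<alpha>\<close> already present, as measured by \<open>e\<^bsub>\<alpha>,\<alpha>\<^esub>\<close>.\<close>

lemma capelli_step:
  assumes "m < k"
  shows "eop (x m) (Pos \<alpha>) (lowered m) = smul (of_nat (l m + (k - 1 - m))) (lowered (Suc m))"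
proof -
  note props = lowered_props[OF Suc_leI[OF assms]]
  have p: "eop (Pos \<alpha> :: ('p, 'q, 'l) symbol) (Pos \<alpha>) (lowered (Suc m)) = smul (of_nat (k - Suc m)) (lowered (Suc m))"
    using props by (rule conjunct1)
  have p': "eop (x m) (x m) (lowered (Suc m)) = smul (of_nat (l m)) (lowered (Suc m))" "eop (x m) (Pos \<alpha>) (lowered (Suc m)) = 0"
    using props lessI[of m] by metis+
  have "eop (x m) (Pos \<alpha>) (lowered m) = smul (of_nat (l m)) (lowered (Suc m)) + smul (of_nat (k - Suc m)) (lowered (Suc m))"
    unfolding lowered_step[OF assms] eop_supercommute[of "x m" "Pos \<alpha>" "Pos \<alpha>"]
    by (simp only: super_sign_x p p') (simp add: smul_minus)
  then show ?thesis by (simp add: smul_add)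
qed

lemma capelli_aux:
  "m \<le> k \<Longrightarrow> wact (rev (map (\<lambda>j. (x j, Pos \<alpha>)) [m..<k])) (lowered m) = smul (of_nat (\<Prod>i=m..<k. l i + (k - 1 - i))) v"
proof (induction rule: inc_induct)
  case base
  then show ?case by (simp add: lowered_k)
next
  case (step m)
  have "wact (rev (map (\<lambda>j. (x j, Pos \<alpha>)) [m..<k])) (lowered m) =
      wact (rev (map (\<lambda>j. (x j, Pos \<alpha>)) [Suc m..<k])) (eop (x m) (Pos \<alpha>) (lowered m))"
    using step.hyps by (simp add: upt_conv_Cons wact_append)
  also have "\<dots> = smul (of_nat (l m + (k - 1 - m))) (smul (of_nat (\<Prod>i=Suc m..<k. l i + (k - 1 - i))) v)"
    unfolding capelli_step[OF step.hyps(2)] by (subst wact_smul) (simp_all only: step.IH inert_of_nat)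
  also have "\<dots> = smul (of_nat (\<Prod>i=m..<k. l i + (k - 1 - i))) v"
    using step.hyps by (simp only: smul_simps of_nat_mult[symmetric] prod.atLeast_Suc_lessThan)
  finally show ?case .
qed

text \<open>In \<open>capelli_aux\<close> the raisings undo the lowerings from the outermost inwards
  and telescope. The tableau prescribes the opposite order, and reversing k anticommuting factors
  costs the sign.\<close>

lemma capelli:
  "wact (map (\<lambda>j. (x j, Pos \<alpha>)) [0..<k]) (wact (map (\<lambda>j. (Pos \<alpha>, x j)) [0..<k]) v) =
    smul ((- 1) ^ triangle k * of_nat (\<Prod>i<k. l i + (k - 1 - i))) v"
proof -
  let ?w = "map (\<lambda>j. (x j, Pos \<alpha>)) [0..<k]"
  have "anticommuting ?w ?w" using nonpos by (auto simp: anticommuting_def)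
  then have "smul ((- 1) ^ triangle k) (wact (rev ?w) (lowered 0)) =
      smul ((- 1) ^ triangle k) (smul ((- 1) ^ triangle k) (wact ?w (lowered 0)))"
    by (simp only: wact_rev length_map length_upt diff_zero)
  then have "wact ?w (lowered 0) = smul ((- 1) ^ triangle k) (wact (rev ?w) (lowered 0))"
    by (simp add: power_add[symmetric])
  also have "\<dots> = smul ((- 1) ^ triangle k * of_nat (\<Prod>i<k. l i + (k - 1 - i))) v"
    using capelli_aux[of 0] by (simp only: le0 smul_simps atLeast0LessThan)
  finally show ?thesis by (simp only: lowered_def)
qed

end

section \<open>Odd monomials and the minors they produce\<close>

definition fstate :: "'p::finite \<Rightarrow> 'd::finite list \<Rightarrow> ('p, 'd) smod"
  where "fstate p ts = foldr (\<lambda>t. fcre (p, t)) ts (vac 1)"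

lemma fstate_simps [simp]: "fstate p [] = vac 1" "fstate p (t # ts) = fcre (p, t) (fstate p ts)"
  by (simp_all add: fstate_def)

lemma fsign_cases: "fsign y A = (1 :: 'r::comm_ring_1) \<or> fsign y A = (- 1 :: 'r)"
  unfolding fsign_def using neg_one_even_power neg_one_odd_power by blast

text \<open>The sign s comes from sorting the columns into the order of \<open>to_nat\<close>. It
  can stay unspecified: being its own inverse, it is absorbed into a scalar in
  \<open>row_action\<close>.\<close>

lemma fstate_distinct:
  "distinct ts \<Longrightarrow> \<exists>s. (s = 1 \<or> s = - 1) \<and> fstate p ts = (\<lambda>A. if A = {p} \<times> set ts then s else 0)"
proof (induction ts)
  case Nil
  then show ?case by (intro exI[of _ 1]) (simp add: vac_def fun_eq_iff)
next
  case (Cons t ts)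
  then obtain s where s: "s = 1 \<or> s = - 1" "fstate p ts = (\<lambda>A. if A = {p} \<times> set ts then s else 0)"
    by auto
  let ?B = "{p} \<times> set (t # ts)"
  have B: "A - {(p, t)} = {p} \<times> set ts \<longleftrightarrow> A = ?B" if "(p, t) \<in> A" for A
    using that Cons.prems by auto
  have "fstate p (t # ts) = (\<lambda>A. if A = ?B then fsign (p, t) ?B * s else 0)"
  proof
    fix A
    show "fstate p (t # ts) A = (if A = ?B then fsign (p, t) ?B * s else 0)"
      by (cases "(p, t) \<in> A") (auto simp: fcre_def s(2) B)
  qed
  moreover have "fsign (p, t) ?B * s = 1 \<or> fsign (p, t) ?B * s = - 1"
    using fsign_cases[of "(p, t)" ?B] s(1) by auto
  ultimately show ?case by blast
qed

lemma fcre_smul: "fcre y (smul h G) = smul h (fcre y G)"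
  by (auto simp: fcre_def smul_def fun_eq_iff)

lemma fcre_sum: "fcre y (\<Sum>i\<in>I. f i) = (\<Sum>i\<in>I. fcre y (f i))"
  by (auto simp: fcre_def fun_eq_iff sum_fun_apply sum_distrib_left)

definition remove_nth :: "nat \<Rightarrow> 'a list \<Rightarrow> 'a list"
  where "remove_nth j xs = take j xs @ drop (Suc j) xs"

lemma remove_nth_simps: "remove_nth 0 (x # xs) = xs" "remove_nth (Suc j) (x # xs) = x # remove_nth j xs"
  by (simp_all add: remove_nth_def)

lemma nth_remove_nth:
  "i < length xs - 1 \<Longrightarrow> remove_nth j xs ! i = xs ! (if i < j then i else Suc i)" if "j < length xs"
  using that by (auto simp: remove_nth_def nth_append min_def)

text \<open>The Leibniz rule of an odd derivation: to reach the factor at position j it passes j odd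
  variables.\<close>

lemma eop_fstate:
  assumes "\<not> is_pos y"
  shows "eop y (Pos p) (fstate p ts) =
    (\<Sum>j<length ts. smul ((- 1) ^ j * poly_var (code y) (ts ! j)) (fstate p (remove_nth j ts)))"
proof (induction ts)
  case Nil
  then show ?case by simp
next
  case (Cons t ts)
  let ?G = "fstate p ts"
  have "eop y (Pos p) (fcre (p, t) ?G) =
      (\<Sum>s\<in>UNIV. (if s = t then smul (poly_var (code y) t) ?G else 0) - fcre (p, t) (smul (poly_var (code y) s) (fann (p, s) ?G)))"
    unfolding eop_def
    by (intro sum.cong refl) (simp add: cre_nonpos[OF assms] ann_def fann_fcre smul_diff fcre_smul)
  also have "\<dots> = smul (poly_var (code y) t) ?G - fcre (p, t) (eop y (Pos p) ?G)"
    by (simp add: sum_subtractf eop_def fcre_sum cre_nonpos[OF assms] ann_def)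
  also have "\<dots> = smul (poly_var (code y) t) ?G +
      (\<Sum>j<length ts. smul ((- 1) ^ Suc j * poly_var (code y) (ts ! j)) (fstate p (t # remove_nth j ts)))"
    by (simp add: Cons.IH fcre_sum fcre_smul smul_minus sum_negf)
  also have "\<dots> = (\<Sum>j<length (t # ts). smul ((- 1) ^ j * poly_var (code y) ((t # ts) ! j)) (fstate p (remove_nth j (t # ts))))"
    by (simp only: length_Cons sum.lessThan_Suc_shift) (simp add: remove_nth_simps)
  finally show ?case by simp
qed

lemma wact_sum: "wact w (\<Sum>i\<in>I. f i) = (\<Sum>i\<in>I. wact w (f i))"
  by (induction I rule: infinite_finite_induct)
    (simp_all only: sum.infinite sum.empty sum.insert wact_0 wact_add not_False_eq_True)

text \<open>The last letter acts first, and its action by \<open>eop_fstate\<close> is the Laplace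
  expansion of the determinant along the last row. The sign there is (-1)^j while the cofactor has
  (-1)^(k+j), with k the number of earlier letters; the discrepancies (-1)^k accumulate to
  \<open>triangle\<close>.\<close>

lemma wact_fstate:
  fixes ts :: "'d::finite list" and ys :: "('p::finite, 'q::finite, 'l::finite) symbol list"
  assumes "\<And>y. y \<in> set ys \<Longrightarrow> \<not> is_pos y" "length ts = length ys"
  shows "wact (map (\<lambda>y. (y, Pos p)) ys) (fstate p ts) = vac ((- 1) ^ triangle (length ys) *
    det (mat (length ys) (length ys) (\<lambda>(i, j). poly_var (code (ys ! i)) (ts ! j))))"
  using assms
proof (induction ys arbitrary: ts rule: rev_induct)
  case Nil
  then show ?case by simp
next
  case (snoc y ys)
  let ?k = "length ys"
  let ?A = "mat (Suc ?k) (Suc ?k) (\<lambda>(i, j). poly_var (code ((ys @ [y]) ! i)) (ts ! j))"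
  let ?D = "\<lambda>j. det (mat ?k ?k (\<lambda>(i, l). poly_var (code (ys ! i)) (remove_nth j ts ! l)))"
  have len: "length ts = Suc ?k" using snoc.prems by simp
  have y: "\<not> is_pos y" using snoc.prems by simp
  have "wact (map (\<lambda>y. (y, Pos p)) (ys @ [y])) (fstate p ts) =
      (\<Sum>j<Suc ?k. smul ((- 1) ^ j * poly_var (code y) (ts ! j)) (wact (map (\<lambda>y. (y, Pos p)) ys) (fstate p (remove_nth j ts))))"
    by (simp add: wact_append eop_fstate[OF y] wact_sum len del: sum.lessThan_Suc)
      (intro sum.cong refl wact_smul, auto simp: inert_def)
  also have "\<dots> = (\<Sum>j<Suc ?k. vac ((- 1) ^ triangle (length (ys @ [y])) * (?A $$ (?k, j) * cofactor ?A ?k j)))"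
  proof (intro sum.cong refl)
    fix j assume "j \<in> {..<Suc ?k}"
    then have j: "j < Suc ?k" by simp
    have "wact (map (\<lambda>y. (y, Pos p)) ys) (fstate p (remove_nth j ts)) = vac ((- 1) ^ triangle ?k * ?D j)"
      using snoc.prems len j by (intro snoc.IH) (auto simp: remove_nth_def)
    moreover have "mat_delete ?A ?k j = mat ?k ?k (\<lambda>(i, l). poly_var (code (ys ! i)) (remove_nth j ts ! l))"
      using j len by (auto simp: mat_delete_def nth_remove_nth nth_append intro!: cong_mat)
    then have "?A $$ (?k, j) * cofactor ?A ?k j = poly_var (code y) (ts ! j) * ((- 1) ^ (?k + j) * ?D j)"
      using j by (simp add: cofactor_def)
    moreover have "(- 1) ^ j * a * ((- 1) ^ triangle ?k * b) =
        (- 1) ^ triangle (length (ys @ [y])) * (a * ((- 1) ^ (?k + j) * b))" for a b :: "(nat, 'd) polys"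
    proof -
      have "(- 1) ^ triangle (length (ys @ [y])) * (- 1) ^ (?k + j) = ((- 1) ^ j * (- 1) ^ triangle ?k :: (nat, 'd) polys)"
        by (auto simp: minus_one_power_iff)
      then show ?thesis by (metis (no_types, lifting) mult.assoc mult.commute)
    qed
    ultimately show "smul ((- 1) ^ j * poly_var (code y) (ts ! j)) (wact (map (\<lambda>y. (y, Pos p)) ys) (fstate p (remove_nth j ts))) =
        vac ((- 1) ^ triangle (length (ys @ [y])) * (?A $$ (?k, j) * cofactor ?A ?k j))"
      by (simp only: vac_smul)
  qed
  also have "\<dots> = vac ((- 1) ^ triangle (length (ys @ [y])) * (\<Sum>j<Suc ?k. ?A $$ (?k, j) * cofactor ?A ?k j))"
    by (simp only: vac_sum sum_distrib_left)
  also have "(\<Sum>j<Suc ?k. ?A $$ (?k, j) * cofactor ?A ?k j) = det ?A"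
    by (rule laplace_expansion_row[symmetric]) auto
  finally show ?case by simp
qed

text \<open>The invariant behind \<open>row_action\<close>. Polarizing a letter into p turns an even
  variable into an odd one in the same column, so no column outside J ever appears, and the odd
  degree j goes up by one.\<close>

definition column_supported :: "'p::finite \<Rightarrow> 'd::finite set \<Rightarrow> nat \<Rightarrow> ('p, 'd) smod \<Rightarrow> bool"
  where "column_supported p J j G \<longleftrightarrow> (\<forall>A. G A \<noteq> 0 \<longrightarrow> A \<subseteq> {p} \<times> J \<and> card A = j) \<and>
    (\<forall>A n t. t \<notin> J \<longrightarrow> pdiff n t (G A) = 0)"

lemma column_supportedD:
  assumes "column_supported p J j G"
  shows "G A \<noteq> 0 \<Longrightarrow> A \<subseteq> {p} \<times> J" "G A \<noteq> 0 \<Longrightarrow> card A = j" "t \<notin> J \<Longrightarrow> pdiff n t (G A) = 0"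
  using assms unfolding column_supported_def by simp_all

lemma column_supported_eop:
  assumes "column_supported p J j G" "\<not> is_pos a"
  shows "column_supported p J (Suc j) (eop (Pos p) a G)"
proof -
  have e: "eop (Pos p) a G A = (\<Sum>t\<in>UNIV. if (p, t) \<in> A then fsign (p, t) A * pdiff (code a) t (G (A - {(p, t)})) else 0)" for A
    by (simp add: eop_def sum_fun_apply cre_def ann_nonpos[OF assms(2)] fcre_def)
  have 1: "A \<subseteq> {p} \<times> J \<and> card A = Suc j" if nz: "eop (Pos p) a G A \<noteq> 0" for A
  proof -
    obtain t where t0: "(if (p, t) \<in> A then fsign (p, t) A * pdiff (code a) t (G (A - {(p, t)})) else 0) \<noteq> 0"
      by (rule sum.not_neutral_contains_not_neutral[OF nz[unfolded e]])
    then have t: "(p, t) \<in> A"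
      by (rule contrapos_np) simp
    have t2: "pdiff (code a) t (G (A - {(p, t)})) \<noteq> 0"
    proof
      assume "pdiff (code a) t (G (A - {(p, t)})) = 0"
      with t0 t show False by simp
    qed
    have "t \<in> J"
    proof (rule ccontr)
      assume "t \<notin> J"
      with t2 column_supportedD(3)[OF assms(1)] show False by simp
    qed
    have nz': "G (A - {(p, t)}) \<noteq> 0"
    proof
      assume "G (A - {(p, t)}) = 0"
      with t2 show False by simp
    qed
    have "A - {(p, t)} \<subseteq> {p} \<times> J" "card (A - {(p, t)}) = j"
      using column_supportedD(1,2)[OF assms(1) nz'] .
    moreover have "card A = Suc (card (A - {(p, t)}))" using card_Suc_Diff1[OF finite t] by (rule sym)
    ultimately have "card A = Suc j" by simp
    moreover have "A \<subseteq> {p} \<times> J"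
      using \<open>A - {(p, t)} \<subseteq> {p} \<times> J\<close> \<open>t \<in> J\<close> by blast
    ultimately show ?thesis by (rule conjI[rotated])
  qed
  have 2: "pdiff n t (eop (Pos p) a G A) = 0" if "t \<notin> J" for A n t
    unfolding e pdiff_sum
  proof (intro sum.neutral ballI)
    fix s
    have "pdiff n t (pdiff (code a) s (G (A - {(p, s)}))) = 0"
      unfolding pdiff_commute[of n t] column_supportedD(3)[OF assms(1) that] by (rule pdiff_0)
    then show "pdiff n t (if (p, s) \<in> A then fsign (p, s) A * pdiff (code a) s (G (A - {(p, s)})) else 0) = 0"
      by (cases "(p, s) \<in> A") (simp_all only: if_True if_False fsign_commute_pdiff mult_zero_right pdiff_0)
  qed
  show ?thesis unfolding column_supported_def
  proof (intro conjI allI impI)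
    fix A assume "eop (Pos p) a G A \<noteq> 0"
    from 1[OF this] show "A \<subseteq> {p} \<times> J" "card A = Suc j" by simp_all
  qed (rule 2)
qed

lemma column_supported_wact:
  assumes "column_supported p J j G" "\<And>a. a \<in> set as \<Longrightarrow> \<not> is_pos a"
  shows "column_supported p J (length as + j) (wact (map (\<lambda>a. (Pos p, a)) as) G)"
  using assms(2) by (induction as) (simp_all add: assms(1) column_supported_eop)

text \<open>A state with \<open>k\<close> odd variables \<open>(p|t)\<close>, where \<open>t\<close> ranges over \<open>k\<close> columns only, contains all of them.
  Hence \<open>h\<close> does not depend on \<open>ys\<close>.\<close>

lemma row_action:
  fixes f :: "(nat, 'd::{finite, linorder}) polys" and as :: "('p::finite, 'q::finite, 'l::finite) symbol list"
  assumes "\<And>n t. t \<notin> nth_element ` {..<length as} \<Longrightarrow> pdiff n t f = 0"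
    and "\<And>a. a \<in> set as \<Longrightarrow> \<not> is_pos a" and "length as \<le> CARD('d)"
  shows "\<exists>h. \<forall>ys :: ('p, 'q, 'l) symbol list. (\<forall>y\<in>set ys. \<not> is_pos y) \<longrightarrow> length ys = length as \<longrightarrow>
    wact (map (\<lambda>y. (y, Pos p)) ys) (wact (map (\<lambda>a. (Pos p, a)) as) (vac f)) =
      vac (bideterminant (map code ys) * h)"
proof -
  define k where "k = length as"
  define ts :: "'d list" where "ts = map nth_element [0..<k]"
  have "{0..<k} \<subseteq> {..<CARD('d)}" using assms(3) by (auto simp: k_def)
  then have dist: "distinct ts"
    using inj_on_subset[OF inj_on_nth_element] by (auto simp: ts_def distinct_map)
  have set_ts: "set ts = nth_element ` {..<k}" and len: "length ts = k"
    by (auto simp: ts_def)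
  define \<Psi> where "\<Psi> = wact (map (\<lambda>a. (Pos p, a)) as) (vac f)"
  have "column_supported p (set ts) 0 (vac f)"
    using assms(1) by (auto simp: column_supported_def vac_def set_ts k_def)
  then have supp: "column_supported p (set ts) k \<Psi>"
    using column_supported_wact[of p "set ts" 0 "vac f" as] assms(2) by (simp add: \<Psi>_def k_def)
  define h where "h = \<Psi> ({p} \<times> set ts)"
  have \<Psi>: "\<Psi> = (\<lambda>A. if A = {p} \<times> set ts then h else 0)"
  proof
    fix A
    show "\<Psi> A = (if A = {p} \<times> set ts then h else 0)"
    proof (cases "A = {p} \<times> set ts")
      case False
      have "\<Psi> A = 0"
      proof (rule ccontr)
        assume "\<Psi> A \<noteq> 0"
        then have "A \<subseteq> {p} \<times> set ts" "card A = k"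
          using column_supportedD(1,2)[OF supp] by simp_all
        moreover have "card ({p} \<times> set ts) = k" using dist len by (simp add: card_cartesian_product_singleton distinct_card)
        ultimately show False using False card_subset_eq[of "{p} \<times> set ts" A] by simp
      qed
      then show ?thesis using False by simp
    qed (simp add: h_def)
  qed
  obtain s where s: "s = 1 \<or> s = - 1" "fstate p ts = (\<lambda>A. if A = {p} \<times> set ts then s else 0)"
    using fstate_distinct[OF dist] by blast
  have \<Psi>': "\<Psi> = smul (h * s) (fstate p ts)"
    using s(1) unfolding \<Psi> s(2) by (auto simp: smul_def)
  have "wact (map (\<lambda>y. (y, Pos p)) ys) \<Psi> = vac (bideterminant (map code ys) * (h * s * (- 1) ^ triangle k))"
    if ys: "\<forall>y\<in>set ys. \<not> is_pos y" "length ys = k" for ys :: "('p, 'q, 'l) symbol list"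
  proof -
    have "wact (map (\<lambda>y. (y, Pos p)) ys) \<Psi> = smul (h * s) (wact (map (\<lambda>y. (y, Pos p)) ys) (fstate p ts))"
      unfolding \<Psi>' by (rule wact_smul) (auto simp: inert_def)
    also have "wact (map (\<lambda>y. (y, Pos p)) ys) (fstate p ts) = vac ((- 1) ^ triangle k *
        det (mat k k (\<lambda>(i, j). poly_var (code (ys ! i)) (ts ! j))))"
      using wact_fstate[of ys ts p] ys len by simp
    also have "mat k k (\<lambda>(i, j). poly_var (code (ys ! i)) (ts ! j)) =
        mat k k (\<lambda>(i, j). poly_var (map code ys ! i) (nth_element j))"
      using ys(2) by (intro cong_mat) (auto simp: ts_def)
    also have "det \<dots> = bideterminant (map code ys)"
      using ys(2) by (simp add: bideterminant_def)
    finally show ?thesis by (simp add: vac_smul mult_ac)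
  qed
  then show ?thesis
    unfolding \<Psi>_def k_def by (intro exI[of _ "h * s * (- 1) ^ triangle (length as)"]) (simp add: k_def)
qed

section \<open>Minors and canonical tableaux as singular vectors\<close>

lemma prod_poly_var:
  "finite I \<Longrightarrow> (\<Prod>i\<in>I. poly_var (f i) (g i)) = Poly_Mapping.single (\<Sum>i\<in>I. Poly_Mapping.single (f i, g i) 1) 1"
  by (induction I rule: finite_induct) (simp_all add: poly_var_def mult_single)

text \<open>The letters are distinct and so are the columns, hence the diagonal monomial
  \<open>M id\<close> arises from the identity permutation alone and has coefficient 1.\<close>

lemma bideterminant_nonzero:
  fixes r :: "nat list"
  assumes "distinct r" "length r \<le> CARD('d)"
  shows "bideterminant r \<noteq> (0 :: (nat, 'd::{finite, linorder}) polys)"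
proof -
  let ?k = "length r"
  define M where "M p = (\<Sum>i = 0..<?k. Poly_Mapping.single (r ! i, nth_element (p i) :: 'd) (1 :: nat))" for p
  have look: "Poly_Mapping.lookup (M p) (r ! i, t) = of_bool (nth_element (p i) = t)" if "i < ?k" for p i t
  proof -
    have "Poly_Mapping.lookup (M p) (r ! i, t) = (\<Sum>j = 0..<?k. if j = i then of_bool (nth_element (p i) = t) else 0)"
      unfolding M_def lookup_sum
      by (intro sum.cong refl) (use assms(1) that in \<open>auto simp: lookup_single when_def nth_eq_iff_index_eq\<close>)
    then show ?thesis using that by simp
  qed
  have M: "M p = M id \<longleftrightarrow> p = id" if p: "p permutes {0..<?k}" for p
  proof
    assume eq: "M p = M id"
    show "p = id"
    proof
      fix i
      show "p i = id i"
      proof (cases "i < ?k")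
        case True
        then have "p i < ?k" using p by (simp add: permutes_in_image[OF p, of i, simplified])
        moreover have "(nth_element (p i) :: 'd) = nth_element i"
        proof -
          have "of_bool ((nth_element (p i) :: 'd) = nth_element i) = (1 :: nat)"
            unfolding look[OF True, of p, symmetric] eq look[OF True] by simp
          then show ?thesis by (simp only: of_bool_eq_1_iff)
        qed
        ultimately show ?thesis
          using inj_on_nth_element[where 'a='d] True assms(2) by (auto simp: inj_on_def)
      next
        case False
        then show ?thesis using p by (auto simp: permutes_def)
      qed
    qed
  qed simp
  have "Poly_Mapping.lookup (bideterminant r :: (nat, 'd) polys) (M id) =
      (\<Sum>p | p permutes {0..<?k}. if p = id then 1 else 0)"
    unfolding bideterminant_eq lookup_sum
  proof (intro sum.cong refl)
    fix p assume "p \<in> {p. p permutes {0..<?k}}"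
    then have p: "p permutes {0..<?k}" by simp
    have "(\<Prod>i = 0..<?k. poly_var (r ! i) (nth_element (p i))) = (Poly_Mapping.single (M p) 1 :: (nat, 'd) polys)"
      by (simp add: prod_poly_var M_def)
    then show "Poly_Mapping.lookup (signof p * (\<Prod>i = 0..<?k. poly_var (r ! i) (nth_element (p i)))) (M id) =
        (if p = id then 1 else 0 :: complex)"
      using M[OF p] by (auto simp: sign_def lookup_single when_def)
  qed
  also have "\<dots> = 1" by (simp add: finite_permutations permutes_id)
  finally have one: "Poly_Mapping.lookup (bideterminant r :: (nat, 'd) polys) (M id) = 1" .
  show ?thesis
  proof
    assume "bideterminant r = (0 :: (nat, 'd) polys)"
    with one show False by simp
  qed
qed

text \<open>One form for \<open>D_star\<close>, for the tableau of the highest weight vector and for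
  the only S that contributes, so that proper and negative letters are treated alike.\<close>

definition canonical_tableau :: "(nat \<Rightarrow> 'a) \<Rightarrow> nat list \<Rightarrow> 'a list list"
  where "canonical_tableau x \<nu> = map (\<lambda>k. map x [0..<k]) \<nu>"

text \<open>For a partition \<nu>, the part of its conjugate with index i, continued by
  zeros.\<close>

definition column_length :: "nat list \<Rightarrow> nat \<Rightarrow> nat"
  where "column_length \<nu> i = length (filter (\<lambda>k. i < k) \<nu>)"

lemma canonical_tableau_simps [simp]:
  "canonical_tableau x [] = []" "canonical_tableau x (k # \<nu>) = map x [0..<k] # canonical_tableau x \<nu>"
  by (simp_all add: canonical_tableau_def)

text \<open>For i < j a row that contains x j already contains x i, so replacing x j by x i repeats
  a letter and the minor vanishes. For i = j the row is reproduced.\<close>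

lemma polarization_canonical_row:
  assumes "inj_on x {..<K}" "k \<le> K" "i \<le> j" "j < K"
  shows "polarization (x i) (x j) (bideterminant (map x [0..<k]) :: (nat, 'd::{finite, linorder}) polys) =
    of_bool (i = j \<and> i < k) * bideterminant (map x [0..<k])"
proof -
  have "of_bool (map x [0..<k] ! s = x j) * (bideterminant ((map x [0..<k])[s := x i]) :: (nat, 'd) polys) =
      (if s = j then of_bool (i = j) * bideterminant (map x [0..<k]) else 0)" if "s < k" for s
  proof (cases "s = j")
    case True
    show ?thesis
    proof (cases "i = j")
      case True
      have "(map x [0..<k])[j := x j] = map x [0..<k]"
        using that \<open>s = j\<close> by (simp add: list_update_same_conv)
      then show ?thesis using \<open>s = j\<close> True that by simp
    next
      case False
      then have "i < j" using assms(3) by simp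
      then have "(map x [0..<k])[s := x i] ! i = (map x [0..<k])[s := x i] ! j"
        using that True by simp
      then have "\<not> distinct ((map x [0..<k])[s := x i])"
        using that True \<open>i < j\<close> nth_eq_iff_index_eq[of "(map x [0..<k])[s := x i]" i j] by auto
      then show ?thesis using False True by (simp add: bideterminant_not_distinct)
    qed
  next
    case False
    then have "x s \<noteq> x j" using assms that by (auto simp: inj_on_def)
    then show ?thesis using False that by simp
  qed
  then have "polarization (x i) (x j) (bideterminant (map x [0..<k]) :: (nat, 'd) polys) =
      (\<Sum>s<k. if s = j then of_bool (i = j) * bideterminant (map x [0..<k]) else 0)"
    unfolding polarization_bideterminant by (intro sum.cong) (simp_all only: length_map length_upt diff_zero lessThan_iff)
  also have "\<dots> = of_bool (i = j \<and> i < k) * bideterminant (map x [0..<k])" by auto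
  finally show ?thesis .
qed

lemma polarization_canonical_tableau:
  assumes "inj_on x {..<K}" "\<And>k. k \<in> set \<nu> \<Longrightarrow> k \<le> K" "i \<le> j" "j < K"
  shows "polarization (x i) (x j) (tableau_product (canonical_tableau x \<nu>) :: (nat, 'd::{finite, linorder}) polys) =
    of_nat (if i = j then column_length \<nu> i else 0) * tableau_product (canonical_tableau x \<nu>)"
  using assms(2)
proof (induction \<nu>)
  case Nil
  then show ?case by (simp add: column_length_def)
next
  case (Cons k \<nu>)
  have "polarization (x i) (x j) (bideterminant (map x [0..<k]) :: (nat, 'd) polys) =
    of_bool (i = j \<and> i < k) * bideterminant (map x [0..<k])"
    using Cons.prems by (intro polarization_canonical_row[OF assms(1) _ assms(3,4)]) auto
  then show ?case using Cons
    by (simp add: polarization_mult column_length_def algebra_simps)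
qed

lemma pdiff_tableau_product_0:
  "(\<And>r. r \<in> set X \<Longrightarrow> a \<notin> set r \<or> t \<notin> nth_element ` {..<length r}) \<Longrightarrow> pdiff a t (tableau_product X) = 0"
  using pdiff_const[of a t 1]
  by (induction X) (simp_all add: pdiff_mult pdiff_bideterminant_0)

section \<open>The words of a whole tableau, row by row\<close>

fun alpha_rows :: "'p list \<Rightarrow> nat list \<Rightarrow> ('p, 'q, 'l) symbol list list" where
  "alpha_rows (a # as) (k # \<nu>) = replicate k (Pos a) # alpha_rows as \<nu>"
| "alpha_rows _ _ = []"

text \<open>Each row contributes \<open>triangle k\<close> from \<open>capelli\<close>, and
  \<open>k * sum_list \<nu>\<close> from moving a word of length k past one for the rows
  below.\<close>

fun row_sign :: "nat list \<Rightarrow> nat" where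
  "row_sign [] = 0"
| "row_sign (k # \<nu>) = triangle k + k * sum_list \<nu> + row_sign \<nu>"

text \<open>For cell i of the first row, \<open>column_length (k # \<nu>) i\<close> is the leg plus
  one and \<open>k - 1 - i\<close> the arm, so each factor is a hook length. In this form it is also
  the factor in the eigenvalue of \<open>capelli\<close>.\<close>

fun hooks :: "nat list \<Rightarrow> nat" where
  "hooks [] = 1"
| "hooks (k # \<nu>) = (\<Prod>i<k. column_length (k # \<nu>) i + (k - 1 - i)) * hooks \<nu>"

lemma set_alpha_rows: "a \<in> set (concat (alpha_rows as \<nu>)) \<Longrightarrow> \<exists>b\<in>set as. a = Pos b"
  by (induction as \<nu> rule: alpha_rows.induct) (auto split: if_splits)

lemma length_concat_alpha_rows: "length as = length \<nu> \<Longrightarrow> length (concat (alpha_rows as \<nu>)) = sum_list \<nu>"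
  by (induction as \<nu> rule: alpha_rows.induct) auto

lemma length_concat_canonical_tableau: "length (concat (canonical_tableau x \<nu>)) = sum_list \<nu>"
  by (induction \<nu>) auto

lemma set_concat_canonical_tableau:
  "a \<in> set (concat (canonical_tableau x \<nu>)) \<Longrightarrow> (\<And>k. k \<in> set \<nu> \<Longrightarrow> k \<le> K) \<Longrightarrow> \<exists>i<K. a = x i"
proof (induction \<nu>)
  case (Cons k \<nu>)
  then consider i where "i < k" "a = x i" | "a \<in> set (concat (canonical_tableau x \<nu>))" by auto
  then show ?case
  proof cases
    case 1
    then show ?thesis using Cons.prems(2)[of k] by (auto intro: less_le_trans)
  next
    case 2
    then show ?thesis using Cons.IH Cons.prems(2) by simp
  qed
qed simp

definition lower_word ::
    "(nat \<Rightarrow> ('p, 'q, 'l) symbol) \<Rightarrow> 'p list \<Rightarrow> nat list \<Rightarrow> (('p, 'q, 'l) symbol \<times> ('p, 'q, 'l) symbol) list"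
  where "lower_word x as \<nu> = zip (concat (alpha_rows as \<nu>)) (concat (canonical_tableau x \<nu>))"

definition raise_word ::
    "(nat \<Rightarrow> ('p, 'q, 'l) symbol) \<Rightarrow> 'p list \<Rightarrow> nat list \<Rightarrow> (('p, 'q, 'l) symbol \<times> ('p, 'q, 'l) symbol) list"
  where "raise_word y as \<nu> = zip (concat (canonical_tableau y \<nu>)) (concat (alpha_rows as \<nu>))"

lemma word_Cons:
  "lower_word x (a # as) (k # \<nu>) = map (\<lambda>b. (Pos a, b)) (map x [0..<k]) @ lower_word x as \<nu>"
  "raise_word y (a # as) (k # \<nu>) = map (\<lambda>b. (b, Pos a)) (map y [0..<k]) @ raise_word y as \<nu>"
  by (simp_all add: lower_word_def raise_word_def zip_append zip_replicate1 zip_replicate2)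

lemma length_words:
  "length as = length \<nu> \<Longrightarrow> length (lower_word x as \<nu>) = sum_list \<nu>"
  "length as = length \<nu> \<Longrightarrow> length (raise_word x as \<nu>) = sum_list \<nu>"
  by (simp_all add: lower_word_def raise_word_def length_concat_alpha_rows length_concat_canonical_tableau del: length_concat)

lemma in_lower_word:
  assumes "(a, b) \<in> set (lower_word x as \<nu>)" "\<And>k. k \<in> set \<nu> \<Longrightarrow> k \<le> K"
  shows "\<exists>p\<in>set as. \<exists>i<K. a = Pos p \<and> b = x i"
  using set_alpha_rows[OF set_zip_leftD[OF assms(1)[unfolded lower_word_def]]]
    set_concat_canonical_tableau[OF set_zip_rightD[OF assms(1)[unfolded lower_word_def]] assms(2)] by blast

lemma in_raise_word:
  assumes "(a, b) \<in> set (raise_word x as \<nu>)" "\<And>k. k \<in> set \<nu> \<Longrightarrow> k \<le> K"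
  shows "\<exists>p\<in>set as. \<exists>i<K. a = x i \<and> b = Pos p"
  using set_alpha_rows[OF set_zip_rightD[OF assms(1)[unfolded raise_word_def]]]
    set_concat_canonical_tableau[OF set_zip_leftD[OF assms(1)[unfolded raise_word_def]] assms(2)] by blast

text \<open>The unknown factor \<open>h\<close> of \<open>row_action\<close> is found by taking \<open>y = x\<close>, where the Capelli eigenvalue is
  available, and cancelling the bideterminant.\<close>

lemma row_exchange:
  fixes x y :: "nat \<Rightarrow> ('p::finite, 'q::finite, 'l::finite) symbol"
  assumes np: "\<And>i. \<not> is_pos (x i)" "\<And>i. \<not> is_pos (y i)"
    and inj: "inj_on x {..<k}" and k: "k \<le> CARD('d::{finite, linorder})" and le: "\<And>m. m \<in> set \<nu> \<Longrightarrow> m \<le> k"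
  defines "T \<equiv> (tableau_product (canonical_tableau (code \<circ> x) \<nu>) :: (nat, 'd) polys)"
  shows "wact (map (\<lambda>b. (b, Pos a)) (map y [0..<k])) (wact (map (\<lambda>b. (Pos a, b)) (map x [0..<k]))
      (vac (bideterminant (map (code \<circ> x) [0..<k]) * T))) =
    smul ((- 1) ^ triangle k * of_nat (\<Prod>i<k. column_length (k # \<nu>) i + (k - 1 - i)))
      (vac (bideterminant (map (code \<circ> y) [0..<k]) * T))"
proof -
  let ?f = "bideterminant (map (code \<circ> x) [0..<k]) * T"
  let ?c = "(- 1) ^ triangle k * of_nat (\<Prod>i<k. column_length (k # \<nu>) i + (k - 1 - i)) :: (nat, 'd) polys"
  have f: "?f = tableau_product (canonical_tableau (code \<circ> x) (k # \<nu>))"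
    by (simp add: T_def)
  have inj': "inj_on (code \<circ> x) {..<k}"
    using inj np(1) by (auto simp: inj_on_def code_eq_iff)
  \<comment> \<open>Here the row must be a longest one: no row of \<nu> reaches a column beyond the
    first k.\<close>
  have "pdiff n t ?f = 0" if t: "t \<notin> nth_element ` {..<length (map x [0..<k])}" for n t
    unfolding f
  proof (rule pdiff_tableau_product_0, rule disjI2)
    fix r assume "r \<in> set (canonical_tableau (code \<circ> x) (k # \<nu>))"
    then have "length r \<le> k" using le by (auto simp: canonical_tableau_def)
    then show "t \<notin> nth_element ` {..<length r}" using t by auto
  qed
  note pd = this
  have "\<exists>h. \<forall>ys :: ('p, 'q, 'l) symbol list. (\<forall>y\<in>set ys. \<not> is_pos y) \<longrightarrow> length ys = length (map x [0..<k]) \<longrightarrow>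
      wact (map (\<lambda>y. (y, Pos a)) ys) (wact (map (\<lambda>a'. (Pos a, a')) (map x [0..<k])) (vac ?f)) =
      vac (bideterminant (map code ys) * h)"
  proof (rule row_action)
    show "\<not> is_pos b" if "b \<in> set (map x [0..<k])" for b using that np(1) by auto
  qed (use pd k in auto)
  then obtain h where h: "\<And>ys :: ('p, 'q, 'l) symbol list. \<forall>y\<in>set ys. \<not> is_pos y \<Longrightarrow> length ys = length (map x [0..<k]) \<Longrightarrow>
      wact (map (\<lambda>y. (y, Pos a)) ys) (wact (map (\<lambda>a'. (Pos a, a')) (map x [0..<k])) (vac ?f)) =
      vac (bideterminant (map code ys) * h)" by blast
  have row: "wact (map (\<lambda>y. (y, Pos a)) (map z [0..<k])) (wact (map (\<lambda>a'. (Pos a, a')) (map x [0..<k])) (vac ?f)) =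
      vac (bideterminant (map (code \<circ> z) [0..<k]) * h)"
    if "\<And>i. \<not> is_pos (z i)" for z :: "nat \<Rightarrow> ('p, 'q, 'l) symbol"
    using h[of "map z [0..<k]"] that by (simp add: comp_def)
  interpret capelli_row x a k "column_length (k # \<nu>)" "vac ?f"
  proof
    have pol: "polarization ((code \<circ> x) i) ((code \<circ> x) j) ?f =
        of_nat (if i = j then column_length (k # \<nu>) i else 0) * ?f" if "i \<le> j" "j < k" for i j
      unfolding f by (rule polarization_canonical_tableau[OF inj']) (use le that in auto)
    show "eop (x i) (x j) (vac ?f) = 0" if "i < j" "j < k" for i j
      using pol[of i j] that by (simp add: eop_vac np)
    show "eop (x i) (x i) (vac ?f) = smul (of_nat (column_length (k # \<nu>) i)) (vac ?f)" if "i < k" for i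
      using pol[of i i] that by (simp add: eop_vac np vac_smul)
  qed (use np inj in auto)
  have "vac (bideterminant (map (code \<circ> x) [0..<k]) * h) =
      wact (map (\<lambda>y. (y, Pos a)) (map x [0..<k])) (wact (map (\<lambda>a'. (Pos a, a')) (map x [0..<k])) (vac ?f))"
    by (rule row[of x, OF np(1), symmetric])
  also have "\<dots> = smul ?c (vac ?f)"
    using capelli by (simp only: map_map comp_def)
  finally have "(vac (bideterminant (map (code \<circ> x) [0..<k]) * h) :: ('p, 'd) smod) = smul ?c (vac ?f)" .
  then have "bideterminant (map (code \<circ> x) [0..<k]) * h = bideterminant (map (code \<circ> x) [0..<k]) * (?c * T)"
    by (simp only: vac_smul vac_inject mult.left_commute)
  moreover have "bideterminant (map (code \<circ> x) [0..<k]) \<noteq> (0 :: (nat, 'd) polys)"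
    using inj' k by (intro bideterminant_nonzero) (auto simp: distinct_map atLeast0LessThan)
  ultimately have "h = ?c * T" by (simp only: mult_cancel_left simp_thms)
  then show ?thesis
    using row[of y, OF np(2)] by (simp only: vac_smul mult.left_commute)
qed

text \<open>Reordering the words brings the lowering and raising of the first row next to the
  polynomial, where \<open>row_exchange\<close> applies. The minor so created is a scalar for the
  other rows, to which the induction hypothesis applies.\<close>

lemma canonical_tableau_action:
  fixes x y :: "nat \<Rightarrow> ('p::finite, 'q::finite, 'l::finite) symbol"
  assumes nonpos: "\<And>i. \<not> is_pos (x i)" "\<And>i. \<not> is_pos (y i)"
    and inj: "inj_on x {..<K}" and disj: "\<And>i j. i < K \<Longrightarrow> j < K \<Longrightarrow> x i \<noteq> y j" and K: "K \<le> CARD('d::{finite, linorder})"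
    and "\<And>k. k \<in> set \<nu> \<Longrightarrow> k \<le> K" "sorted_wrt (\<ge>) \<nu>" "distinct as" "length as = length \<nu>"
  shows "wact (raise_word y as \<nu>) (wact (lower_word x as \<nu>) (vac (tableau_product (canonical_tableau (code \<circ> x) \<nu>) :: (nat, 'd) polys))) =
    smul ((- 1) ^ row_sign \<nu> * of_nat (hooks \<nu>)) (vac (tableau_product (canonical_tableau (code \<circ> y) \<nu>)))"
  using assms(6-)
proof (induction \<nu> arbitrary: as)
  case Nil
  then show ?case by (simp add: lower_word_def raise_word_def)
next
  case (Cons k \<nu> as')
  obtain a as where as: "as' = a # as" using Cons.prems(4) by (cases as') auto
  have prems: "k \<le> K" "\<And>m. m \<in> set \<nu> \<Longrightarrow> m \<le> K" "\<And>m. m \<in> set \<nu> \<Longrightarrow> m \<le> k" "sorted_wrt (\<ge>) \<nu>"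
    "distinct as" "a \<notin> set as" "length as = length \<nu>"
    using Cons.prems by (auto simp: as)
  let ?Q1 = "map (\<lambda>b. (Pos a, b)) (map x [0..<k])" and ?R1 = "map (\<lambda>b. (b, Pos a)) (map y [0..<k])"
  let ?Q = "lower_word x as \<nu>" and ?R = "raise_word y as \<nu>"
  let ?T = "\<lambda>z. tableau_product (canonical_tableau (code \<circ> z) \<nu>) :: (nat, 'd) polys"
  let ?B = "\<lambda>z. bideterminant (map (code \<circ> z) [0..<k]) :: (nat, 'd) polys"
  let ?s = "(- 1) ^ (k * sum_list \<nu>) :: (nat, 'd) polys"
  have np: "(Pos p :: ('p, 'q, 'l) symbol) \<noteq> x i" "Pos p \<noteq> y i" "x i \<noteq> Pos p" "y i \<noteq> Pos p" for p i
    using nonpos(1)[of i] nonpos(2)[of i] by (metis is_pos_simps(1))+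
  have in_Q: "\<exists>p\<in>set as. \<exists>i<K. c = Pos p \<and> d = x i" if "(c, d) \<in> set ?Q" for c d
    using that prems(2) by (rule in_lower_word)
  have in_R: "\<exists>p\<in>set as. \<exists>i<K. c = y i \<and> d = Pos p" if "(c, d) \<in> set ?R" for c d
    using that prems(2) by (rule in_raise_word)
  have in_Q1: "\<exists>i<K. c = Pos a \<and> d = x i" if "(c, d) \<in> set ?Q1" for c d
  proof -
    from that obtain i where "i < k" "c = Pos a" "d = x i" by auto
    then show ?thesis using prems(1) by (intro exI[of _ i]) simp
  qed
  have in_R1: "\<exists>i<K. c = y i \<and> d = Pos a" if "(c, d) \<in> set ?R1" for c d
  proof -
    from that obtain i where "i < k" "d = Pos a" "c = y i" by auto
    then show ?thesis using prems(1) by (intro exI[of _ i]) simp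
  qed
  have "anticommuting ?R1 ?R"
    by (rule anticommutingI) (drule in_R1, drule in_R, use nonpos np in auto)
  then have 1: "wact ?R1 (wact ?R G) = smul ?s (wact ?R (wact ?R1 G))" for G :: "('p, 'd) smod"
    by (simp only: wact_swap length_map length_upt diff_zero length_words(2)[OF prems(7)])
  have "anticommuting ?Q1 ?Q"
    by (rule anticommutingI) (drule in_Q1, drule in_Q, use nonpos np in auto)
  then have 2: "wact ?Q1 (wact ?Q G) = smul ?s (wact ?Q (wact ?Q1 G))" for G :: "('p, 'd) smod"
    by (simp only: wact_swap length_map length_upt diff_zero length_words(1)[OF prems(7)])
  \<comment> \<open>Distinctness of the positive symbols rules out one contraction, disjointness of
    the alphabets x and y the other.\<close>
  have "anticommuting ?R1 ?Q"
    by (rule anticommutingI) (drule in_R1, drule in_Q, use nonpos np disj[THEN not_sym] prems(6) in auto)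
  then have 3: "wact ?R1 (wact ?Q G) = smul ?s (wact ?Q (wact ?R1 G))" for G :: "('p, 'd) smod"
    by (simp only: wact_swap length_map length_upt diff_zero length_words(1)[OF prems(7)])
  let ?c = "(- 1) ^ triangle k * of_nat (\<Prod>i<k. column_length (k # \<nu>) i + (k - 1 - i)) :: (nat, 'd) polys"
  have row: "wact ?R1 (wact ?Q1 (vac (?B x * ?T x))) = smul (?c * ?B y) (vac (?T x))"
    using row_exchange[where 'd = 'd, of x y k \<nu> a] nonpos inj_on_subset[OF inj, of "{..<k}"] prems(1,3) K
    by (simp only: lessThan_subset_iff vac_smul mult.assoc order_trans[OF prems(1) K] simp_thms)
  have inert_c: "inert b ?c" for b :: "('p, 'q, 'l) symbol"
  proof -
    have "inert b (p * q)" if "inert b p" "inert b q" for p q :: "(nat, 'd) polys"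
      using that by (auto simp: inert_def pdiff_mult)
    then show ?thesis by (metis inert_sign inert_of_nat)
  qed
  \<comment> \<open>The remaining words differentiate only by positive symbols and by letters x j,
    while the new minor has letters y only.\<close>
  have inert_B: "inert b (?c * ?B y)" if bx: "is_pos b \<or> (\<exists>j<K. b = x j)" for b :: "('p, 'q, 'l) symbol"
  proof (cases "is_pos b")
    case False
    then obtain j where j: "j < K" "b = x j" using bx by blast
    then have "code b \<notin> set (map (code \<circ> y) [0..<k])"
      using disj prems(1) nonpos by (auto simp: code_eq_iff)
    then have "pdiff (code b) t (?B y) = 0" for t by (intro pdiff_bideterminant_0) simp
    then show ?thesis using inert_c[of b] False by (auto simp: inert_def pdiff_mult)
  qed (simp add: inert_def)
  have "wact (raise_word y as' (k # \<nu>)) (wact (lower_word x as' (k # \<nu>)) (vac (tableau_product (canonical_tableau (code \<circ> x) (k # \<nu>))))) =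
      wact ?R1 (wact ?R (wact ?Q1 (wact ?Q (vac (?B x * ?T x)))))"
    by (simp only: as word_Cons wact_append canonical_tableau_simps tableau_product_simps)
  \<comment> \<open>Three exchanges turn R1 R Q1 Q into R Q R1 Q1. They have the same sign, so two
    of them cancel.\<close>
  also have "\<dots> = smul ?s (smul ?s (smul ?s (wact ?R (wact ?Q (wact ?R1 (wact ?Q1 (vac (?B x * ?T x))))))))"
    by (simp only: 1 2 3 wact_smul_sign)
  also have "\<dots> = smul ?s (wact ?R (wact ?Q (wact ?R1 (wact ?Q1 (vac (?B x * ?T x))))))"
    by (simp add: power_add[symmetric])
  also have "wact ?R (wact ?Q (wact ?R1 (wact ?Q1 (vac (?B x * ?T x))))) = smul (?c * ?B y) (wact ?R (wact ?Q (vac (?T x))))"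
  proof -
    have "wact ?Q (smul (?c * ?B y) (vac (?T x))) = smul (?c * ?B y) (wact ?Q (vac (?T x)))"
      by (rule wact_smul, rule inert_B) (use in_Q in blast)
    moreover have "wact ?R (smul (?c * ?B y) G) = smul (?c * ?B y) (wact ?R G)" for G
      by (rule wact_smul, rule inert_B) (use in_R in fastforce)
    ultimately show ?thesis unfolding row by simp
  qed
  also have "wact ?R (wact ?Q (vac (?T x))) = smul ((- 1) ^ row_sign \<nu> * of_nat (hooks \<nu>)) (vac (?T y))"
    using Cons.IH prems by blast
  also have "smul ?s (smul (?c * ?B y) \<dots>) =
      smul ((- 1) ^ row_sign (k # \<nu>) * of_nat (hooks (k # \<nu>))) (vac (?B y * ?T y))"
    by (simp add: vac_smul power_add mult_ac)
  finally show ?case by (simp only: canonical_tableau_simps tableau_product_simps)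
qed

section \<open>Contents and conjugate partitions\<close>

text \<open>The number of cells in the first m columns, that is, the partial sums of the conjugate
  partition by which dominance is defined.\<close>

definition truncated_size :: "nat \<Rightarrow> nat list \<Rightarrow> nat"
  where "truncated_size m \<nu> = (\<Sum>k\<leftarrow>\<nu>. min m k)"

lemma truncated_size_Suc: "truncated_size (Suc m) \<nu> = truncated_size m \<nu> + column_length \<nu> m"
  by (induction \<nu>) (auto simp: truncated_size_def column_length_def)

lemma truncated_size_mono: "m \<le> n \<Longrightarrow> truncated_size m \<nu> \<le> truncated_size n \<nu>"
  unfolding truncated_size_def by (rule sum_list_mono) auto

lemma truncated_size_bound:
  assumes "\<And>k. k \<in> set \<nu> \<Longrightarrow> k \<le> K"
  shows "truncated_size m \<nu> = truncated_size (min m K) \<nu>"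
  unfolding truncated_size_def by (intro arg_cong[where f = sum_list] map_cong refl) (use assms in \<open>force simp: min_def\<close>)

lemma length_filter_concat: "length (filter P (concat Z)) = (\<Sum>r\<leftarrow>Z. length (filter P r))"
  by (induction Z) auto

lemma length_filter_distinct_le:
  assumes "distinct r" "inj_on f {..<m}"
  shows "length (filter (\<lambda>a. a \<in> f ` {..<m}) r) \<le> min m (length r)"
proof -
  have "length (filter (\<lambda>a. a \<in> f ` {..<m}) r) = card (set (filter (\<lambda>a. a \<in> f ` {..<m}) r))"
    by (rule distinct_card[symmetric]) (simp add: assms(1))
  also have "\<dots> \<le> card (f ` {..<m})" by (intro card_mono) auto
  also have "\<dots> = m" using assms(2) by (simp add: card_image)
  finally show ?thesis by simp
qed

lemma length_filter_canonical:
  assumes "inj_on f {..<K}" "m \<le> K" "k \<le> K"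
  shows "length (filter (\<lambda>a. a \<in> f ` {..<m}) (map f [0..<k])) = min m k"
proof -
  have "filter (\<lambda>i. f i \<in> f ` {..<m}) [0..<k] = filter (\<lambda>i. i < m) [0..<k]"
  proof (intro filter_cong refl)
    fix i assume "i \<in> set [0..<k]"
    then show "f i \<in> f ` {..<m} \<longleftrightarrow> i < m"
      using inj_on_image_mem_iff[OF assms(1), of i "{..<m}"] assms(2,3) by auto
  qed
  also have "length \<dots> = card {i. i < k \<and> i < m}"
    by (simp add: length_filter_conv_card cong: conj_cong)
  also have "{i. i < k \<and> i < m} = {..<min m k}" by auto
  finally show ?thesis by (simp add: filter_map comp_def)
qed

lemma canonical_filter_count:
  assumes "inj_on f {..<K}" "m \<le> K" "\<And>k. k \<in> set \<nu> \<Longrightarrow> k \<le> K"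
  shows "length (filter (\<lambda>a. a \<in> f ` {..<m}) (concat (canonical_tableau f \<nu>))) = truncated_size m \<nu>"
proof -
  have "map (\<lambda>r. length (filter (\<lambda>a. a \<in> f ` {..<m}) r)) (canonical_tableau f \<nu>) = map (min m) \<nu>"
    using assms length_filter_canonical[OF assms(1,2)] by (simp add: canonical_tableau_def)
  then show ?thesis by (simp add: length_filter_concat truncated_size_def)
qed

lemma mset_length_filter: "mset xs = mset ys \<Longrightarrow> length (filter P xs) = length (filter P ys)"
  by (metis mset_filter size_mset)

text \<open>Count the letters f 0, ..., f (m-1). A row of Z with distinct entries holds at most min
  m (its length) of them, and the canonical tableau attains this bound in every row. Replacing m by
  \<open>min m K\<close> keeps to the range where f is injective.\<close>

lemma truncated_size_le:
  assumes "mset (concat Z) = mset (concat (canonical_tableau f \<nu>))" "\<And>r. r \<in> set Z \<Longrightarrow> distinct r"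
    and "inj_on f {..<K}" "\<And>k. k \<in> set \<nu> \<Longrightarrow> k \<le> K"
  shows "truncated_size m \<nu> \<le> truncated_size m (map length Z)"
proof -
  let ?m = "min m K"
  have inj: "inj_on f {..<?m}" using assms(3) by (rule inj_on_subset) auto
  have "truncated_size m \<nu> = truncated_size ?m \<nu>" using assms(4) by (rule truncated_size_bound)
  also have "\<dots> = length (filter (\<lambda>a. a \<in> f ` {..<?m}) (concat Z))"
    using canonical_filter_count[OF assms(3) min.cobounded2 assms(4)] mset_length_filter[OF assms(1)] by metis
  also have "\<dots> \<le> truncated_size ?m (map length Z)"
    unfolding length_filter_concat truncated_size_def map_map comp_def
    by (rule sum_list_mono) (use length_filter_distinct_le[OF assms(2) inj] in blast)
  also have "\<dots> \<le> truncated_size m (map length Z)" by (rule truncated_size_mono) simp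
  finally show ?thesis .
qed

lemma sum_list_eq_pointwise:
  fixes f g :: "'a \<Rightarrow> nat"
  assumes "\<And>x. x \<in> set xs \<Longrightarrow> f x \<le> g x" "(\<Sum>x\<leftarrow>xs. f x) = (\<Sum>x\<leftarrow>xs. g x)" "x \<in> set xs"
  shows "f x = g x"
  using assms
proof (induction xs)
  case (Cons y xs)
  have "(\<Sum>x\<leftarrow>xs. f x) \<le> (\<Sum>x\<leftarrow>xs. g x)" by (rule sum_list_mono) (use Cons.prems(1) in auto)
  moreover have "f y \<le> g y" using Cons.prems(1) by simp
  ultimately have "f y = g y" "(\<Sum>x\<leftarrow>xs. f x) = (\<Sum>x\<leftarrow>xs. g x)" using Cons.prems(2) by auto
  then show ?case using Cons by auto
qed simp

lemma strict_sorted_nth_element: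
  assumes "k \<le> CARD('a::{finite, linorder})"
  shows "sorted_wrt (<) (map (nth_element :: nat \<Rightarrow> 'a) [0..<k])"
proof -
  have "map (nth_element :: nat \<Rightarrow> 'a) [0..<k] = take k (sorted_list_of_set UNIV)"
    using assms by (intro nth_equalityI) (simp_all add: nth_element_def)
  moreover have "sorted_wrt (<) (sorted_list_of_set (UNIV :: 'a set))" by simp
  ultimately show ?thesis by (simp add: sorted_wrt_take)
qed

text \<open>For a row r let m be its length. By content, the total number of the m smallest letters
  in T attains the sum of the row bounds, so each row attains its own; thus r consists of exactly
  the m smallest letters, and strictness fixes their order.\<close>

lemma row_strict_canonical:
  fixes T :: "'a::{finite, linorder} list list"
  assumes T: "T \<in> row_strict_tableaux \<nu>" and ms: "mset (concat T) = mset (concat (canonical_tableau nth_element \<nu>))"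
    and le: "\<And>k. k \<in> set \<nu> \<Longrightarrow> k \<le> CARD('a)"
  shows "T = canonical_tableau nth_element \<nu>"
proof -
  have \<nu>: "\<nu> = map length T" and strict: "\<And>r. r \<in> set T \<Longrightarrow> sorted_wrt (<) r"
    using T by (auto simp: row_strict_tableaux_def tableaux_def)
  have "r = map nth_element [0..<length r]" if r: "r \<in> set T" for r
  proof -
    let ?f = "nth_element :: nat \<Rightarrow> 'a" and ?k = "length r"
    have k: "?k \<le> CARD('a)" using le r by (simp add: \<nu>)
    have inj: "inj_on ?f {..<?k}" using inj_on_nth_element by (rule inj_on_subset) (use k in auto)
    have dist: "distinct s" if "s \<in> set T" for s using strict[OF that] by (simp add: strict_sorted_iff)
    have "length (filter (\<lambda>a. a \<in> ?f ` {..<?k}) (concat T)) = truncated_size ?k \<nu>"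
      using mset_length_filter[OF ms] canonical_filter_count[OF inj_on_nth_element k le] by (rule trans)
    also have "\<dots> = (\<Sum>s\<leftarrow>T. min ?k (length s))"
      by (simp add: \<nu> truncated_size_def comp_def)
    finally have eq: "(\<Sum>s\<leftarrow>T. length (filter (\<lambda>a. a \<in> ?f ` {..<?k}) s)) = (\<Sum>s\<leftarrow>T. min ?k (length s))"
      by (simp only: length_filter_concat)
    have len: "length (filter (\<lambda>a. a \<in> ?f ` {..<?k}) r) = min ?k (length r)"
      by (rule sum_list_eq_pointwise[OF length_filter_distinct_le[OF dist inj] eq r])
    have sub: "set r \<subseteq> ?f ` {..<?k}"
    proof (rule ccontr)
      assume "\<not> set r \<subseteq> ?f ` {..<?k}"
      then obtain a where "a \<in> set r" "a \<notin> ?f ` {..<?k}" by blast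
      then have "length (filter (\<lambda>a. a \<in> ?f ` {..<?k}) r) < length r" by (rule length_filter_less)
      with len show False by simp
    qed
    have "set r = ?f ` {..<?k}"
      using dist[OF r] inj by (intro card_subset_eq sub) (simp_all add: distinct_card card_image)
    then have "set r = set (map ?f [0..<?k])" by (simp add: atLeast0LessThan)
    then show ?thesis
      using strict[OF r] strict_sorted_nth_element[OF k] by (intro strict_sorted_equal) auto
  qed
  then show ?thesis unfolding canonical_tableau_def \<nu> map_map comp_def by (intro map_idI[symmetric]) simp
qed

section \<open>Conjugate partitions\<close>

lemma down_closed_eq:
  fixes S :: "nat set"
  assumes "finite S" "\<And>i j. i \<in> S \<Longrightarrow> j < i \<Longrightarrow> j \<in> S"
  shows "S = {..<card S}"
proof (rule card_seteq[symmetric])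
  show "{..<card S} \<subseteq> S"
  proof
    fix i assume "i \<in> {..<card S}"
    show "i \<in> S"
    proof (rule ccontr)
      assume "i \<notin> S"
      then have "S \<subseteq> {..<i}" using assms(2) by (metis lessThan_iff linorder_neqE_nat subsetI)
      then have "card S \<le> i" using card_mono[of "{..<i}" S] by simp
      then show False using \<open>i \<in> {..<card S}\<close> by simp
    qed
  qed
qed (use assms in auto)

lemma partition_antimono:
  assumes "is_partition lam" "i \<le> j" "j < length lam"
  shows "lam ! j \<le> lam ! i"
  using assms by (cases "i = j") (auto simp: is_partition_def sorted_wrt_iff_nth_less)

text \<open>Since the parts decrease, the rows longer than j form an initial segment, which its
  cardinality determines.\<close>

lemma less_conjugate_iff:
  assumes "is_partition lam"
  shows "i < card {i. i < length lam \<and> j < lam ! i} \<longleftrightarrow> i < length lam \<and> j < lam ! i"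
proof -
  let ?S = "{i. i < length lam \<and> j < lam ! i}"
  have "?S = {..<card ?S}"
    by (rule down_closed_eq) (auto dest: partition_antimono[OF assms less_imp_le])
  then have "i \<in> {..<card ?S} \<longleftrightarrow> i \<in> ?S" by simp
  then show ?thesis by simp
qed

lemma row_length_le: "is_partition lam \<Longrightarrow> row_length lam i \<le> row_length lam 0"
  using partition_antimono[of lam 0 i] by (auto simp: row_length_def)

lemma column_length_conjugate:
  assumes "is_partition lam"
  shows "column_length (conjugate_partition lam) i = row_length lam i"
proof -
  have "column_length (conjugate_partition lam) i = card {j. j < row_length lam 0 \<and> i < length lam \<and> j < lam ! i}"
    unfolding column_length_def conjugate_partition_def filter_map length_map comp_def less_conjugate_iff[OF assms]
    by (simp add: length_filter_conv_card cong: conj_cong)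
  also have "{j. j < row_length lam 0 \<and> i < length lam \<and> j < lam ! i} = {..<row_length lam i}"
    using row_length_le[OF assms, of i] by (auto simp: row_length_def)
  finally show ?thesis by simp
qed

lemma card_eq_column_length: "card {i. i < length \<nu> \<and> j < \<nu> ! i} = column_length \<nu> j"
  by (simp add: column_length_def length_filter_conv_card)

lemma conjugate_eq: "conjugate_partition \<nu> = map (column_length \<nu>) [0..<row_length \<nu> 0]"
  by (simp add: conjugate_partition_def card_eq_column_length)

lemma conjugate_le: "k \<in> set (conjugate_partition lam) \<Longrightarrow> k \<le> length lam"
  by (auto simp: conjugate_eq column_length_def)

lemma row_length_pos: "is_partition lam \<Longrightarrow> i < length lam \<longleftrightarrow> 0 < row_length lam i"
  by (auto simp: row_length_def is_partition_def in_set_conv_nth intro: gr0I)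

lemma conjugate_partition_partition:
  assumes "is_partition lam"
  shows "is_partition (conjugate_partition lam)"
proof -
  have "column_length lam j \<le> column_length lam i" if "i < j" for i j
    unfolding column_length_def using that by (induction lam) auto
  then have "sorted_wrt (\<ge>) (conjugate_partition lam)"
    by (auto simp: conjugate_eq sorted_wrt_iff_nth_less)
  moreover have pos: "0 < column_length lam j" if "j < row_length lam 0" for j
    using less_conjugate_iff[OF assms, of 0 j] that
    by (auto simp: card_eq_column_length row_length_def split: if_splits)
  have "0 \<notin> set (conjugate_partition lam)"
  proof
    assume "0 \<in> set (conjugate_partition lam)"
    then obtain j where "j < row_length lam 0" "column_length lam j = 0" by (auto simp: conjugate_eq)
    with pos[of j] show False by simp
  qed
  ultimately show ?thesis by (simp add: is_partition_def)
qed

lemma row_length_conjugate_0: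
  assumes "is_partition lam"
  shows "row_length (conjugate_partition lam) 0 = length lam"
proof (cases "lam = []")
  case True
  then show ?thesis by (simp add: conjugate_partition_def row_length_def)
next
  case False
  then have "0 < row_length lam 0" using row_length_pos[OF assms, of 0] by simp
  moreover have "column_length lam 0 = length lam"
    using assms by (simp add: column_length_def is_partition_def) (metis filter_True gr0I)
  ultimately show ?thesis by (simp add: conjugate_eq row_length_def[of "map _ _"])
qed

lemma conjugate_conjugate:
  assumes "is_partition lam"
  shows "conjugate_partition (conjugate_partition lam) = lam"
proof -
  have "map (row_length lam) [0..<length lam] = lam"
    by (rule nth_equalityI) (simp_all add: row_length_def)
  then show ?thesis
    unfolding conjugate_eq[of "conjugate_partition lam"] row_length_conjugate_0[OF assms]
    by (simp add: column_length_conjugate[OF assms] cong: map_cong)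
qed

lemma conjugate_cell_iff:
  assumes "is_partition lam"
  shows "j < length (conjugate_partition lam) \<and> i < conjugate_partition lam ! j \<longleftrightarrow> i < length lam \<and> j < lam ! i"
proof -
  have "j < length (conjugate_partition lam) \<and> i < conjugate_partition lam ! j \<longleftrightarrow>
      j < row_length lam 0 \<and> i < length lam \<and> j < lam ! i"
    using less_conjugate_iff[OF assms, of i j] by (auto simp: conjugate_partition_def)
  then show ?thesis
    using row_length_le[OF assms, of i] by (auto simp: row_length_def split: if_splits)
qed

section \<open>Transposition of diagrams and hook lengths\<close>

lemma bij_betw_swap_cells:
  assumes "is_partition lam"
  defines "\<nu> \<equiv> conjugate_partition lam"
  shows "bij_betw prod.swap (SIGMA j:{..<length \<nu>}. {..<\<nu> ! j}) (SIGMA i:{..<length lam}. {..<lam ! i})"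
proof (rule bij_betwI[where g = prod.swap])
  show "prod.swap \<in> (SIGMA j:{..<length \<nu>}. {..<\<nu> ! j}) \<rightarrow> (SIGMA i:{..<length lam}. {..<lam ! i})"
  proof
    fix x assume "x \<in> (SIGMA j:{..<length \<nu>}. {..<\<nu> ! j})"
    then obtain j i where "x = (j, i)" "j < length \<nu> \<and> i < \<nu> ! j" by auto
    then show "prod.swap x \<in> (SIGMA i:{..<length lam}. {..<lam ! i})"
      using conjugate_cell_iff[OF assms(1), of j i] by (simp add: \<nu>_def)
  qed
  show "prod.swap \<in> (SIGMA i:{..<length lam}. {..<lam ! i}) \<rightarrow> (SIGMA j:{..<length \<nu>}. {..<\<nu> ! j})"
  proof
    fix x assume "x \<in> (SIGMA i:{..<length lam}. {..<lam ! i})"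
    then obtain i j where "x = (i, j)" "i < length lam \<and> j < lam ! i" by auto
    then show "prod.swap x \<in> (SIGMA j:{..<length \<nu>}. {..<\<nu> ! j})"
      using conjugate_cell_iff[OF assms(1), of j i] by (simp add: \<nu>_def)
  qed
qed auto

lemma sum_list_conjugate:
  assumes "is_partition lam"
  shows "sum_list (conjugate_partition lam) = sum_list lam"
proof -
  let ?\<nu> = "conjugate_partition lam"
  have *: "sum_list \<mu> = card (SIGMA i:{..<length \<mu>}. {..<\<mu> ! i})" for \<mu> :: "nat list"
    by (simp add: card_SigmaI sum_list_sum_nth atLeast0LessThan)
  show ?thesis unfolding * by (rule bij_betw_same_card[OF bij_betw_swap_cells[OF assms]])
qed

text \<open>Transposition exchanges the arm and the leg of each cell.\<close>

lemma hook_product_conjugate: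
  assumes "is_partition lam"
  shows "hook_product (conjugate_partition lam) = hook_product lam"
proof -
  let ?\<nu> = "conjugate_partition lam"
  let ?h = "\<lambda>\<mu> i j. \<mu> ! i - j - 1 + (conjugate_partition \<mu> ! j - i - 1) + 1 :: nat"
  have *: "hook_product \<mu> = (\<Prod>(i, j)\<in>(SIGMA i:{..<length \<mu>}. {..<\<mu> ! i}). ?h \<mu> i j)" for \<mu>
    unfolding hook_product_def by (rule prod.Sigma) auto
  have "(\<Prod>(i, j)\<in>(SIGMA i:{..<length ?\<nu>}. {..<?\<nu> ! i}). ?h ?\<nu> i j) =
      (\<Prod>x\<in>(SIGMA i:{..<length ?\<nu>}. {..<?\<nu> ! i}). case prod.swap x of (i, j) \<Rightarrow> ?h lam i j)"
    by (intro prod.cong refl) (auto simp: conjugate_conjugate[OF assms])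
  also have "\<dots> = (\<Prod>(i, j)\<in>(SIGMA i:{..<length lam}. {..<lam ! i}). ?h lam i j)"
    by (rule prod.reindex_bij_betw[OF bij_betw_swap_cells[OF assms]])
  finally show ?thesis unfolding * .
qed

lemma hook_product_pos: "hook_product lam > 0"
  unfolding hook_product_def by (intro prod_pos ballI) simp

text \<open>Deleting the first row shortens each column of a remaining cell by one and moves that
  cell up by one, so its leg, arm and hook are unchanged.\<close>

lemma hook_product_Cons:
  assumes "is_partition (k # \<nu>)"
  shows "hook_product (k # \<nu>) = (\<Prod>i<k. column_length (k # \<nu>) i + (k - 1 - i)) * hook_product \<nu>"
proof -
  have le: "m \<le> k" if "m \<in> set \<nu>" for m using assms that by (auto simp: is_partition_def)
  have cl: "column_length (k # \<nu>) j = Suc (column_length \<nu> j)" if "j < k" for j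
    using that by (simp add: column_length_def)
  have c1: "conjugate_partition (k # \<nu>) ! j = column_length (k # \<nu>) j" if "j < k" for j
    using that by (simp add: conjugate_eq row_length_def)
  have c2: "conjugate_partition \<nu> ! j = column_length \<nu> j" if "j < \<nu> ! i" "i < length \<nu>" for i j
  proof -
    have "is_partition \<nu>" using assms by (simp add: is_partition_def)
    then have "j < row_length \<nu> 0" using that row_length_le[of \<nu> i] by (simp add: row_length_def)
    then show ?thesis by (simp add: conjugate_eq)
  qed
  have "hook_product (k # \<nu>) = (\<Prod>j<k. k - j - 1 + (conjugate_partition (k # \<nu>) ! j - 1) + 1) *
      (\<Prod>i<length \<nu>. \<Prod>j<\<nu> ! i. \<nu> ! i - j - 1 + (conjugate_partition (k # \<nu>) ! j - Suc i - 1) + 1)"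
    unfolding hook_product_def by (simp only: length_Cons prod.lessThan_Suc_shift) simp
  also have "(\<Prod>j<k. k - j - 1 + (conjugate_partition (k # \<nu>) ! j - 1) + 1) = (\<Prod>i<k. column_length (k # \<nu>) i + (k - 1 - i))"
    by (rule prod.cong) (simp_all add: c1 cl)
  also have "(\<Prod>i<length \<nu>. \<Prod>j<\<nu> ! i. \<nu> ! i - j - 1 + (conjugate_partition (k # \<nu>) ! j - Suc i - 1) + 1) = hook_product \<nu>"
    unfolding hook_product_def
  proof (intro prod.cong refl)
    fix i j assume ij: "i \<in> {..<length \<nu>}" "j \<in> {..<\<nu> ! i}"
    then have "j < k" using le[of "\<nu> ! i"] by simp
    then show "\<nu> ! i - j - 1 + (conjugate_partition (k # \<nu>) ! j - Suc i - 1) + 1 =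
        \<nu> ! i - j - 1 + (conjugate_partition \<nu> ! j - i - 1) + 1"
      using ij by (simp add: c1 cl c2)
  qed
  finally show ?thesis .
qed

lemma hooks_eq_hook_product: "is_partition \<nu> \<Longrightarrow> hooks \<nu> = hook_product \<nu>"
proof (induction \<nu>)
  case Nil
  then show ?case by (simp add: hook_product_def)
next
  case (Cons k \<nu>)
  then have "is_partition \<nu>" by (simp add: is_partition_def)
  then show ?case using Cons by (simp only: hooks.simps hook_product_Cons)
qed

lemma partition_eqI:
  assumes "is_partition lam" "is_partition mu" "\<And>i. row_length lam i = row_length mu i"
  shows "lam = mu"
proof (rule nth_equalityI)
  have "i < length lam \<longleftrightarrow> i < length mu" for i
    using row_length_pos[OF assms(1)] row_length_pos[OF assms(2)] assms(3) by simp
  then show "length lam = length mu" by (meson linorder_neqE_nat less_irrefl)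
  then show "lam ! i = mu ! i" if "i < length lam" for i
    using assms(3)[of i] that by (simp add: row_length_def)
qed

section \<open>The action of double Young-Capelli bitableaux\<close>

lemma C_star_eq:
  fixes \<alpha> :: "nat \<Rightarrow> 'p"
  shows "(C_star \<alpha> \<nu> :: ('p, 'q, 'l) symbol list list) = alpha_rows (map \<alpha> [0..<length \<nu>]) \<nu>"
proof -
  have "(alpha_rows as \<nu> :: ('p, 'q, 'l) symbol list list) = map (\<lambda>r. replicate (\<nu> ! r) (Pos (as ! r))) [0..<length \<nu>]" if "length as = length \<nu>" for as
    using that
  proof (induction as \<nu> rule: alpha_rows.induct)
    case (1 a as k \<nu>)
    then show ?case by (simp del: upt_Suc add: map_upt_Suc)
  qed auto
  from this[of "map \<alpha> [0..<length \<nu>]"] show ?thesis by (simp add: C_star_def cong: map_cong)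
qed

lemma D_star_eq: "D_star \<beta> \<nu> = canonical_tableau (Neg \<circ> \<beta>) \<nu>"
  by (simp add: D_star_def canonical_tableau_def)

lemma proper_canonical_tableau:
  "proper_tableau (canonical_tableau f \<nu>) = canonical_tableau (\<lambda>i. Proper (Letter (f i))) \<nu>"
  by (simp add: proper_tableau_def canonical_tableau_def)

lemma length_concat_C_star: "length (concat (C_star \<alpha> \<nu>)) = sum_list \<nu>"
  unfolding C_star_eq by (rule length_concat_alpha_rows) simp

lemma length_concat_D_star: "length (concat (D_star \<beta> \<nu>)) = sum_list \<nu>"
  unfolding D_star_eq by (rule length_concat_canonical_tableau)

lemma length_concat_proper_tableau: "T \<in> tableaux \<nu> \<Longrightarrow> length (concat (proper_tableau T)) = sum_list \<nu>"
  by (auto simp: proper_tableau_def tableaux_def length_concat comp_def)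

text \<open>The lists c and d occur equally often in first and in second place, while s and t
  contain no virtual symbols.\<close>

lemma balanced_double_word:
  assumes "length s = length c" "length d = length c" "length t = length c"
    and "\<And>a. a \<in> set s \<Longrightarrow> \<not> virtual a" "\<And>a. a \<in> set t \<Longrightarrow> \<not> virtual a"
  shows "balanced (zip s c @ zip c d @ zip d c @ zip c t)"
proof -
  have "count_list s \<gamma> = 0" "count_list t \<gamma> = 0" if "virtual \<gamma>" for \<gamma>
    using assms(4,5) that by (auto simp: count_list_0_iff)
  then show ?thesis using assms by (simp add: balanced_def)
qed

lemma emb_act_double_young_capelli:
  fixes \<alpha> :: "nat \<Rightarrow> 'p::finite" and \<beta> :: "nat \<Rightarrow> 'q::finite" and S T :: "'l::finite list list"
    and f :: "('l, 'd::finite) polys"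
  assumes "S \<in> tableaux \<nu>" "T \<in> tableaux \<nu>"
  defines "C \<equiv> concat (C_star \<alpha> \<nu>) :: ('p, 'q, 'l) symbol list" and "D \<equiv> concat (D_star \<beta> \<nu>)"
  shows "emb (act (double_young_capelli \<alpha> \<beta> \<nu> S T) f) =
    wact (zip (concat (proper_tableau S)) C) (wact (zip C D) (wact (zip D C) (wact (zip C (concat (proper_tableau T))) (emb f))))"
proof -
  let ?s = "concat (proper_tableau S) :: ('p, 'q, 'l) symbol list" and ?t = "concat (proper_tableau T) :: ('p, 'q, 'l) symbol list"
  have len: "length ?s = sum_list \<nu>" "length ?t = sum_list \<nu>" "length C = sum_list \<nu>" "length D = sum_list \<nu>"
    unfolding C_def D_def
    by (simp_all only: length_concat_C_star length_concat_D_star length_concat_proper_tableau assms(1,2))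
  let ?w = "zip ?s C @ zip C D @ zip D C @ zip C ?t"
  have "balanced ?w"
    by (rule balanced_double_word, simp_all only: len) (auto simp: proper_tableau_def virtual_def)
  then have "emb (act (devirt (e_word ?w)) f) = sact (e_word ?w) (emb f)"
    by (intro emb_act_devirt balanced_virt_alg)
  moreover have "double_young_capelli \<alpha> \<beta> \<nu> S T = devirt (e_word ?w)"
    by (simp add: double_young_capelli_def e_tableau_def C_def D_def e_word_append mult.assoc)
  ultimately show ?thesis by (simp add: sact_e_word wact_append)
qed

lemma rename_bideterminant:
  "rename (map_prod \<rho> id) (bideterminant r) = bideterminant (map \<rho> r)"
proof -
  interpret comm_ring_hom "rename (map_prod \<rho> id)" by (rule rename_hom)
  have "rename (map_prod \<rho> id) (det (mat (length r) (length r) (\<lambda>(s, t). poly_var (r ! s) (nth_element t)))) =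
      det (map_mat (rename (map_prod \<rho> id)) (mat (length r) (length r) (\<lambda>(s, t). poly_var (r ! s) (nth_element t))))"
    by (rule hom_det[symmetric])
  also have "map_mat (rename (map_prod \<rho> id)) (mat (length r) (length r) (\<lambda>(s, t). poly_var (r ! s) (nth_element t))) =
      mat (length r) (length r) (\<lambda>(s, t). poly_var (map \<rho> r ! s) (nth_element t))"
    by (rule eq_matI) (simp_all add: rename_var)
  finally show ?thesis by (simp only: bideterminant_def length_map)
qed

lemma rename_tableau_product:
  "rename (map_prod \<rho> id) (tableau_product X) = tableau_product (map (map \<rho>) X)"
  by (induction X) (simp_all only: list.map tableau_product_simps rename_1 rename_mult rename_bideterminant)

lemma emb_hw_vector:
  "emb (hw_vector \<epsilon> mu :: ('l::{finite, linorder}, 'd::{finite, linorder}) polys) = smul (poly_const (\<epsilon> mu))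
    (vac (tableau_product (canonical_tableau (proper_code \<circ> (nth_element :: nat \<Rightarrow> 'l)) (conjugate_partition mu))))"
proof -
  have "map (map proper_code) (map (\<lambda>k. map (nth_element :: nat \<Rightarrow> 'l) [0..<k]) (conjugate_partition mu)) =
      canonical_tableau (proper_code \<circ> (nth_element :: nat \<Rightarrow> 'l)) (conjugate_partition mu)"
    by (simp add: canonical_tableau_def)
  then show ?thesis
    unfolding hw_vector_def emb_simps by (simp only: emb_def rename_tableau_product)
qed

lemma wact_smul_const: "wact w (smul (poly_const c) F) = smul (poly_const c) (wact w F)"
  by (rule wact_smul) simp

lemma mset_eqI_count_list: "(\<And>n. count_list xs n = count_list ys n) \<Longrightarrow> mset xs = mset ys"
  by (simp add: multiset_eq_iff count_mset)

lemma canonical_tableau_comp: "map (map g) (canonical_tableau f \<nu>) = canonical_tableau (g \<circ> f) \<nu>"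
  by (simp add: canonical_tableau_def)

lemma map_concat_canonical_tableau: "map g (concat (canonical_tableau f \<nu>)) = concat (canonical_tableau (g \<circ> f) \<nu>)"
  by (simp add: map_concat canonical_tableau_comp)

lemma mset_map_inj: "inj g \<Longrightarrow> mset (map g xs) = mset (map g ys) \<Longrightarrow> mset xs = mset ys"
  by (metis injD mset_map multiset.inj_map)

text \<open>Comparing contents: a nonzero contribution forces \<open>T\<close> to have content \<open>mu\<close> and the resulting
  bitableaux, of shape \<open>conjugate_partition mu\<close>, to have content \<open>lam\<close> and distinct entries in each row.
  This yields dominance in both directions.\<close>

lemma lower_vanishes:
  fixes \<alpha> :: "nat \<Rightarrow> 'p::finite" and \<beta> :: "nat \<Rightarrow> 'q::finite" and T :: "'l::{finite, linorder} list list"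
    and lam mu :: "nat list"
  defines "\<nu> \<equiv> conjugate_partition lam" and "\<rho> \<equiv> conjugate_partition mu"
  defines "C \<equiv> concat (C_star \<alpha> \<nu>) :: ('p, 'q, 'l) symbol list" and "D \<equiv> concat (D_star \<beta> \<nu>)"
  assumes part: "is_partition lam" "is_partition mu" and T: "T \<in> row_strict_tableaux \<nu>"
    and len: "length lam \<le> CARD('l)" "length mu \<le> CARD('l)" and inj: "inj_on \<beta> {..<length lam}"
    and le: "sum_list mu \<le> sum_list lam" and neq: "\<not> (lam = mu \<and> T = canonical_tableau nth_element \<nu>)"
  shows "wact (zip D C) (wact (zip C (concat (proper_tableau T)))
    (vac (tableau_product (canonical_tableau (proper_code \<circ> (nth_element :: nat \<Rightarrow> 'l)) \<rho>) :: (nat, 'd::{finite, linorder}) polys))) = 0"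
proof -
  let ?f = "nth_element :: nat \<Rightarrow> 'l" and ?c = "code :: ('p, 'q, 'l) symbol \<Rightarrow> nat"
  let ?V = "canonical_tableau (proper_code \<circ> ?f) \<rho>" and ?t = "concat (proper_tableau T) :: ('p, 'q, 'l) symbol list"
  define g where "g = ?c \<circ> (Neg \<circ> \<beta>)"
  have T': "map length T = \<nu>" "\<And>r. r \<in> set T \<Longrightarrow> distinct r"
    using T by (auto simp: row_strict_tableaux_def tableaux_def strict_sorted_iff)
  have lens: "length ?t = sum_list \<nu>" "length C = sum_list \<nu>" "length D = sum_list \<nu>"
    using T unfolding C_def D_def row_strict_tableaux_def
    by (simp_all add: length_concat_C_star length_concat_D_star length_concat_proper_tableau)
  have codes_t: "map ?c ?t = map proper_code (concat T)"
    by (simp add: proper_tableau_def map_concat comp_def code_Proper)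
  have codes_D: "map ?c D = concat (canonical_tableau g \<nu>)"
    by (simp add: D_def D_star_eq map_concat_canonical_tableau g_def)
  define \<kappa> where "\<kappa> = (\<lambda>n. int (count_list (concat ?V) n) + letter_count D n - letter_count ?t n)"
  have "wact (zip D C) (wact (zip C ?t) (vac (tableau_product ?V :: (nat, 'd) polys))) \<in>
      vac_bispan (map length ?V) (\<lambda>n. int (count_list (concat ?V) n) + letter_count (map fst (zip D C)) n - letter_count (map snd (zip C ?t)) n)"
  proof (rule wact_contract_bispan)
    show "\<exists>q \<alpha>. x = (Neg q, Pos \<alpha>)" if "x \<in> set (zip D C)" for x
    proof -
      obtain a b where x: "x = (a, b)" by fastforce
      have "a \<in> set D" "b \<in> set C" using that by (auto simp: x dest: set_zip_leftD set_zip_rightD)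
      then show ?thesis by (auto simp: x D_def D_star_def C_def C_star_def)
    qed
    show "\<exists>\<alpha> i. x = (Pos \<alpha>, Proper i)" if "x \<in> set (zip C ?t)" for x
    proof -
      obtain a b where x: "x = (a, b)" by fastforce
      have "a \<in> set C" "b \<in> set ?t" using that by (auto simp: x dest: set_zip_leftD set_zip_rightD)
      then show ?thesis by (auto simp: x C_def C_star_def proper_tableau_def)
    qed
  qed (simp_all add: lens tableau_product_bispan)
  also have "(\<lambda>n. int (count_list (concat ?V) n) + letter_count (map fst (zip D C)) n - letter_count (map snd (zip C ?t)) n) = \<kappa>"
    using lens by (simp add: \<kappa>_def)
  finally obtain p where p: "p \<in> bispan (map length ?V) \<kappa>"
    and eq: "wact (zip D C) (wact (zip C ?t) (vac (tableau_product ?V))) = vac (p :: (nat, 'd) polys)"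
    unfolding vac_bispan_def by blast
  have "p = 0"
  proof (rule bispan_trivial[OF p], rule ccontr)
    fix X assume shape: "map length X = map length ?V"
      and cnt: "\<And>n. int (count_list (concat X) n) = \<kappa> n" and "\<not> (\<exists>r\<in>set X. \<not> distinct r)"
    then have dist: "\<And>r. r \<in> set X \<Longrightarrow> distinct r" by blast
    have shape': "map length X = \<rho>" using shape by (simp add: canonical_tableau_def comp_def)
    \<comment> \<open>Moving the subtracted content to the other side gives an identity of
      multisets.\<close>
    have "count_list (concat X @ map proper_code (concat T)) n =
        count_list (concat ?V @ concat (canonical_tableau g \<nu>)) n" for n
      using cnt[of n] by (simp add: \<kappa>_def letter_count_def codes_t codes_D)
    then have ms: "mset (concat X @ map proper_code (concat T)) = mset (concat ?V @ concat (canonical_tableau g \<nu>))"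
      by (rule mset_eqI_count_list)
    have V: "concat ?V = map proper_code (concat (canonical_tableau ?f \<rho>))"
      by (simp add: map_concat_canonical_tableau)
    \<comment> \<open>The parity of the codes splits this identity into one for proper letters and
      one for negative symbols.\<close>
    have even: "filter even (map proper_code xs) = map proper_code xs" "filter odd (map proper_code xs) = []"
      for xs :: "'l list" by (auto simp: proper_code_def filter_empty_conv)
    have "odd (g i)" for i by (simp add: g_def code_def)
    then have odd: "filter even (concat (canonical_tableau g \<nu>)) = []"
        "filter odd (concat (canonical_tableau g \<nu>)) = concat (canonical_tableau g \<nu>)"
      by (auto simp: canonical_tableau_def filter_empty_conv)
    have ms_even: "mset (filter even (concat X)) + mset (map proper_code (concat T)) =
        mset (map proper_code (concat (canonical_tableau ?f \<rho>)))"
      using arg_cong[OF ms, of "filter_mset even"] by (simp only: mset_append filter_union_mset flip: mset_filter)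
        (simp only: V even odd mset_append mset.simps add_0_right)
    have ms_odd: "mset (filter odd (concat X)) = mset (concat (canonical_tableau g \<nu>))"
      using arg_cong[OF ms, of "filter_mset odd"] by (simp only: mset_append filter_union_mset flip: mset_filter)
        (simp only: V even odd mset_append mset.simps add_0_right add_0_left)
    have sizes: "sum_list \<rho> = sum_list mu" "sum_list \<nu> = sum_list lam"
      using sum_list_conjugate part by (simp_all add: \<rho>_def \<nu>_def)
    have "size (mset (filter even (concat X))) + sum_list \<nu> = sum_list \<rho>"
    proof -
      have "length (concat T) = sum_list \<nu>" using T'(1) by (simp add: length_concat)
      then show ?thesis
        using arg_cong[OF ms_even, of size]
        by (simp only: size_union size_mset length_map length_concat_canonical_tableau)
    qed
    \<comment> \<open>T has at least as many cells as the tableau of the highest weight vector, so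
      it uses up all proper letters and X has negative symbols only.\<close>
    then have "size (mset (filter even (concat X))) = 0" using le sizes by linarith
    then have no_even: "filter even (concat X) = []" by (simp only: size_eq_0_iff_empty mset_zero_iff)
    then have "filter odd (concat X) = concat X"
      by (simp add: filter_empty_conv filter_id_conv)
    then have msX: "mset (concat X) = mset (concat (canonical_tableau g \<nu>))" using ms_odd by simp
    have "mset (map proper_code (concat T)) = mset (map proper_code (concat (canonical_tableau ?f \<rho>)))"
      using ms_even no_even by simp
    then have msT: "mset (concat T) = mset (concat (canonical_tableau ?f \<rho>))"
      by (rule mset_map_inj[OF inj_proper_code])
    have le_\<rho>: "k \<le> CARD('l)" if "k \<in> set \<rho>" for k using conjugate_le[of k mu] that len by (simp add: \<rho>_def)
    have le_\<nu>: "k \<le> length lam" if "k \<in> set \<nu>" for k using conjugate_le[of k lam] that by (simp add: \<nu>_def)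
    have g: "inj_on g {..<length lam}" using inj by (auto simp: inj_on_def g_def code_def)
    \<comment> \<open>T has shape \<nu> and the content of the canonical tableau of \<rho>; X has
      shape \<rho> and the content of that of \<nu>. Each gives one inequality.\<close>
    have "truncated_size m \<rho> = truncated_size m \<nu>" for m
    proof (rule antisym)
      show "truncated_size m \<rho> \<le> truncated_size m \<nu>"
        using truncated_size_le[OF msT T'(2) inj_on_nth_element le_\<rho>] T'(1) by simp
      show "truncated_size m \<nu> \<le> truncated_size m \<rho>"
        using truncated_size_le[OF msX dist g le_\<nu>] shape' by simp
    qed
    \<comment> \<open>Column lengths are the successive differences of truncated sizes.\<close>
    then have "column_length \<rho> i = column_length \<nu> i" for i
      using truncated_size_Suc[of i \<rho>] truncated_size_Suc[of i \<nu>] by (metis add_left_cancel)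
    then have "row_length mu i = row_length lam i" for i
      using part by (simp add: \<rho>_def \<nu>_def column_length_conjugate)
    then have lm: "lam = mu" using part by (intro partition_eqI) auto
    then have "T = canonical_tableau ?f \<nu>"
      using msT le_\<rho> by (intro row_strict_canonical[OF T]) (simp_all add: \<rho>_def \<nu>_def)
    with lm neq show False by simp
  qed
  then show ?thesis using eq by simp
qed

section \<open>Evaluation on the highest weight vector\<close>

lemma act_0: "act 0 f = 0"
  using act_add[of 0 0 f] by simp

lemma act_sum: "act (\<Sum>i\<in>I. u i) f = (\<Sum>i\<in>I. act (u i) f)"
  by (induction I rule: infinite_finite_induct) (simp_all add: act_0 act_add)

lemma act_double_young_capelli_hw_vector:
  fixes \<alpha> :: "nat \<Rightarrow> 'p::finite" and \<beta> :: "nat \<Rightarrow> 'q::finite" and S :: "'l::{finite, linorder} list list"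
    and lam mu :: "nat list"
  defines "\<nu> \<equiv> conjugate_partition lam"
  assumes part: "is_partition lam" "is_partition mu" and S: "S \<in> row_strict_tableaux \<nu>"
    and len: "length lam \<le> CARD('l)" "length mu \<le> CARD('l)" "length lam \<le> CARD('d::{finite, linorder})"
    and inj: "inj_on \<alpha> {..<length \<nu>}" "inj_on \<beta> {..<length lam}"
    and le: "sum_list mu \<le> sum_list lam"
  shows "act (double_young_capelli \<alpha> \<beta> \<nu> S S) (hw_vector \<epsilon> mu :: ('l, 'd) polys) =
    (if lam = mu \<and> S = canonical_tableau nth_element \<nu> then of_nat (hook_product \<nu> ^ 2) * hw_vector \<epsilon> mu else 0)"
proof -
  let ?f = "nth_element :: nat \<Rightarrow> 'l" and ?v = "hw_vector \<epsilon> mu :: ('l, 'd) polys"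
  let ?C = "concat (C_star \<alpha> \<nu>) :: ('p, 'q, 'l) symbol list" and ?D = "concat (D_star \<beta> \<nu>) :: ('p, 'q, 'l) symbol list"
  let ?s = "concat (proper_tableau S) :: ('p, 'q, 'l) symbol list"
  let ?V = "\<lambda>\<rho>. vac (tableau_product (canonical_tableau (proper_code \<circ> ?f) \<rho>)) :: ('p, 'd) smod"
  have "S \<in> tableaux \<nu>" using S by (simp add: row_strict_tableaux_def)
  from emb_act_double_young_capelli[OF this this, of \<alpha> \<beta> ?v]
  have main: "emb (act (double_young_capelli \<alpha> \<beta> \<nu> S S) ?v) = smul (poly_const (\<epsilon> mu))
      (wact (zip ?s ?C) (wact (zip ?C ?D) (wact (zip ?D ?C) (wact (zip ?C ?s) (?V (conjugate_partition mu))))))"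
    by (simp only: emb_hw_vector wact_smul_const)
  show ?thesis
  proof (cases "lam = mu \<and> S = canonical_tableau nth_element \<nu>")
    case False
    then have "wact (zip ?D ?C) (wact (zip ?C ?s) (?V (conjugate_partition mu))) = 0"
      using lower_vanishes[OF part _ len(1,2) inj(2) le, of S \<alpha>, where 'd = 'd] S unfolding \<nu>_def by blast
    then have "emb (act (double_young_capelli \<alpha> \<beta> \<nu> S S) ?v) = (emb (0 :: ('l, 'd) polys) :: ('p, 'd) smod)"
      unfolding main by (simp add: emb_simps)
    then have "act (double_young_capelli \<alpha> \<beta> \<nu> S S) ?v = 0" by (simp only: emb_inject)
    then show ?thesis by (simp only: if_not_P[OF False])
  next
    case True
    define x where "x = (\<lambda>i. Proper (Letter (?f i)) :: ('p, 'q, 'l) symbol)"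
    define y where "y = (\<lambda>i. Neg (\<beta> i) :: ('p, 'q, 'l) symbol)"
    define as where "as = map \<alpha> [0..<length \<nu>]"
    have part\<nu>: "is_partition \<nu>" using part by (simp add: \<nu>_def conjugate_partition_partition)
    have words: "zip ?s ?C = raise_word x as \<nu>" "zip ?C ?s = lower_word x as \<nu>"
      "zip ?D ?C = raise_word y as \<nu>" "zip ?C ?D = lower_word y as \<nu>"
      using True by (simp_all add: raise_word_def lower_word_def C_star_eq D_star_eq proper_canonical_tableau
          x_def y_def as_def comp_def)
    have codes: "proper_code \<circ> ?f = code \<circ> x"
      by (simp add: x_def comp_def code_Proper)
    have as: "distinct as" "length as = length \<nu>"
      using inj(1) by (auto simp: as_def distinct_map atLeast0LessThan)
    have le_\<nu>: "k \<le> length lam" if "k \<in> set \<nu>" for k using conjugate_le[of k lam] that by (simp add: \<nu>_def)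
    have sorted: "sorted_wrt (\<ge>) \<nu>" using part\<nu> by (simp add: is_partition_def)
    have np: "\<And>i. \<not> is_pos (x i)" "\<And>i. \<not> is_pos (y i)" by (simp_all add: x_def y_def)
    have "inj_on ?f {..<length lam}" using inj_on_nth_element by (rule inj_on_subset) (use len in auto)
    then have injx: "inj_on x {..<length lam}" by (auto simp: inj_on_def x_def)
    have injy: "inj_on y {..<length lam}" using inj(2) by (auto simp: inj_on_def y_def)
    let ?h = "(- 1) ^ row_sign \<nu> * of_nat (hooks \<nu>) :: (nat, 'd) polys"
    have 1: "wact (raise_word y as \<nu>) (wact (lower_word x as \<nu>) (vac (tableau_product (canonical_tableau (code \<circ> x) \<nu>)))) =
        smul ?h (vac (tableau_product (canonical_tableau (code \<circ> y) \<nu>)))"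
      by (rule canonical_tableau_action[OF np injx _ len(3) le_\<nu> sorted as]) (simp_all add: x_def y_def)
    \<comment> \<open>The second half is the first one with the alphabets exchanged, hence has the
      same scalar, sign included.\<close>
    have 2: "wact (raise_word x as \<nu>) (wact (lower_word y as \<nu>) (vac (tableau_product (canonical_tableau (code \<circ> y) \<nu>)))) =
        smul ?h (vac (tableau_product (canonical_tableau (code \<circ> x) \<nu>)))"
      by (rule canonical_tableau_action[OF np(2,1) injy _ len(3) le_\<nu> sorted as]) (simp_all add: x_def y_def)
    have inert: "inert b ?h" for b :: "('p, 'q, 'l) symbol"
    proof -
      have "inert b (p * q)" if "inert b p" "inert b q" for p q :: "(nat, 'd) polys"
        using that by (auto simp: inert_def pdiff_mult)
      then show ?thesis using inert_sign inert_of_nat by blast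
    qed
    have "wact (zip ?s ?C) (wact (zip ?C ?D) (wact (zip ?D ?C) (wact (zip ?C ?s) (?V \<nu>)))) = smul (?h * ?h) (?V \<nu>)"
      unfolding words codes 1 by (simp only: wact_smul[OF inert] 2 smul_simps)
    also have "?h * ?h = poly_const (of_nat (hook_product \<nu> ^ 2))"
      by (simp add: hooks_eq_hook_product[OF part\<nu>] poly_const_of_nat power2_eq_square mult_ac)
        (simp add: poly_const_mult poly_const_of_nat)
    finally have eq: "wact (zip ?s ?C) (wact (zip ?C ?D) (wact (zip ?D ?C) (wact (zip ?C ?s) (?V \<nu>)))) =
      smul (poly_const (of_nat (hook_product \<nu> ^ 2))) (?V \<nu>)" .
    have mu: "conjugate_partition mu = \<nu>" using True by (simp add: \<nu>_def)
    have "emb (act (double_young_capelli \<alpha> \<beta> \<nu> S S) ?v) = (emb (poly_const (of_nat (hook_product \<nu> ^ 2)) * ?v) :: ('p, 'd) smod)"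
      unfolding main emb_simps emb_hw_vector mu eq smul_simps by (simp only: mult.commute)
    then have "act (double_young_capelli \<alpha> \<beta> \<nu> S S) ?v = poly_const (of_nat (hook_product \<nu> ^ 2)) * ?v"
      by (simp only: emb_inject)
    also have "poly_const (of_nat (hook_product \<nu> ^ 2)) = (of_nat (hook_product \<nu> ^ 2) :: ('l, 'd) polys)"
      by (rule poly_const_of_nat)
    finally show ?thesis by (simp only: if_P[OF True])
  qed
qed

lemma canonical_tableau_row_strict:
  assumes "\<And>k. k \<in> set \<nu> \<Longrightarrow> k \<le> CARD('a::{finite, linorder})"
  shows "canonical_tableau (nth_element :: nat \<Rightarrow> 'a) \<nu> \<in> row_strict_tableaux \<nu>"
  using strict_sorted_nth_element assms by (auto simp: row_strict_tableaux_def tableaux_def canonical_tableau_def comp_def)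

theorem theorem4p2:
  fixes \<alpha> :: "nat \<Rightarrow> 'p::finite"
    and \<beta> :: "nat \<Rightarrow> 'q::finite"
    and \<epsilon> :: "nat list \<Rightarrow> complex"
    and lam mu :: "nat list"
  assumes "is_partition lam" and "is_partition mu"
    and "row_length (conjugate_partition lam) 0 \<le> CARD('l::{finite, linorder})"
    and "row_length (conjugate_partition mu) 0 \<le> CARD('l)"
    and "row_length (conjugate_partition lam) 0 \<le> CARD('d::{finite, linorder})"
    and "row_length (conjugate_partition mu) 0 \<le> CARD('d)"
    and "inj_on \<alpha> {..<length (conjugate_partition lam)}"
    and "inj_on \<beta> {..<row_length (conjugate_partition lam) 0}"
    and "\<And>nu. \<epsilon> nu = 1 \<or> \<epsilon> nu = - 1"
  shows "(sum_list mu < sum_list lam \<longrightarrow>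
      act (schur_element \<alpha> \<beta> lam) (hw_vector \<epsilon> mu :: ('l, 'd) polys) = 0) \<and>
    (sum_list mu = sum_list lam \<longrightarrow>
      act (schur_element \<alpha> \<beta> lam) (hw_vector \<epsilon> mu :: ('l, 'd) polys) =
        of_bool (lam = mu) * of_nat (hook_product lam) * hw_vector \<epsilon> lam)"
proof -
  let ?\<nu> = "conjugate_partition lam" and ?v = "hw_vector \<epsilon> mu :: ('l, 'd) polys"
  \<comment> \<open>One formula covers both claims: a strict inequality of sizes excludes lam = mu
    and makes the right-hand side zero.\<close>
  have "act (schur_element \<alpha> \<beta> lam) ?v = of_bool (lam = mu) * of_nat (hook_product lam) * hw_vector \<epsilon> lam"
    if le: "sum_list mu \<le> sum_list lam"
  proof (cases "lam = []")
    case True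
    then have "mu = []" using le assms(2) by (cases mu) (auto simp: is_partition_def)
    then show ?thesis using True by (simp add: schur_element_def act_1 hook_product_def)
  next
    case False
    note len = assms(3-6,8)[unfolded row_length_conjugate_0[OF assms(1)] row_length_conjugate_0[OF assms(2)]]
    let ?T = "row_strict_tableaux ?\<nu> :: 'l list list set" and ?S = "canonical_tableau (nth_element :: nat \<Rightarrow> 'l) ?\<nu>"
    let ?H = "hook_product ?\<nu>"
    \<comment> \<open>The only tableau that contributes belongs to the index set because lam has at
      most n rows, so n letters suffice to fill each row of its conjugate strictly.\<close>
    have "?S \<in> ?T" using conjugate_le len(1) by (intro canonical_tableau_row_strict) (meson le_trans)
    have "(\<Sum>S\<in>?T. act (double_young_capelli \<alpha> \<beta> ?\<nu> S S) ?v) =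
        (\<Sum>S\<in>?T. if S = ?S then of_bool (lam = mu) * of_nat (?H ^ 2) * hw_vector \<epsilon> lam else 0)"
      by (rule sum.cong[OF refl])
        (auto simp: act_double_young_capelli_hw_vector[OF assms(1,2) _ len(1,2,3) assms(7) len(5) le])
    also have "\<dots> = of_bool (lam = mu) * of_nat (?H ^ 2) * hw_vector \<epsilon> lam"
      using \<open>?S \<in> ?T\<close> by (simp add: finite_row_strict_tableaux)
    finally have "act (schur_element \<alpha> \<beta> lam) ?v =
        poly_const (1 / of_nat ?H) * (of_bool (lam = mu) * of_nat (?H ^ 2) * hw_vector \<epsilon> lam)"
      using False by (simp add: schur_element_def act_scale act_sum)
    also have "\<dots> = of_bool (lam = mu) * (poly_const (1 / of_nat ?H) * of_nat (?H ^ 2)) * hw_vector \<epsilon> lam"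
      by (simp add: mult_ac)
    also have "poly_const (1 / of_nat ?H) * of_nat (?H ^ 2) = (of_nat ?H :: ('l, 'd) polys)"
    proof -
      have of_nat: "poly_const (of_nat n) = (of_nat n :: ('l, 'd) polys)" for n
        by (induction n) (simp_all add: poly_const_add)
      have "(1 / of_nat ?H) * of_nat (?H ^ 2) = (of_nat ?H :: complex)"
        using hook_product_pos[of ?\<nu>] by (simp add: power2_eq_square)
      then show ?thesis by (simp only: of_nat[symmetric] poly_const_mult[symmetric])
    qed
    finally show ?thesis by (simp only: hook_product_conjugate[OF assms(1)])
  qed
  then show ?thesis by auto
qed

end
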